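(* For each $N\ge 2$ let $(X_n)_{0\le n\le N}$ be the edge-counting process of the growing random graph with $N$ vertices. As $N\to\infty$, the point process on $[0,\infty)$ with atoms $$\frac{\binom N2-X_N}{N\log N},\ \frac{\binom N2-X_{N-1}}{N\log N},\ \ldots,\ \frac{\binom N2-X_{1}}{N\log N}$$ (counted with multiplicity) converges weakly to a homogeneous Poisson process on $[0,\infty)$ with unit rate.
   Context: Growing random graph. Fix $N$. Initially there is a pool of $N$ virtual vertices and no edges. At each step, an element is selected uniformly at random from the current pool of virtual elements (vertices and edges), removed from the pool, and declared occupied. When the $n$-th vertex becomes occupied (it is then labelled $n$), the $n-1$ edges linking it to the previously occupied vertices $1,\dots,n-1$ are added to the pool as virtual edges. Thus when there are $n$ occupied vertices and $k$ occupied edges, the pool consists of $N-n$ virtual vertices and $\binom n2-k$ virtual edges. The process continues until the pool is empty (complete graph on $N$ vertices). For $1\le n\le N$, $X_n$ is the number of occupied edges at the moment the $n$-th vertex becomes occupied; $X_0=0$. The law of $(X_n)$ depends on $N$. Equivalently, $(X_n)$ is a Markov chain with $X_0=X_1=0$ such that, for $1\le n<N$, given $X_n=k$, the increment $X_{n+1}-X_n$ is the number of black balls drawn before the first white ball when sampling uniformly without replacement from an urn with $\binom n2-k$ black and $N-n$ white balls. Weak convergence of point processes means convergence in distribution as random locally finite counting measures on $[0,\infty)$ with the vague topology. *)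

theory Defs
  imports "HOL-Probability.Probability"
begin

section \<open>The growing random graph\<close>

text \<open>
  Vertices are named by \<open>{1..N}\<close>; the label of a vertex is its position in the order of
  occupation. An edge is the two-element set of the names of its end points.
\<close>

datatype element = Vertex nat | Edge "nat set"

text \<open>
  A history lists the elements selected so far, the most recent one first.
\<close>

primrec new_edges :: "element \<Rightarrow> element list \<Rightarrow> element set" where
  "new_edges (Vertex v) h = {Edge {u, v} | u. Vertex u \<in> set h}"
| "new_edges (Edge e) h = {}"

primrec pool :: "nat \<Rightarrow> element list \<Rightarrow> element set" where
  "pool N [] = Vertex ` {1..N}"
| "pool N (x # h) = (pool N h - {x}) \<union> new_edges x h"

definition grow_step :: "nat \<Rightarrow> element list \<Rightarrow> element list pmf" where
  "grow_step N h =
     (if pool N h = {} then return_pmf h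
      else map_pmf (\<lambda>x. x # h) (pmf_of_set (pool N h)))"

primrec grow :: "nat \<Rightarrow> nat \<Rightarrow> element list pmf" where
  "grow N 0 = return_pmf []"
| "grow N (Suc t) = bind_pmf (grow N t) (grow_step N)"

text \<open>
  The pool runs empty after exactly \<open>N + (N choose 2)\<close> steps, see
  \<open>pool_growing_graph\<close> below.
\<close>

definition growing_graph :: "nat \<Rightarrow> element list pmf" where
  "growing_graph N = grow N (N + (N choose 2))"

definition occupied_vertices :: "element list \<Rightarrow> nat" where
  "occupied_vertices h = card {v. Vertex v \<in> set h}"

definition occupied_edges :: "element list \<Rightarrow> nat" where
  "occupied_edges h = card {e. Edge e \<in> set h}"

text \<open>
  \<open>edge_count h n\<close> is \<open>X\<^sub>n\<close>: it searches back for the moment at which the \<open>n\<close>-th vertex was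
  selected.
\<close>

fun edge_count :: "element list \<Rightarrow> nat \<Rightarrow> nat" where
  "edge_count [] n = 0"
| "edge_count (Vertex v # h) n =
     (if occupied_vertices (Vertex v # h) = n then occupied_edges (Vertex v # h)
      else edge_count h n)"
| "edge_count (Edge e # h) n = edge_count h n"

lemma Vertex_set_Cons:
  "{v. Vertex v \<in> set (Vertex w # h)} = insert w {v. Vertex v \<in> set h}"
  "{v. Vertex v \<in> set (Edge e # h)} = {v. Vertex v \<in> set h}"
  "{d. Edge d \<in> set (Vertex w # h)} = {d. Edge d \<in> set h}"
  "{d. Edge d \<in> set (Edge e # h)} = insert e {d. Edge d \<in> set h}"
  by auto

lemma finite_occupied: "finite {v. Vertex v \<in> set h}" "finite {e. Edge e \<in> set h}"
proof -
  show "finite {v. Vertex v \<in> set h}"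
    using finite_vimageI[of "set h" Vertex] by (simp add: inj_def vimage_def)
  show "finite {e. Edge e \<in> set h}"
    using finite_vimageI[of "set h" Edge] by (simp add: inj_def vimage_def)
qed

definition valid_history :: "nat \<Rightarrow> element list \<Rightarrow> bool" where
  "valid_history N h \<longleftrightarrow>
     pool N h = (Vertex ` {1..N} \<union>
       {Edge {u, v} | u v. u \<noteq> v \<and> Vertex u \<in> set h \<and> Vertex v \<in> set h}) - set h \<and>
     distinct h \<and> {v. Vertex v \<in> set h} \<subseteq> {1..N} \<and>
     {e. Edge e \<in> set h} \<subseteq> {e. e \<subseteq> {v. Vertex v \<in> set h} \<and> card e = 2}"

lemma valid_history_Nil: "valid_history N []"
  by (auto simp: valid_history_def)

lemma valid_history_Cons:
  assumes v: "valid_history N h" and x: "x \<in> pool N h"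
  shows "valid_history N (x # h)"
proof -
  let ?C = "\<lambda>h. {Edge {u, v} | u v. u \<noteq> v \<and> Vertex u \<in> set h \<and> Vertex v \<in> set h}"
  have p: "pool N h = (Vertex ` {1..N} \<union> ?C h) - set h"
    and d: "distinct h" and V: "{v. Vertex v \<in> set h} \<subseteq> {1..N}"
    and E: "{e. Edge e \<in> set h} \<subseteq> {e. e \<subseteq> {v. Vertex v \<in> set h} \<and> card e = 2}"
    using v by (simp_all only: valid_history_def)
  have xn: "x \<notin> set h" using x by (simp add: p)
  show ?thesis
  proof (cases x)
    case (Vertex w)
    have w: "w \<in> {1..N}" using x unfolding p Vertex by blast
    have wn: "Vertex w \<notin> set h" using xn Vertex by simp
    have C: "?C (x # h) = ?C h \<union> new_edges x h"
    proof (intro set_eqI iffI)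
      fix y assume "y \<in> ?C (x # h)"
      then obtain u v where y: "y = Edge {u, v}" "u \<noteq> v"
          "Vertex u \<in> set (x # h)" "Vertex v \<in> set (x # h)" by blast
      consider "u = w" "Vertex v \<in> set h" | "v = w" "Vertex u \<in> set h"
        | "Vertex u \<in> set h" "Vertex v \<in> set h"
        using y Vertex by fastforce
      then show "y \<in> ?C h \<union> new_edges x h"
      proof cases
        case 1
        then have "y = Edge {v, w}" using y by (simp add: insert_commute)
        then show ?thesis using 1 Vertex by (simp, blast)
      next
        case 2
        then show ?thesis using y Vertex by (simp, blast)
      next
        case 3
        then show ?thesis using y by blast
      qed
    next
      fix y assume "y \<in> ?C h \<union> new_edges x h"
      then consider "y \<in> ?C h" | u where "y = Edge {u, w}" "Vertex u \<in> set h"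
        using Vertex by auto
      then show "y \<in> ?C (x # h)"
      proof cases
        case 1
        then show ?thesis by fastforce
      next
        case (2 u)
        then have "u \<noteq> w" "Vertex u \<in> set (x # h)" "Vertex w \<in> set (x # h)"
          using wn Vertex by auto
        then show ?thesis using 2(1) by blast
      qed
    qed
    have n: "new_edges x h \<inter> set h = {}"
    proof (rule ccontr)
      assume "new_edges x h \<inter> set h \<noteq> {}"
      then obtain u where "Edge {u, w} \<in> set h" using Vertex by auto
      then have "{u, w} \<subseteq> {v. Vertex v \<in> set h}" using E by blast
      then show False using wn by simp
    qed
    have xn': "x \<notin> new_edges x h" using Vertex by simp
    have "pool N (x # h) = (Vertex ` {1..N} \<union> ?C (x # h)) - set (x # h)"
      unfolding C pool.simps p using n xn' by (simp only: list.set) blast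
    moreover have "{v. Vertex v \<in> set (x # h)} \<subseteq> {1..N}"
      using V w unfolding Vertex Vertex_set_Cons by blast
    moreover have "{e. Edge e \<in> set (x # h)} \<subseteq>
        {e. e \<subseteq> {v. Vertex v \<in> set (x # h)} \<and> card e = 2}"
      using E unfolding Vertex Vertex_set_Cons by blast
    ultimately show ?thesis
      using d xn unfolding valid_history_def by simp
  next
    case (Edge e)
    have "Edge e \<in> ?C h" using x unfolding p Edge by blast
    then obtain a b where e: "e = {a, b}" "a \<noteq> b" "Vertex a \<in> set h" "Vertex b \<in> set h"
      by blast
    have C: "?C (x # h) = ?C h" unfolding Edge by simp
    have "pool N (x # h) = (Vertex ` {1..N} \<union> ?C (x # h)) - set (x # h)"
      unfolding C pool.simps p using Edge by (simp only: list.set new_edges.simps) blast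
    moreover have "{v. Vertex v \<in> set (x # h)} \<subseteq> {1..N}"
      using V unfolding Edge Vertex_set_Cons .
    moreover have "{e. Edge e \<in> set (x # h)} \<subseteq>
        {e. e \<subseteq> {v. Vertex v \<in> set (x # h)} \<and> card e = 2}"
      using E e unfolding Edge Vertex_set_Cons by simp
    ultimately show ?thesis
      using d xn unfolding valid_history_def by simp
  qed
qed

lemma card_pool:
  assumes "valid_history N h"
  shows "occupied_vertices h \<le> N"
    and "occupied_edges h \<le> occupied_vertices h choose 2"
    and "finite (pool N h)"
    and "card (pool N h) =
      (N - occupied_vertices h) + ((occupied_vertices h choose 2) - occupied_edges h)"
proof -
  let ?V = "{v. Vertex v \<in> set h}" and ?E = "{e. Edge e \<in> set h}"
  let ?P = "{e. e \<subseteq> ?V \<and> card e = 2}"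
  note fin = finite_occupied[of h]
  have V: "?V \<subseteq> {1..N}" and E: "?E \<subseteq> ?P"
    using assms by (simp_all add: valid_history_def)
  have cP: "card ?P = card ?V choose 2"
    by (rule n_subsets[OF fin(1)])
  have finP: "finite ?P" using fin(1) by auto
  show "occupied_vertices h \<le> N"
    using card_mono[OF _ V] by (simp add: occupied_vertices_def)
  show "occupied_edges h \<le> occupied_vertices h choose 2"
    using card_mono[OF finP E] cP by (simp add: occupied_vertices_def occupied_edges_def)
  have eq: "pool N h = Vertex ` ({1..N} - ?V) \<union> Edge ` (?P - ?E)"
  proof -
    have "{Edge {u, v} | u v. u \<noteq> v \<and> Vertex u \<in> set h \<and> Vertex v \<in> set h} = Edge ` ?P"
      (is "?C = _")
    proof (intro set_eqI iffI)
      fix y assume "y \<in> ?C"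
      then obtain u v where "y = Edge {u, v}" "u \<noteq> v" "Vertex u \<in> set h" "Vertex v \<in> set h"
        by blast
      then show "y \<in> Edge ` ?P" by (intro image_eqI[of _ _ "{u, v}"]) simp_all
    next
      fix y assume "y \<in> Edge ` ?P"
      then obtain e where y: "y = Edge e" "e \<subseteq> ?V" "card e = 2" by blast
      then obtain u v where "e = {u, v}" "u \<noteq> v" unfolding card_2_iff by blast
      then show "y \<in> ?C" using y by blast
    qed
    then have "pool N h = (Vertex ` {1..N} \<union> Edge ` ?P) - set h"
      using assms unfolding valid_history_def by simp
    also have "\<dots> = Vertex ` ({1..N} - ?V) \<union> Edge ` (?P - ?E)"
      by blast
    finally show ?thesis .
  qed
  show "finite (pool N h)"
    unfolding eq using finP by simp
  have "card (pool N h) = card (Vertex ` ({1..N} - ?V)) + card (Edge ` (?P - ?E))"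
    unfolding eq by (rule card_Un_disjoint) (use finP in auto)
  also have "\<dots> = card ({1..N} - ?V) + card (?P - ?E)"
    by (simp add: card_image inj_on_def)
  also have "\<dots> = (N - card ?V) + (card ?P - card ?E)"
    using card_Diff_subset[OF fin(1) V] card_Diff_subset[OF fin(2) E] by simp
  finally show "card (pool N h) =
      (N - occupied_vertices h) + ((occupied_vertices h choose 2) - occupied_edges h)"
    by (simp add: cP occupied_vertices_def occupied_edges_def)
qed

lemma length_history:
  assumes "distinct h"
  shows "length h = occupied_vertices h + occupied_edges h"
proof -
  have "set h = Vertex ` {v. Vertex v \<in> set h} \<union> Edge ` {e. Edge e \<in> set h}" (is "_ = ?A \<union> ?B")
  proof (intro set_eqI iffI)
    fix x assume "x \<in> set h"
    then show "x \<in> ?A \<union> ?B" by (cases x rule: element.exhaust) auto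
  qed auto
  then have "card (set h) = card (?A \<union> ?B)" by (rule arg_cong)
  also have "\<dots> = card ?A + card ?B"
    by (rule card_Un_disjoint) (auto simp: finite_occupied)
  also have "\<dots> = occupied_vertices h + occupied_edges h"
    by (simp add: card_image inj_on_def occupied_vertices_def occupied_edges_def)
  finally show ?thesis using distinct_card[OF assms] by simp
qed

lemma set_pmf_grow:
  assumes "h \<in> set_pmf (grow N t)"
  shows "valid_history N h \<and> (pool N h = {} \<or> length h = t)"
  using assms
proof (induction t arbitrary: h)
  case 0
  then show ?case by (simp add: valid_history_Nil)
next
  case (Suc t)
  then obtain g where g: "g \<in> set_pmf (grow N t)" and h: "h \<in> set_pmf (grow_step N g)"
    by auto
  note IH = Suc.IH[OF g]
  show ?case
  proof (cases "pool N g = {}")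
    case True
    then show ?thesis using h IH by (simp add: grow_step_def)
  next
    case False
    then obtain x where "x \<in> pool N g" "h = x # g"
      using h card_pool(3)[of N g] IH by (auto simp: grow_step_def)
    then show ?thesis using IH False valid_history_Cons[of N g x] by simp
  qed
qed

lemma pool_growing_graph:
  assumes "h \<in> set_pmf (growing_graph N)"
  shows "pool N h = {}" "occupied_vertices h = N" "occupied_edges h = N choose 2"
proof -
  have v: "valid_history N h" and p: "pool N h = {} \<or> length h = N + (N choose 2)"
    using set_pmf_grow assms unfolding growing_graph_def by blast+
  note c = card_pool[OF v]
  have l: "length h = occupied_vertices h + occupied_edges h"
    using v length_history by (simp add: valid_history_def)
  have m: "occupied_vertices h choose 2 \<le> N choose 2"
    using c(1) by (rule binomial_right_mono)
  from p show e: "pool N h = {}"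
  proof
    assume "length h = N + (N choose 2)"
    with l c(1,2) m have "occupied_vertices h = N" "occupied_edges h = N choose 2" by linarith+
    with c(3,4) show ?thesis by simp
  qed
  then show "occupied_vertices h = N" using c by simp
  then show "occupied_edges h = N choose 2" using c e by simp
qed


section \<open>Point processes on the half-line\<close>

abbreviation half_line :: "real measure" where
  "half_line \<equiv> restrict_space borel {0..}"

definition point_measures :: "real measure set" where
  "point_measures = {\<mu>. sets \<mu> = sets half_line \<and>
     (\<forall>B\<in>sets half_line. bounded B \<longrightarrow> (\<exists>k::nat. emeasure \<mu> B = of_nat k))}"

text \<open>
  Test functions are continuous functions of compact support on \<open>{0..}\<close>; their values at
  negative arguments play no role.
\<close>

definition test_functions :: "(real \<Rightarrow> real) set" where
  "test_functions = {f. continuous_on {0..} f \<and>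
     (\<exists>K. compact K \<and> K \<subseteq> {0..} \<and> (\<forall>x\<in>{0..} - K. f x = 0))}"

definition vague_topology :: "real measure topology" where
  "vague_topology = topology_generated_by
     {{\<mu> \<in> point_measures. (\<integral>x. f x \<partial>\<mu>) \<in> U} | f U. f \<in> test_functions \<and> open U}"

lemma topspace_vague_topology: "topspace vague_topology = point_measures"
proof -
  have "(\<lambda>_. 0) \<in> test_functions"
    unfolding test_functions_def by (auto intro!: exI[of _ "{}"])
  then have "point_measures \<in>
      {{\<mu> \<in> point_measures. (\<integral>x. f x \<partial>\<mu>) \<in> U} | f U. f \<in> test_functions \<and> open U}"
    by (force intro!: exI[of _ "\<lambda>_. 0"] exI[of _ "UNIV"])
  then show ?thesis
    unfolding vague_topology_def topology_generated_by_topspace by blast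
qed

definition borel_measure_of :: "'s topology \<Rightarrow> 's measure" where
  "borel_measure_of T = sigma (topspace T) {U. openin T U}"

definition converges_in_distribution ::
  "'s topology \<Rightarrow> (nat \<Rightarrow> 'a measure) \<Rightarrow> (nat \<Rightarrow> 'a \<Rightarrow> 's) \<Rightarrow> 'b measure \<Rightarrow> ('b \<Rightarrow> 's) \<Rightarrow> bool" where
  "converges_in_distribution T Ms X M Y \<longleftrightarrow>
     (\<forall>n. prob_space (Ms n) \<and> X n \<in> measurable (Ms n) (borel_measure_of T)) \<and>
     prob_space M \<and> Y \<in> measurable M (borel_measure_of T) \<and>
     (\<forall>F. continuous_map T euclideanreal F \<and> bounded (F ` topspace T) \<longrightarrow>
        (\<lambda>n. \<integral>\<omega>. F (X n \<omega>) \<partial>Ms n) \<longlonglongrightarrow> (\<integral>\<omega>. F (Y \<omega>) \<partial>M))"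

definition homogeneous_poisson_process :: "real \<Rightarrow> 'a measure \<Rightarrow> ('a \<Rightarrow> real measure) \<Rightarrow> bool" where
  "homogeneous_poisson_process r M \<xi> \<longleftrightarrow>
     prob_space M \<and> \<xi> \<in> measurable M (borel_measure_of vague_topology) \<and>
     (\<forall>B\<in>sets half_line. bounded B \<longrightarrow>
        (\<forall>k::nat. measure M {\<omega> \<in> space M. measure (\<xi> \<omega>) B = real k} =
           (r * measure lborel B) ^ k / fact k * exp (- (r * measure lborel B)))) \<and>
     (\<forall>(B :: nat \<Rightarrow> real set) m.
        (\<forall>i<m. B i \<in> sets half_line \<and> bounded (B i)) \<and> disjoint_family_on B {..<m} \<longrightarrow>
        prob_space.indep_vars M (\<lambda>_. borel) (\<lambda>i \<omega>. measure (\<xi> \<omega>) (B i)) {..<m})"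

text \<open>
  Image of the counting measure on \<open>{1..N}\<close> under \<open>n \<mapsto> ((N choose 2) - X\<^sub>n) / (N log N)\<close>, so
  that equal atoms are counted with multiplicity.
\<close>

definition scaled_point_process :: "nat \<Rightarrow> element list \<Rightarrow> real measure" where
  "scaled_point_process N h =
     distr (count_space {1..N}) half_line
       (\<lambda>n. (real (N choose 2) - real (edge_count h n)) / (real N * ln (real N)))"

end

theory Submission
  imports Defs
begin

text \<open>
  Let \<open>w\<close> vertices be unoccupied and let \<open>y\<close> be the number of edges not occupied yet. Up to the
  \<open>O(w N)\<close> edges that are not virtual yet, \<open>w\<close> white balls are mixed uniformly with \<open>y\<close> black ones, so
  on the scale \<open>L = N log N\<close> the remaining \<open>w\<close> atoms are \<open>w\<close> independent uniform points of
  \<open>[0, y / L]\<close>. For a weight \<open>g\<close> with primitive \<open>G\<close> the mean of the product of \<open>g\<close> over these atoms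
  is therefore close to \<open>(G \<eta> / \<eta>) ^ w\<close> with \<open>\<eta> = y / L\<close>. A second moment computation shows
  that \<open>y / L\<close> is close to \<open>w + 1\<close> for large fixed \<open>w\<close>, and if \<open>g = 1\<close> far out, then
  \<open>(1 - c / (w + 1)) ^ w\<close> tends to \<open>exp (- c)\<close> with \<open>c = \<integral>(1 - g)\<close>. For step functions \<open>g\<close> this is the
  joint generating function of the Poisson counts of the cells of a grid. Moving every atom to the
  left end of its cell changes a vaguely continuous function little, uniformly on tight sets of
  point measures, which turns convergence of the cell counts into weak convergence.
\<close>

section \<open>The chain of unoccupied edges\<close>

text \<open>The scale comes from the growth of the pool per remaining vertex. Occupying the (i+1)-st
  vertex adds i edges to a pool shared by N - i vertices, so the ratio grows on average by i / (N -
  i). Down to m remaining vertices these terms add up to N (H_N - H_m) + O(N) with harmonic numbers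
  H_n, which is asymptotic to N log N for every fixed m. The obstacle is that the bound 1 / (m + 1)
  on the relative variance does not vanish as N grows. Hence there are two limits: N to infinity at
  fixed m, then m to infinity. The atoms of the first N - m vertices need no description in between:
  the number of unoccupied edges only decreases, so if the state with m vertices left lies beyond
  the region where g differs from 1, all earlier atoms do too. Weak convergence is tested on
  arbitrary bounded vaguely continuous functionals, for which no modulus of continuity is given.
  This is why the comparison with the grid rests on sequential compactness instead of an explicit
  estimate.\<close>

text \<open>Mean of \<open>f r\<close>, where \<open>r\<close> black balls are left when the first white ball is drawn from an urn
  with \<open>w\<close> white and \<open>b\<close> black balls; the recursion conditions on the first draw.\<close>

primrec urn_mean :: "nat \<Rightarrow> (nat \<Rightarrow> real) \<Rightarrow> nat \<Rightarrow> real" where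
  "urn_mean w f 0 = f 0"
| "urn_mean w f (Suc b) =
     (real w * f (Suc b) + real (Suc b) * urn_mean w f b) / (real w + real (Suc b))"

text \<open>The edges that are not in the pool yet when \<open>w\<close> vertices are unoccupied. The state \<open>y\<close> below
  counts all unoccupied edges, so \<open>y - hidden_edges N w\<close> of them are virtual; smaller values of \<open>y\<close>
  are unreachable and get the value 0.\<close>

definition hidden_edges :: "nat \<Rightarrow> nat \<Rightarrow> nat" where
  "hidden_edges N w = (N choose 2) - ((N - w) choose 2)"

definition vertex_step :: "nat \<Rightarrow> nat \<Rightarrow> (nat \<Rightarrow> real) \<Rightarrow> nat \<Rightarrow> real" where
  "vertex_step N w f y =
     (if y < hidden_edges N w then 0
      else urn_mean w (\<lambda>r. f (r + hidden_edges N w)) (y - hidden_edges N w))"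

text \<open>Indexed by the vertices still unoccupied, that is, counted backwards from the end, so
  that \<open>w\<close> can stay fixed while \<open>N\<close> tends to infinity.\<close>

primrec product_mean :: "nat \<Rightarrow> (nat \<Rightarrow> real) \<Rightarrow> nat \<Rightarrow> nat \<Rightarrow> real" where
  "product_mean N g 0 y = 1"
| "product_mean N g (Suc w) y = vertex_step N (Suc w) (\<lambda>z. g z * product_mean N g w z) y"

lemma urn_mean_mono:
  assumes "\<And>r. r \<le> b \<Longrightarrow> f r \<le> g r"
  shows "urn_mean w f b \<le> urn_mean w g b"
  using assms
proof (induction b)
  case (Suc b)
  have "urn_mean w f b \<le> urn_mean w g b" using Suc by simp
  then show ?case
    using Suc.prems[of "Suc b"]
    by (auto intro!: divide_right_mono add_mono mult_left_mono)
qed auto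

lemma urn_mean_cong:
  assumes "\<And>r. r \<le> b \<Longrightarrow> f r = g r"
  shows "urn_mean w f b = urn_mean w g b"
  using assms by (induction b) auto

lemma urn_mean_const: "urn_mean w (\<lambda>_. c) b = c"
  by (induction b) (auto simp: field_simps)

lemma urn_mean_add: "urn_mean w (\<lambda>r. f r + g r) b = urn_mean w f b + urn_mean w g b"
  by (induction b) (simp_all add: algebra_simps flip: add_divide_distrib)

lemma urn_mean_scale: "urn_mean w (\<lambda>r. c * f r) b = c * urn_mean w f b"
  by (induction b) (auto simp: field_simps)

lemma vertex_step_mono:
  assumes "\<And>z. hidden_edges N w \<le> z \<Longrightarrow> z \<le> y \<Longrightarrow> f z \<le> g z"
  shows "vertex_step N w f y \<le> vertex_step N w g y"
  using assms unfolding vertex_step_def by (auto intro!: urn_mean_mono)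

lemma vertex_step_cong:
  assumes "\<And>z. hidden_edges N w \<le> z \<Longrightarrow> z \<le> y \<Longrightarrow> f z = g z"
  shows "vertex_step N w f y = vertex_step N w g y"
  using assms unfolding vertex_step_def by (auto intro!: urn_mean_cong)

lemma vertex_step_const:
  "vertex_step N w (\<lambda>_. c) y = (if y < hidden_edges N w then 0 else c)"
  by (simp add: vertex_step_def urn_mean_const)

lemma vertex_step_add:
  "vertex_step N w (\<lambda>z. f z + g z) y = vertex_step N w f y + vertex_step N w g y"
  by (simp add: vertex_step_def urn_mean_add)

lemma vertex_step_scale: "vertex_step N w (\<lambda>z. c * f z) y = c * vertex_step N w f y"
  by (simp add: vertex_step_def urn_mean_scale)

lemma vertex_step_bounds:
  assumes "\<And>z. 0 \<le> f z \<and> f z \<le> 1"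
  shows "0 \<le> vertex_step N w f y \<and> vertex_step N w f y \<le> 1"
  using vertex_step_mono[of N w y "\<lambda>_. 0" f] vertex_step_mono[of N w y f "\<lambda>_. 1"] assms
  by (auto simp: vertex_step_const split: if_splits)

lemma product_mean_bounds:
  assumes "\<And>z. 0 \<le> g z \<and> g z \<le> 1"
  shows "0 \<le> product_mean N g w y \<and> product_mean N g w y \<le> 1"
proof (induction w arbitrary: y)
  case (Suc w)
  have "0 \<le> g z * product_mean N g w z \<and> g z * product_mean N g w z \<le> 1" for z
    using Suc[of z] assms[of z] by (auto intro: mult_le_one)
  then show ?case by (simp add: vertex_step_bounds)
qed simp

section \<open>From histories of the graph to the urn recursion\<close>

lemma edge_count_Vertex_Cons:
  assumes "Vertex u \<notin> set h"
  shows "occupied_vertices (Vertex u # h) = Suc (occupied_vertices h)"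
    and "occupied_edges (Vertex u # h) = occupied_edges h"
    and "edge_count (Vertex u # h) n =
      (if n = Suc (occupied_vertices h) then occupied_edges h else edge_count h n)"
proof -
  show "occupied_vertices (Vertex u # h) = Suc (occupied_vertices h)"
    "occupied_edges (Vertex u # h) = occupied_edges h"
    using assms unfolding occupied_vertices_def occupied_edges_def Vertex_set_Cons
    by (simp_all add: finite_occupied)
  then show "edge_count (Vertex u # h) n =
      (if n = Suc (occupied_vertices h) then occupied_edges h else edge_count h n)"
    by auto
qed

lemma edge_count_Edge_Cons:
  assumes "Edge e \<notin> set h"
  shows "occupied_vertices (Edge e # h) = occupied_vertices h"
    and "occupied_edges (Edge e # h) = Suc (occupied_edges h)"
  using assms unfolding occupied_vertices_def occupied_edges_def Vertex_set_Cons
  by (simp_all add: finite_occupied)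

text \<open>A martingale along the growth of the graph.\<close>

definition graph_potential :: "nat \<Rightarrow> (nat \<Rightarrow> real) \<Rightarrow> element list \<Rightarrow> real" where
  "graph_potential N g h =
     (\<Prod>n=1..occupied_vertices h. g ((N choose 2) - edge_count h n)) *
     product_mean N g (N - occupied_vertices h) ((N choose 2) - occupied_edges h)"

lemma graph_potential_bounds:
  assumes "\<And>z. 0 \<le> g z \<and> g z \<le> 1"
  shows "0 \<le> graph_potential N g h \<and> graph_potential N g h \<le> 1"
  unfolding graph_potential_def using product_mean_bounds[OF assms] assms
  by (auto intro!: mult_nonneg_nonneg mult_le_one prod_nonneg prod_le_1)

text \<open>Drawing a vertex multiplies by \<open>g\<close> at the current state and leaves one
  vertex fewer; drawing an edge lowers the state by one. Weighted by the numbers of virtual vertices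
  and edges, these two values form the first-draw recursion of \<open>urn_mean\<close>, so averaging
  over the pool gives the potential back.\<close>

lemma sum_pool_graph_potential:
  assumes v: "valid_history N h"
  shows "(\<Sum>x\<in>pool N h. graph_potential N g (x # h)) =
    real (card (pool N h)) * graph_potential N g h"
proof -
  let ?v = "occupied_vertices h" and ?k = "occupied_edges h"
  let ?w = "N - ?v" and ?b = "(?v choose 2) - ?k"
  let ?V = "pool N h \<inter> range Vertex" and ?E = "pool N h \<inter> range Edge"
  let ?p = "\<Prod>n=1..?v. g ((N choose 2) - edge_count h n)"
  let ?y = "(N choose 2) - ?k"
  note c = card_pool[OF v]
  have p: "pool N h = (Vertex ` {1..N} \<union>
      {Edge {u, v} | u v. u \<noteq> v \<and> Vertex u \<in> set h \<and> Vertex v \<in> set h}) - set h"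
    using v by (simp add: valid_history_def)
  have V: "{v. Vertex v \<in> set h} \<subseteq> {1..N}" using v by (simp add: valid_history_def)
  have disj: "pool N h = ?V \<union> ?E" "?V \<inter> ?E = {}"
    by (auto intro: element.exhaust)
  have "?V = Vertex ` ({1..N} - {v. Vertex v \<in> set h})"
    unfolding p by auto
  then have cV: "card ?V = ?w"
    using card_Diff_subset[OF finite_occupied(1) V]
    by (simp add: card_image inj_on_def occupied_vertices_def)
  have cE: "card ?E = ?b"
    using c(4) card_Un_disjoint[of ?V ?E] disj c(3) cV by (simp add: finite_Int)
  have notin: "x \<notin> set h" if "x \<in> pool N h" for x using that unfolding p by blast
  have PV: "graph_potential N g (x # h) = ?p * (g ?y * product_mean N g (?w - 1) ?y)"
    if "x \<in> ?V" for x
  proof -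
    from that have "x \<in> range Vertex" by simp
    then obtain u where x: "x = Vertex u" by blast
    then have u: "Vertex u \<notin> set h" using notin that by blast
    show ?thesis
      unfolding x graph_potential_def edge_count_Vertex_Cons[OF u]
      by (simp add: prod.nat_ivl_Suc')
  qed
  have PE: "graph_potential N g (x # h) = ?p * product_mean N g ?w (?y - 1)" if "x \<in> ?E" for x
  proof -
    from that have "x \<in> range Edge" by simp
    then obtain e where x: "x = Edge e" by blast
    then have e: "Edge e \<notin> set h" using notin that by blast
    show ?thesis
      unfolding x graph_potential_def edge_count_Edge_Cons[OF e] by simp
  qed
  have "(\<Sum>x\<in>pool N h. graph_potential N g (x # h)) =
      (\<Sum>x\<in>?V. graph_potential N g (x # h)) + (\<Sum>x\<in>?E. graph_potential N g (x # h))"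
    using sum.union_disjoint[of ?V ?E] disj c(3) by (metis finite_Int)
  also have "\<dots> = ?p * (real ?w * (g ?y * product_mean N g (?w - 1) ?y)
      + real ?b * product_mean N g ?w (?y - 1))"
    by (simp add: PV PE cV cE algebra_simps)
  also have "real ?w * (g ?y * product_mean N g (?w - 1) ?y) + real ?b * product_mean N g ?w (?y - 1)
      = (real ?w + real ?b) * product_mean N g ?w ?y"
  \<comment> \<open>With no vertex left, \<open>product_mean\<close> is constantly 1 and only edge
    draws remain.\<close>
  proof (cases ?w)
    case 0
    then show ?thesis by simp
  next
    case (Suc w)
    have D: "hidden_edges N ?w = (N choose 2) - (?v choose 2)"
      using c(1) by (simp add: hidden_edges_def)
    have le: "?v choose 2 \<le> N choose 2" using c(1) by (rule binomial_right_mono)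
    have yb: "?y - hidden_edges N ?w = ?b" "?y \<ge> hidden_edges N ?w" 
      "?y = ?b + hidden_edges N ?w"
      unfolding D using c(2) le by auto
    let ?F = "\<lambda>r. g (r + hidden_edges N ?w) * product_mean N g w (r + hidden_edges N ?w)"
    have 1: "product_mean N g ?w ?y = urn_mean ?w ?F ?b"
      unfolding Suc product_mean.simps vertex_step_def using yb unfolding Suc by simp
    show ?thesis
    proof (cases ?b)
      case 0
      then show ?thesis unfolding 1 using yb Suc by simp
    next
      case b: (Suc b)
      have "product_mean N g ?w (?y - 1) = urn_mean ?w ?F b"
        unfolding Suc product_mean.simps vertex_step_def using yb b unfolding Suc by simp
      then show ?thesis unfolding 1 using yb(3) Suc b by (simp add: field_simps)
    qed
  qed
  also have "real ?w + real ?b = real (card (pool N h))" using c(4) by simp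
  finally show ?thesis by (simp add: graph_potential_def algebra_simps)
qed

lemma expectation_grow_step_potential:
  assumes v: "valid_history N h"
  shows "measure_pmf.expectation (grow_step N h) (graph_potential N g) = graph_potential N g h"
proof (cases "pool N h = {}")
  case False
  note c = card_pool[OF v]
  show ?thesis
    using sum_pool_graph_potential[OF v, of g] False c(3)
    by (simp add: grow_step_def integral_pmf_of_set)
qed (simp add: grow_step_def)

lemma expectation_grow_potential:
  assumes g: "\<And>z. 0 \<le> g z \<and> g z \<le> (1::real)"
  shows "measure_pmf.expectation (grow N t) (graph_potential N g) =
    product_mean N g N (N choose 2)"
proof (induction t)
  case 0
  then show ?case by (simp add: graph_potential_def occupied_vertices_def occupied_edges_def)
next
  case (Suc t)
  have "measure_pmf.expectation (grow N (Suc t)) (graph_potential N g) =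
      measure_pmf.expectation (grow N t)
        (\<lambda>h. measure_pmf.expectation (grow_step N h) (graph_potential N g))"
    unfolding grow.simps
    unfolding measure_pmf_bind
    by (intro integral_bind[where K="count_space UNIV" and B=1 and B'=1])
      (use graph_potential_bounds[OF g] in
        \<open>auto intro!: measurable_measure_pmf simp: measure_pmf.emeasure_space_1 measure_pmf_in_subprob_algebra\<close>)
  also have "\<dots> = measure_pmf.expectation (grow N t) (graph_potential N g)"
    by (intro integral_cong_AE)
      (auto simp: AE_measure_pmf_iff expectation_grow_step_potential dest: set_pmf_grow)
  finally show ?case using Suc by simp
qed

text \<open>The right-hand side is the potential of the empty history. Once the graph is complete,
  the factor \<open>product_mean\<close> is 1 and only the product over the vertices is
  left.\<close>

proposition expectation_growing_graph:
  assumes g: "\<And>z. 0 \<le> g z \<and> g z \<le> (1::real)"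
  shows "measure_pmf.expectation (growing_graph N)
      (\<lambda>h. \<Prod>n=1..N. g ((N choose 2) - edge_count h n)) = product_mean N g N (N choose 2)"
proof -
  have "measure_pmf.expectation (growing_graph N)
      (\<lambda>h. \<Prod>n=1..N. g ((N choose 2) - edge_count h n)) =
    measure_pmf.expectation (growing_graph N) (graph_potential N g)"
    by (intro integral_cong_AE)
      (auto simp: AE_measure_pmf_iff graph_potential_def dest: pool_growing_graph)
  then show ?thesis by (simp add: growing_graph_def expectation_grow_potential[OF g])
qed

section \<open>Concentration of the pool size\<close>

lemma hidden_edges_Suc:
  assumes "Suc w \<le> N"
  shows "hidden_edges N (Suc w) = hidden_edges N w + (N - Suc w)"
proof -
  obtain n where n: "N - Suc w = n" "N - w = Suc n" using assms by (metis Suc_diff_Suc Suc_le_lessD)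
  have "Suc n choose 2 = (n choose 2) + n" by (simp add: numeral_2_eq_2)
  moreover have "Suc n choose 2 \<le> N choose 2" using n by (intro binomial_right_mono) auto
  ultimately show ?thesis unfolding hidden_edges_def n by simp
qed

lemma hidden_edges_le: "w \<le> N \<Longrightarrow> hidden_edges N w \<le> w * N"
proof (induction w)
  case (Suc w)
  then show ?case using hidden_edges_Suc[of w N] by simp
qed (simp add: hidden_edges_def)

text \<open>Mean of \<open>f\<close> at the state after \<open>j\<close> vertices, weighted with \<open>g\<close> at the states visited.\<close>

primrec chain_mean :: "nat \<Rightarrow> (nat \<Rightarrow> real) \<Rightarrow> nat \<Rightarrow> (nat \<Rightarrow> real) \<Rightarrow> real" where
  "chain_mean N g 0 f = f (N choose 2)"
| "chain_mean N g (Suc j) f = chain_mean N g j (vertex_step N (N - j) (\<lambda>z. g z * f z))"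

lemma chain_mean_product_mean:
  "j \<le> N \<Longrightarrow> chain_mean N g j (product_mean N g (N - j)) = product_mean N g N (N choose 2)"
proof (induction j)
  case (Suc j)
  then have *: "N - j = Suc (N - Suc j)" by simp
  have "vertex_step N (N - j) (\<lambda>z. g z * product_mean N g (N - Suc j) z) = product_mean N g (N - j)"
    unfolding * by (intro ext) simp
  then show ?case using Suc by simp
qed simp

text \<open>A comparison on reachable states suffices: the step after \<open>j\<close> vertices ends
  at or above \<open>hidden_edges N (N - j)\<close>, which is at least
  \<open>hidden_edges N (N - Suc j)\<close>.\<close>

lemma chain_mean_mono:
  assumes "\<And>z. 0 \<le> g z" "j \<le> N" "\<And>z. hidden_edges N (N - j) \<le> z \<Longrightarrow> f z \<le> f' z"
  shows "chain_mean N g j f \<le> chain_mean N g j f'"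
  using assms(2,3)
proof (induction j arbitrary: f f')
  case 0
  then show ?case by (simp add: hidden_edges_def)
next
  case (Suc j)
  have le: "hidden_edges N (N - Suc j) \<le> hidden_edges N (N - j)"
    using hidden_edges_Suc[of "N - Suc j" N] Suc.prems(1) by (simp add: Suc_diff_Suc)
  show ?case
    using Suc.prems le assms(1) unfolding chain_mean.simps
    by (intro Suc.IH vertex_step_mono mult_left_mono) auto
qed

lemma chain_mean_cong:
  assumes "\<And>z. 0 \<le> g z" "j \<le> N" "\<And>z. hidden_edges N (N - j) \<le> z \<Longrightarrow> f z = f' z"
  shows "chain_mean N g j f = chain_mean N g j f'"
  using assms by (intro antisym chain_mean_mono) auto

lemma chain_mean_add: "chain_mean N g j (\<lambda>z. f z + f' z) = chain_mean N g j f + chain_mean N g j f'"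
proof (induction j arbitrary: f f')
  case (Suc j)
  have "vertex_step N (N - j) (\<lambda>z. g z * (f z + f' z)) =
    (\<lambda>y. vertex_step N (N - j) (\<lambda>z. g z * f z) y + vertex_step N (N - j) (\<lambda>z. g z * f' z) y)"
    by (intro ext) (simp add: vertex_step_add[symmetric] algebra_simps)
  then show ?case using Suc by simp
qed simp

lemma chain_mean_scale: "chain_mean N g j (\<lambda>z. c * f z) = c * chain_mean N g j f"
proof (induction j arbitrary: f)
  case (Suc j)
  have "vertex_step N (N - j) (\<lambda>z. g z * (c * f z)) = (\<lambda>y. c * vertex_step N (N - j) (\<lambda>z. g z * f z) y)"
    by (intro ext) (simp add: vertex_step_scale[symmetric] algebra_simps)
  then show ?case using Suc by simp
qed simp

abbreviation "plain_mean N \<equiv> chain_mean N (\<lambda>_. 1)"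

lemma plain_mean_const: "j \<le> N \<Longrightarrow> plain_mean N j (\<lambda>_. c) = c"
proof (induction j)
  case (Suc j)
  then have "plain_mean N (Suc j) (\<lambda>_. c) = plain_mean N j (\<lambda>_. c)"
    unfolding chain_mean.simps by (intro chain_mean_cong) (auto simp: vertex_step_const)
  then show ?case using Suc by simp
qed simp

lemma chain_mean_le_plain_mean:
  assumes g: "\<And>z. 0 \<le> g z \<and> g z \<le> 1" and f: "\<And>z. 0 \<le> f z" and j: "j \<le> N"
  shows "chain_mean N g j f \<le> plain_mean N j f"
  using f j
proof (induction j arbitrary: f)
  case (Suc j)
  have "chain_mean N g (Suc j) f \<le> chain_mean N g j (vertex_step N (N - j) f)"
    unfolding chain_mean.simps using g Suc.prems
    by (intro chain_mean_mono vertex_step_mono mult_left_le_one_le) auto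
  also have "\<dots> \<le> plain_mean N j (vertex_step N (N - j) f)"
    using vertex_step_mono[of N "N - j" _ "\<lambda>_. 0" f] Suc.prems
    by (intro Suc.IH) (auto simp: vertex_step_const split: if_splits)
  finally show ?case by simp
qed simp

text \<open>The state only decreases. A path ending at or above \<open>r\<close> has stayed where
  \<open>g\<close> is 1, and all other paths are killed by \<open>f\<close>.\<close>

lemma chain_mean_eq_plain_mean:
  assumes g: "\<And>z. r \<le> z \<Longrightarrow> g z = 1" and f: "\<And>z. z < r \<Longrightarrow> f z = 0"
  shows "chain_mean N g j f = plain_mean N j f"
  using f
proof (induction j arbitrary: f)
  case (Suc j)
  have eq: "(\<lambda>z. g z * f z) = f"
  proof
    show "g z * f z = f z" for z using Suc.prems[of z] g[of z] by (cases "z < r") auto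
  qed
  have "vertex_step N (N - j) f y = 0" if "y < r" for y
    using that Suc.prems vertex_step_cong[of N "N - j" y f "\<lambda>_. 0"]
    by (simp add: vertex_step_const)
  then show ?case using Suc.IH[of "vertex_step N (N - j) f"] by (simp add: eq)
qed simp

section \<open>First and second moment of the pool size\<close>

lemma urn_mean_first_moment:
  assumes "0 < w"
  shows "urn_mean w (\<lambda>r. real r + real w) b = real w * (real b + real w + 1) / (real w + 1)"
proof (induction b)
  case (Suc b)
  have "real w + 1 \<noteq> 0" "real w + real (Suc b) \<noteq> 0" by linarith+
  then show ?case unfolding urn_mean.simps Suc by (simp add: divide_simps) algebra
qed (use assms in \<open>simp add: field_simps\<close>)

lemma urn_mean_second_moment:
  assumes "0 < w"
  shows "urn_mean w (\<lambda>r. (real r + real w) * (real r + real w + 1)) b =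
    real w * (real b + real w + 1) * (real b + real w + 2) / (real w + 2)"
proof (induction b)
  case (Suc b)
  have "real w + 2 \<noteq> 0" "real w + real (Suc b) \<noteq> 0" by linarith+
  then show ?case unfolding urn_mean.simps Suc by (simp add: divide_simps) algebra
qed (use assms in \<open>simp add: field_simps\<close>)

definition pool_size :: "nat \<Rightarrow> nat \<Rightarrow> nat \<Rightarrow> real" where
  "pool_size N j y = real y - real (hidden_edges N (N - j)) + real (N - j)"

text \<open>\<open>pool_ratio\<close> minus a deterministic drift is a martingale; in \<open>pool_ratio2\<close> the square is
  replaced by a rising factorial, whose one-step mean has again the same form.\<close>

definition pool_ratio :: "nat \<Rightarrow> nat \<Rightarrow> nat \<Rightarrow> real" where
  "pool_ratio N j y = (pool_size N j y + 1) / (real (N - j) + 1)"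

definition pool_ratio2 :: "nat \<Rightarrow> nat \<Rightarrow> nat \<Rightarrow> real" where
  "pool_ratio2 N j y =
     (pool_size N j y + 1) * (pool_size N j y + 2) / ((real (N - j) + 1) * (real (N - j) + 2))"

definition mean_ratio :: "nat \<Rightarrow> nat \<Rightarrow> real" where
  "mean_ratio N j = 1 + (\<Sum>i<j. real i / real (N - i))"

text \<open>The drawn vertex leaves the pool, hence the \<open>- 1\<close>, and its \<open>j\<close>
  edges to the vertices occupied before enter it.\<close>

lemma pool_size_next:
  assumes "j < N"
  shows "pool_size N (Suc j) (r + hidden_edges N (N - j)) = (real r + real (N - j)) + real j - 1"
  using hidden_edges_Suc[of "N - Suc j" N] assms
  by (simp add: pool_size_def Suc_diff_Suc of_nat_diff)

text \<open>Dividing \<open>urn_mean_first_moment\<close> by \<open>w\<close> shows that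
  \<open>(r + w) / w\<close> has mean \<open>(b + w + 1) / (w + 1)\<close>, which is the old ratio.
  On average the ratio therefore changes only through the \<open>j\<close> new edges, divided by
  \<open>w\<close>.\<close>

lemma vertex_step_pool_ratio:
  assumes j: "j < N" and y: "hidden_edges N (N - j) \<le> y"
  shows "vertex_step N (N - j) (pool_ratio N (Suc j)) y = pool_ratio N j y + real j / real (N - j)"
proof -
  define w where "w = N - j"
  define b where "b = y - hidden_edges N (N - j)"
  have w: "0 < w" "real (N - Suc j) + 1 = real w" using j by (auto simp: w_def of_nat_diff)
  have "vertex_step N w (pool_ratio N (Suc j)) y =
      urn_mean w (\<lambda>r. (1 / real w) * (real r + real w) + real j / real w) b"
    using y unfolding vertex_step_def pool_ratio_def w_def[symmetric] w(2)
    by (simp add: w_def[symmetric] b_def pool_size_next[OF j, folded w_def] add_divide_distrib)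
  also have "\<dots> = (1 / real w) * (real w * (real b + real w + 1) / (real w + 1)) + real j / real w"
    using urn_mean_add[of w "\<lambda>r. (1 / real w) * (real r + real w)" "\<lambda>_. real j / real w" b]
    unfolding urn_mean_scale urn_mean_const urn_mean_first_moment[OF w(1)] .
  also have "\<dots> = pool_ratio N j y + real j / real w"
    using y w by (simp add: pool_ratio_def pool_size_def b_def w_def[symmetric] of_nat_diff)
  finally show ?thesis by (simp add: w_def)
qed

lemma vertex_step_pool_ratio2:
  assumes j: "j < N" and y: "hidden_edges N (N - j) \<le> y"
  shows "vertex_step N (N - j) (pool_ratio2 N (Suc j)) y =
    pool_ratio2 N j y + (2 * real j / (real (N - j) + 1)) * pool_ratio N j y
      + real j * (real j + 1) / (real (N - j) * (real (N - j) + 1))"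
proof -
  define w where "w = N - j"
  define b where "b = y - hidden_edges N (N - j)"
  have w: "0 < w" "real (N - Suc j) + 1 = real w" "real (N - Suc j) + 2 = real w + 1" 
    using j by (auto simp: w_def of_nat_diff)
  let ?W = "real w * (real w + 1)"
  have p: "pool_ratio2 N (Suc j) (r + hidden_edges N w) =
    (1 / ?W) * ((real r + real w) * (real r + real w + 1)) +
      ((2 * real j / ?W) * (real r + real w) + real j * (real j + 1) / ?W)" for r
  proof -
    have "pool_ratio2 N (Suc j) (r + hidden_edges N w) =
        (real r + real w + real j) * (real r + real w + real j + 1) / ?W"
      unfolding pool_ratio2_def w(2,3) w_def pool_size_next[OF j] by simp
    also have "(real r + real w + real j) * (real r + real w + real j + 1) =
        (real r + real w) * (real r + real w + 1) + (2 * real j * (real r + real w) + real j * (real j + 1))"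
      by algebra
    finally show ?thesis by (simp only: add_divide_distrib) simp
  qed
  have "vertex_step N w (pool_ratio2 N (Suc j)) y =
      urn_mean w (\<lambda>r. (1 / ?W) * ((real r + real w) * (real r + real w + 1)) +
      ((2 * real j / ?W) * (real r + real w) + real j * (real j + 1) / ?W)) b"
    using y unfolding vertex_step_def p by (simp add: b_def w_def)
  also have "\<dots> = (1 / ?W) * (real w * (real b + real w + 1) * (real b + real w + 2) / (real w + 2))
      + ((2 * real j / ?W) * (real w * (real b + real w + 1) / (real w + 1)) + real j * (real j + 1) / ?W)"
    using urn_mean_add[of w "\<lambda>r. (1 / ?W) * ((real r + real w) * (real r + real w + 1))"
        "\<lambda>r. (2 * real j / ?W) * (real r + real w) + real j * (real j + 1) / ?W" b]
      urn_mean_add[of w "\<lambda>r. (2 * real j / ?W) * (real r + real w)" "\<lambda>_. real j * (real j + 1) / ?W" b]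
    unfolding urn_mean_scale urn_mean_const urn_mean_first_moment[OF w(1)]
      urn_mean_second_moment[OF w(1)] by (rule trans[OF _ arg_cong2[where f="(+)", OF refl]])
  also have "\<dots> = pool_ratio2 N j y + (2 * real j / (real w + 1)) * pool_ratio N j y
      + real j * (real j + 1) / ?W"
  proof -
    have s: "pool_size N j y = real b + real w" using y by (simp add: pool_size_def b_def w_def of_nat_diff)
    show ?thesis unfolding pool_ratio_def pool_ratio2_def s w_def[symmetric] using w(1) by simp
  qed
  finally show ?thesis by (simp add: w_def)
qed

lemma mean_ratio_Suc: "mean_ratio N (Suc j) = mean_ratio N j + real j / real (N - j)"
  by (simp add: mean_ratio_def)

lemma mean_ratio_ge_1: "1 \<le> mean_ratio N j"
  by (auto simp: mean_ratio_def intro!: sum_nonneg)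

lemma plain_mean_pool_ratio: "j \<le> N \<Longrightarrow> plain_mean N j (pool_ratio N j) = mean_ratio N j"
proof (induction j)
  case 0
  then show ?case by (simp add: pool_ratio_def pool_size_def mean_ratio_def hidden_edges_def binomial_eq_0)
next
  case (Suc j)
  have "plain_mean N (Suc j) (pool_ratio N (Suc j)) =
      plain_mean N j (\<lambda>y. pool_ratio N j y + real j / real (N - j))"
    unfolding chain_mean.simps using Suc.prems
    by (intro chain_mean_cong) (simp_all add: vertex_step_pool_ratio)
  also have "\<dots> = mean_ratio N (Suc j)"
    using Suc by (simp add: chain_mean_add plain_mean_const mean_ratio_Suc)
  finally show ?case .
qed

text \<open>With the normalisation \<open>(w + 1) (w + 2)\<close> the urn leaves the rising
  factorial unchanged on average, so no variance accumulates from the draws. Only the new edges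
  contribute, and no more than they contribute to the squared mean.\<close>

lemma plain_mean_pool_ratio2: "j \<le> N \<Longrightarrow> plain_mean N j (pool_ratio2 N j) \<le> (mean_ratio N j)\<^sup>2"
proof (induction j)
  case 0
  then show ?case by (simp add: pool_ratio2_def pool_size_def mean_ratio_def hidden_edges_def binomial_eq_0)
next
  case (Suc j)
  define w where "w = real (N - j)"
  have w: "0 < w" using Suc.prems by (simp add: w_def)
  define a where "a = mean_ratio N j"
  have a: "1 \<le> a" by (simp add: a_def mean_ratio_ge_1)
  have "plain_mean N (Suc j) (pool_ratio2 N (Suc j)) =
      plain_mean N j (\<lambda>y. pool_ratio2 N j y + (2 * real j / (w + 1)) * pool_ratio N j y
        + real j * (real j + 1) / (w * (w + 1)))"
    unfolding chain_mean.simps w_def using Suc.prems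
    by (intro chain_mean_cong) (simp_all add: vertex_step_pool_ratio2)
  also have "\<dots> = plain_mean N j (pool_ratio2 N j) + (2 * real j / (w + 1)) * a
        + real j * (real j + 1) / (w * (w + 1))"
    using Suc.prems 
    by (simp only: chain_mean_add chain_mean_scale plain_mean_const plain_mean_pool_ratio a_def Suc_leD)
  also have "\<dots> \<le> a\<^sup>2 + (2 * real j / (w + 1)) * a + real j * (real j + 1) / (w * (w + 1))"
    using Suc by (simp add: a_def)
  also have "\<dots> \<le> (a + real j / w)\<^sup>2"
  proof -
    have "(a + real j / w)\<^sup>2 - (a\<^sup>2 + (2 * real j / (w + 1)) * a + real j * (real j + 1) / (w * (w + 1)))
        = real j * (2 * w * a + real j - w) / (w\<^sup>2 * (w + 1))"
      using w by (simp add: divide_simps power2_eq_square) algebra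
    moreover have "0 \<le> real j * (2 * w * a + real j - w) / (w\<^sup>2 * (w + 1))"
    proof (intro divide_nonneg_pos mult_nonneg_nonneg)
      \<comment> \<open>Here \<open>1 \<le> a\<close> enters: it lets \<open>2 * w * a\<close>
        absorb the only negative term \<open>- w\<close>.\<close>
      have "w * 1 \<le> w * a" using w a by (intro mult_left_mono) auto
      then show "0 \<le> 2 * w * a + real j - w"
        using w of_nat_0_le_iff[of j, where 'a=real] by linarith
    qed (use w in auto)
    ultimately show ?thesis by linarith
  qed
  finally show ?case by (simp add: mean_ratio_Suc a_def w_def)
qed

text \<open>Passing from the rising factorial to the square costs the factor
  \<open>(w + 2) / (w + 1)\<close>, and its excess over 1 is the whole bound. The relative variance
  is thus at most \<open>1 / (w + 1)\<close>, uniformly in \<open>N\<close>.\<close>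

lemma plain_mean_pool_ratio_variance:
  assumes j: "j \<le> N"
  shows "plain_mean N j (\<lambda>y. (pool_ratio N j y - mean_ratio N j)\<^sup>2) \<le>
    (mean_ratio N j)\<^sup>2 / (real (N - j) + 1)"
proof -
  define w where "w = real (N - j)"
  define a where "a = mean_ratio N j"
  have "plain_mean N j (\<lambda>y. (pool_ratio N j y - a)\<^sup>2) \<le>
      plain_mean N j (\<lambda>y. ((w + 2) / (w + 1)) * pool_ratio2 N j y + ((- 2 * a) * pool_ratio N j y + a\<^sup>2))"
  proof (rule chain_mean_mono[OF _ j])
    fix y assume y: "hidden_edges N (N - j) \<le> y"
    have s: "0 \<le> pool_size N j y" using y by (simp add: pool_size_def)
    define x where "x = pool_size N j y"
    have "(pool_ratio N j y)\<^sup>2 = (x + 1) * (x + 1) / (w + 1)\<^sup>2"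
      by (simp add: pool_ratio_def x_def w_def power2_eq_square)
    also have "\<dots> \<le> (x + 1) * (x + 2) / (w + 1)\<^sup>2"
      using s by (intro divide_right_mono mult_left_mono) (auto simp: x_def)
    also have "\<dots> = ((w + 2) / (w + 1)) * pool_ratio2 N j y"
      by (simp add: pool_ratio2_def x_def w_def power2_eq_square divide_simps)
    finally show "(pool_ratio N j y - a)\<^sup>2 \<le> 
        ((w + 2) / (w + 1)) * pool_ratio2 N j y + ((- 2 * a) * pool_ratio N j y + a\<^sup>2)"
      by (simp add: power2_diff)
  qed simp
  also have "\<dots> = ((w + 2) / (w + 1)) * plain_mean N j (pool_ratio2 N j) - a\<^sup>2"
    using j
    by (simp only: chain_mean_add chain_mean_scale plain_mean_const plain_mean_pool_ratio a_def)
      (simp add: power2_eq_square)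
  also have "\<dots> \<le> ((w + 2) / (w + 1)) * a\<^sup>2 - a\<^sup>2"
    using plain_mean_pool_ratio2[OF j] 
    by (intro diff_right_mono mult_left_mono) (auto simp: a_def w_def)
  also have "\<dots> = a\<^sup>2 / (w + 1)"
    by (simp add: w_def divide_simps) algebra
  finally show ?thesis by (simp add: a_def w_def)
qed

lemma mean_ratio_eq_harm:
  assumes "m \<le> N"
  shows "mean_ratio N (N - m) = 1 + real N * (harm N - harm m) - real (N - m)"
proof -
  have "(\<Sum>i<N - m. real i / real (N - i)) = (\<Sum>k=m+1..N. real (N - k) / real k)"
    by (rule sum.reindex_bij_witness[of _ "\<lambda>k. N - k" "\<lambda>i. N - i"]) auto
  also have "\<dots> = (\<Sum>k=m+1..N. real N * (1 / real k) - 1)"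
    by (intro sum.cong) (auto simp: of_nat_diff field_simps)
  also have "\<dots> = real N * (\<Sum>k=m+1..N. 1 / real k) - real (N - m)"
    by (simp add: sum_subtractf sum_distrib_left)
  also have "(\<Sum>k=m+1..N. 1 / real k) = harm N - harm m"
  proof -
    have "harm N = harm m + (\<Sum>k=m+1..N. 1 / real k)"
    proof -
      have "{1..N} = {1..m} \<union> {m+1..N}" using assms by auto
      then show ?thesis unfolding harm_def by (simp add: sum.union_disjoint inverse_eq_divide)
    qed
    then show ?thesis by simp
  qed
  finally show ?thesis by (simp add: mean_ratio_def)
qed

text \<open>Only \<open>harm N\<close> contributes a logarithm; the terms depending on
  \<open>m\<close> are of order \<open>N\<close> and vanish on the scale \<open>N log N\<close>, so
  one scale serves every number of remaining vertices.\<close>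

lemma mean_ratio_asymp:
  "(\<lambda>N. mean_ratio N (N - m) / (real N * ln (real N))) \<longlonglongrightarrow> 1"
proof -
  have lim: "(\<lambda>N. 1 / (real N * ln (real N)) + (harm N - ln (real N)) / ln (real N) + 1 
      - harm m / ln (real N) - 1 / ln (real N) + real m / (real N * ln (real N))) \<longlonglongrightarrow> 0 + 0 + 1 - 0 - 0 + 0"
  proof (intro tendsto_intros)
    have ln: "filterlim (\<lambda>N. ln (real N)) at_top sequentially"
      by (rule filterlim_compose[OF ln_at_top filterlim_real_sequentially])
    have nln: "filterlim (\<lambda>N. real N * ln (real N)) at_top sequentially"
      by (rule filterlim_at_top_mult_at_top[OF filterlim_real_sequentially ln])
    show "(\<lambda>N. 1 / (real N * ln (real N))) \<longlonglongrightarrow> 0" "(\<lambda>N. real m / (real N * ln (real N))) \<longlonglongrightarrow> 0"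
      by (rule real_tendsto_divide_at_top[OF tendsto_const nln])+
    show "(\<lambda>N. harm m / ln (real N)) \<longlonglongrightarrow> 0" "(\<lambda>N. 1 / ln (real N)) \<longlonglongrightarrow> 0"
      by (rule real_tendsto_divide_at_top[OF tendsto_const ln])+
    show "(\<lambda>N. (harm N - ln (real N)) / ln (real N)) \<longlonglongrightarrow> 0"
      by (rule real_tendsto_divide_at_top[OF euler_mascheroni_LIMSEQ ln])
  qed
  have "\<forall>\<^sub>F N in sequentially. mean_ratio N (N - m) / (real N * ln (real N)) =
      1 / (real N * ln (real N)) + (harm N - ln (real N)) / ln (real N) + 1 
      - harm m / ln (real N) - 1 / ln (real N) + real m / (real N * ln (real N))"
    using eventually_ge_at_top[of "max 2 m"]
  proof eventually_elim
    case (elim N)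
    then have "0 < ln (real N)" "0 < real N" "m \<le> N" by auto
    then show ?case
      unfolding mean_ratio_eq_harm[OF \<open>m \<le> N\<close>] by (simp add: of_nat_diff divide_simps) algebra
  qed
  then show ?thesis using lim by (simp add: tendsto_cong)
qed

section \<open>The last few vertices\<close>

text \<open>The weight of \<open>r\<close> is \<open>C(r + w, w) / C(b + w + 1, w + 1)\<close> with
  binomial coefficients \<open>C\<close>: the colour arrangements of what follows the first of
  \<open>w + 1\<close> white balls, divided by all colour arrangements.\<close>

lemma urn_mean_eq_sum:
  "urn_mean (Suc w) f b =
    (\<Sum>r\<le>b. (real w + 1) * (\<Prod>i<w. real r + 1 + real i) * f r) / (\<Prod>i<Suc w. real b + 1 + real i)"
proof (induction b)
  case 0
  define P where "P = (\<Prod>i<w. 1 + real i)"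
  have "P > 0" unfolding P_def by (intro prod_pos) auto
  moreover have "1 + real w \<noteq> 0" by linarith
  ultimately show ?case by (simp add: divide_simps flip: P_def)
next
  case (Suc b)
  define P where "P = (\<Prod>i<w. real (Suc b) + 1 + real i)"
  have P: "P > 0" unfolding P_def by (intro prod_pos) auto
  have Z: "(\<Prod>i<Suc w. real b + 1 + real i) = (real b + 1) * P"
    unfolding P_def prod.lessThan_Suc_shift by (simp add: algebra_simps)
  have Z': "(\<Prod>i<Suc w. real (Suc b) + 1 + real i) = P * (real b + real w + 2)"
    unfolding P_def by simp
  define R where "R = (\<Sum>r\<le>b. (real w + 1) * (\<Prod>i<w. real r + 1 + real i) * f r)"
  have "urn_mean (Suc w) f (Suc b) =
      ((real w + 1) * f (Suc b) + (real b + 1) * (R / ((real b + 1) * P))) / (real b + real w + 2)"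
    using Suc unfolding R_def[symmetric] Z by (simp add: algebra_simps)
  also have "\<dots> = (R + (real w + 1) * P * f (Suc b)) / (P * (real b + real w + 2))"
    using P by (simp add: divide_simps)
  finally show ?case unfolding Z' by (simp add: R_def P_def)
qed

text \<open>Crude but uniform in \<open>r\<close>, as needed for the dominated convergence in
  \<open>urn_mean_tendsto\<close>.\<close>

lemma urn_density_le:
  assumes "r \<le> b"
  shows "(real w + 1) * (\<Prod>i<w. real r + 1 + real i) / (\<Prod>i<Suc w. real b + 1 + real i) \<le>
    (real w + 1) / (real b + 1)"
proof -
  have "(\<Prod>i<w. real r + 1 + real i) \<le> (\<Prod>i<w. real b + 1 + real i)"
    using assms by (intro prod_mono) auto
  moreover have P: "(\<Prod>i<w. real b + 1 + real i) > 0" by (intro prod_pos) auto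
  ultimately have "(real w + 1) * (\<Prod>i<w. real r + 1 + real i) / (\<Prod>i<Suc w. real b + 1 + real i) \<le>
      (real w + 1) * (\<Prod>i<w. real b + 1 + real i) / (\<Prod>i<Suc w. real b + 1 + real i)"
    by (intro divide_right_mono mult_left_mono) (auto intro!: prod_nonneg)
  also have "\<dots> = (real w + 1) / (real b + 1 + real w)"
    using P by (simp add: divide_simps)
  also have "\<dots> \<le> (real w + 1) / (real b + 1)" by (intro divide_left_mono) auto
  finally show ?thesis .
qed

lemma nat_floor_mult_div_tendsto:
  assumes "filterlim L at_top sequentially" "0 < x"
  shows "(\<lambda>k. real (nat \<lfloor>L k * x\<rfloor>) / L k) \<longlonglongrightarrow> x"
proof (rule tendsto_sandwich)
  have L: "\<forall>\<^sub>F k in sequentially. 0 < L k"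
    using assms(1) by (simp add: filterlim_at_top_dense)
  show "\<forall>\<^sub>F k in sequentially. x - 1 / L k \<le> real (nat \<lfloor>L k * x\<rfloor>) / L k"
    using L
  proof eventually_elim
    case (elim k)
    have "L k * x - 1 \<le> real (nat \<lfloor>L k * x\<rfloor>)" by linarith
    then have "(L k * x - 1) / L k \<le> real (nat \<lfloor>L k * x\<rfloor>) / L k" 
      using elim by (intro divide_right_mono) auto
    then show ?case using elim by (simp add: diff_divide_distrib)
  qed
  show "\<forall>\<^sub>F k in sequentially. real (nat \<lfloor>L k * x\<rfloor>) / L k \<le> x"
    using L
  proof eventually_elim
    case (elim k)
    have "real (nat \<lfloor>L k * x\<rfloor>) \<le> L k * x" using elim assms(2) by simp
    then show ?case using elim by (simp add: field_simps)
  qed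
  have "(\<lambda>k. x - 1 / L k) \<longlonglongrightarrow> x - 0"
    by (intro tendsto_intros real_tendsto_divide_at_top[OF tendsto_const assms(1)])
  then show "(\<lambda>k. x - 1 / L k) \<longlonglongrightarrow> x" by simp
qed simp

lemma nat_floor_iff:
  assumes "0 < L"
  shows "x \<in> {real r / L..<real (Suc r) / L} \<longleftrightarrow> 0 \<le> x \<and> r = nat \<lfloor>L * x\<rfloor>"
proof -
  have "x \<in> {real r / L..<real (Suc r) / L} \<longleftrightarrow> real r \<le> L * x \<and> L * x < real r + 1"
    using assms by (simp add: field_simps)
  also have "\<dots> \<longleftrightarrow> 0 \<le> L * x \<and> r = nat \<lfloor>L * x\<rfloor>" by linarith
  also have "0 \<le> L * x \<longleftrightarrow> 0 \<le> x" using assms by (simp add: zero_le_mult_iff)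
  finally show ?thesis .
qed

text \<open>The density \<open>(w + 1) * x ^ w / \<eta> ^ Suc w\<close> is that of the maximum of
  \<open>w + 1\<close> independent uniform points of \<open>[0, \<eta>]\<close>: the state
  decreases, so the largest atom comes first. Convergence of \<open>\<phi>\<close> is assumed along
  all sequences with \<open>r k / L k\<close> tending to \<open>s\<close>, because a point
  \<open>s\<close> is only approached through rounding; \<open>S\<close> makes room for jumps of the
  weight.\<close>

lemma urn_mean_tendsto:
  fixes \<phi> :: "nat \<Rightarrow> nat \<Rightarrow> real" and f :: "real \<Rightarrow> real"
  assumes L: "filterlim L at_top sequentially"
    and b: "(\<lambda>k. real (b k) / L k) \<longlonglongrightarrow> \<eta>" and \<eta>: "0 < \<eta>"
    and bound: "\<And>k r. \<bar>\<phi> k r\<bar> \<le> 1"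
    and S: "finite S"
    and lim: "\<And>s r. 0 < s \<Longrightarrow> s \<notin> S \<Longrightarrow> (\<lambda>k. real (r k) / L k) \<longlonglongrightarrow> s \<Longrightarrow>
      (\<lambda>k. \<phi> k (r k)) \<longlonglongrightarrow> f s"
    and meas: "(\<lambda>x. indicator {0..\<eta>} x * ((real w + 1) * x ^ w / \<eta> ^ Suc w * f x)) \<in> borel_measurable lborel"
  shows "(\<lambda>k. urn_mean (Suc w) (\<phi> k) (b k)) \<longlonglongrightarrow>
    (\<integral>x. indicator {0..\<eta>} x * ((real w + 1) * x ^ w / \<eta> ^ Suc w * f x) \<partial>lborel)"
proof -
  define q where "q k r = (real w + 1) * (\<Prod>i<w. real r + 1 + real i) /
    (\<Prod>i<Suc w. real (b k) + 1 + real i)" for k r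
  \<comment> \<open>The mean becomes the integral of a step function; the factor \<open>L k\<close>
    compensates the cell width \<open>1 / L k\<close>.\<close>
  define u where "u k x = (\<Sum>r\<le>b k. L k * q k r * \<phi> k r *
    indicator {real r / L k..<real (Suc r) / L k} x)" for k x
  have q0: "0 \<le> q k r" for k r
    unfolding q_def by (intro divide_nonneg_nonneg mult_nonneg_nonneg prod_nonneg) auto
  have u_int: "(\<integral>x. u k x \<partial>lborel) = urn_mean (Suc w) (\<phi> k) (b k)" if "0 < L k" for k
  proof -
    have m: "measure lborel {real r / L k..<real (Suc r) / L k} = 1 / L k" for r
      using that by (simp add: divide_right_mono add_divide_distrib)
    have "(\<integral>x. u k x \<partial>lborel) =
        (\<Sum>r\<le>b k. \<integral>x. L k * q k r * \<phi> k r * indicator {real r / L k..<real (Suc r) / L k} x \<partial>lborel)"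
      unfolding u_def using that
      by (intro Bochner_Integration.integral_sum integrable_mult_right integrable_real_indicator)
        (auto simp: divide_right_mono)
    also have "\<dots> = (\<Sum>r\<le>b k. q k r * \<phi> k r)"
    proof (rule sum.cong[OF refl])
      fix r
      have "(\<integral>x. L k * q k r * \<phi> k r * indicator {real r / L k..<real (Suc r) / L k} x \<partial>lborel) =
          L k * q k r * \<phi> k r * measure lborel {real r / L k..<real (Suc r) / L k}" by simp
      then show "(\<integral>x. L k * q k r * \<phi> k r * indicator {real r / L k..<real (Suc r) / L k} x \<partial>lborel) =
          q k r * \<phi> k r" unfolding m using that by simp
    qed
    also have "\<dots> = urn_mean (Suc w) (\<phi> k) (b k)"
      unfolding urn_mean_eq_sum q_def by (simp add: sum_divide_distrib)
    finally show ?thesis .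
  qed
  have u_eq: "u k x = (if 0 \<le> x \<and> nat \<lfloor>L k * x\<rfloor> \<le> b k
      then L k * q k (nat \<lfloor>L k * x\<rfloor>) * \<phi> k (nat \<lfloor>L k * x\<rfloor>) else 0)" if "0 < L k" for k x
  proof -
    have "u k x = (\<Sum>r\<le>b k. if r = nat \<lfloor>L k * x\<rfloor> then 
        (if 0 \<le> x then L k * q k r * \<phi> k r else 0) else 0)"
      unfolding u_def using nat_floor_iff[OF that, of x]
      by (intro sum.cong refl) (auto simp: indicator_def)
    then show ?thesis by (simp add: sum.delta)
  qed
  have L0: "\<forall>\<^sub>F k in sequentially. 1 < L k"
    using L by (simp add: filterlim_at_top_dense)
  have b1: "\<forall>\<^sub>F k in sequentially. \<eta> / 2 < real (b k) / L k"
    using b \<eta> by (intro order_tendstoD(1)) auto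
  have b2: "\<forall>\<^sub>F k in sequentially. real (b k) / L k < 2 * \<eta>"
    using b \<eta> by (intro order_tendstoD(2)) auto
  obtain k0 where k0: "\<And>k. k \<ge> k0 \<Longrightarrow> 1 < L k" "\<And>k. k \<ge> k0 \<Longrightarrow> \<eta> / 2 < real (b k) / L k"
      "\<And>k. k \<ge> k0 \<Longrightarrow> real (b k) / L k < 2 * \<eta>"
    using eventually_conj[OF L0 eventually_conj[OF b1 b2]] unfolding eventually_sequentially by blast
  let ?h = "\<lambda>x. indicator {0..\<eta>} x * ((real w + 1) * x ^ w / \<eta> ^ Suc w * f x)"
  \<comment> \<open>From \<open>k0\<close> on, \<open>b k / L k\<close> exceeds
    \<open>\<eta> / 2\<close>, which bounds the height by \<open>B\<close> through
    \<open>urn_density_le\<close>, and is below \<open>2 * \<eta>\<close>, which bounds the support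
    up to one cell of width less than 1.\<close>
  define B where "B = 2 * (real w + 1) / \<eta>"
  have "(\<lambda>k. \<integral>x. u (k + k0) x \<partial>lborel) \<longlonglongrightarrow> (\<integral>x. ?h x \<partial>lborel)"
  proof (rule integral_dominated_convergence[where w = "\<lambda>x. B * indicator {0..2 * \<eta> + 1} x"])
    show "integrable lborel (\<lambda>x. B * indicator {0..2 * \<eta> + 1} x)"
      by (intro integrable_mult_right integrable_real_indicator) (use \<eta> in auto)
    show "(\<lambda>x. u (k + k0) x) \<in> borel_measurable lborel" for k
      unfolding u_def by measurable
    show "AE x in lborel. norm (u (k + k0) x) \<le> B * indicator {0..2 * \<eta> + 1} x" for k
    proof (rule AE_I2)
      fix x :: real
      define l where "l = k + k0"
      have l: "1 < L l" "\<eta> / 2 < real (b l) / L l" "real (b l) / L l < 2 * \<eta>"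
        using k0[of l] by (auto simp: l_def)
      show "norm (u (k + k0) x) \<le> B * indicator {0..2 * \<eta> + 1} x"
      proof (cases "0 \<le> x \<and> nat \<lfloor>L l * x\<rfloor> \<le> b l")
        case True
        have bl: "\<eta> / 2 * L l < real (b l)" using l by (simp add: field_simps)
        have blp: "0 < real (b l)" using bl l(1) \<eta> by (smt (verit) divide_pos_pos mult_pos_pos)
        let ?r = "nat \<lfloor>L l * x\<rfloor>"
        have "L l * q l ?r \<le> L l * ((real w + 1) / (real (b l) + 1))"
          using True l urn_density_le[of ?r "b l" w] unfolding q_def by (intro mult_left_mono) auto
        also have "\<dots> \<le> L l * ((real w + 1) / (\<eta> / 2 * L l))"
          using l \<eta> bl by (intro mult_left_mono divide_left_mono) auto
        also have "\<dots> = B" using l \<eta> by (simp add: B_def)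
        finally have 1: "L l * q l ?r \<le> B" .
        have "norm (u l x) = (L l * q l ?r) * \<bar>\<phi> l ?r\<bar>"
          using True l q0[of l ?r] by (simp add: u_eq abs_mult)
        also have "\<dots> \<le> B * 1"
          using 1 bound q0[of l ?r] l by (intro mult_mono) (auto intro: order_trans[OF _ 1])
        finally have 2: "norm (u l x) \<le> B" by simp
        have "L l * x \<le> real (b l) + 1" using True by linarith
        then have "x \<le> real (b l) / L l + 1 / L l"
          using l by (simp add: field_simps)
        also have "\<dots> \<le> 2 * \<eta> + 1" using l by (intro add_mono) auto
        finally show ?thesis using True 2 by (simp add: l_def)
      next
        case False
        then have "u l x = 0" using l by (subst u_eq) auto
        then show ?thesis using \<eta> by (simp add: l_def B_def)
      qed
    qed
    \<comment> \<open>Almost every point suffices, so the jumps in \<open>S\<close> are discarded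
      together with the end points, at \<open>\<eta>\<close> because the rounded point may fall on
      either side of \<open>b k\<close>.\<close>
    have "AE x in lborel. x \<notin> insert 0 (insert \<eta> S)"
      using S by (intro AE_not_in finite_imp_null_set_lborel) auto
    then show "AE x in lborel. (\<lambda>k. u (k + k0) x) \<longlonglongrightarrow> ?h x"
    proof eventually_elim
      case (elim x)
      have L1: "\<forall>\<^sub>F k in sequentially. 0 < L k" using L0 by eventually_elim auto
      consider "x < 0" | "0 < x" "x < \<eta>" | "\<eta> < x" using elim by force
      then have "(\<lambda>k. u k x) \<longlonglongrightarrow> ?h x"
      proof cases
        case 1
        have "\<forall>\<^sub>F k in sequentially. u k x = 0"
          using L1 by eventually_elim (use 1 in \<open>simp add: u_eq\<close>)
        then show ?thesis using 1 by (simp add: tendsto_eventually)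
      next
        case 3
        have x: "0 < x" using 3 \<eta> by simp
        have "\<forall>\<^sub>F k in sequentially. real (b k) / L k - real (nat \<lfloor>L k * x\<rfloor>) / L k < 0"
          using 3 by (intro order_tendstoD(2)[OF tendsto_diff[OF b nat_floor_mult_div_tendsto[OF L x]]]) auto
        with L1 have "\<forall>\<^sub>F k in sequentially. u k x = 0"
        proof eventually_elim
          case (elim k)
          then have "b k < nat \<lfloor>L k * x\<rfloor>" by (simp add: field_simps)
          then show ?case using elim by (simp add: u_eq)
        qed
        then show ?thesis using 3 \<eta> by (simp add: tendsto_eventually)
      next
        case 2
        define r where "r k = nat \<lfloor>L k * x\<rfloor>" for k
        have r: "(\<lambda>k. real (r k) / L k) \<longlonglongrightarrow> x"
          unfolding r_def by (rule nat_floor_mult_div_tendsto[OF L 2(1)])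
        have c: "(\<lambda>k. (1 + real i) / L k) \<longlonglongrightarrow> 0" for i
          by (rule real_tendsto_divide_at_top[OF tendsto_const L])
        have "(\<lambda>k. (real w + 1) * (\<Prod>i<w. real (r k) / L k + (1 + real i) / L k) /
            (\<Prod>i<Suc w. real (b k) / L k + (1 + real i) / L k) * \<phi> k (r k)) \<longlonglongrightarrow>
          (real w + 1) * (\<Prod>i<w. x + 0) / (\<Prod>i<Suc w. \<eta> + 0) * f x"
          using \<eta> elim 2 by (intro tendsto_intros r b c lim) auto
        then have lim2: "(\<lambda>k. (real w + 1) * (\<Prod>i<w. real (r k) / L k + (1 + real i) / L k) /
            (\<Prod>i<Suc w. real (b k) / L k + (1 + real i) / L k) * \<phi> k (r k)) \<longlonglongrightarrow> ?h x"
          using 2 by simp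
        have "\<forall>\<^sub>F k in sequentially. real (r k) / L k - real (b k) / L k < 0"
          using 2 by (intro order_tendstoD(2)[OF tendsto_diff[OF r b]]) auto
        with L1 have "\<forall>\<^sub>F k in sequentially. (real w + 1) * (\<Prod>i<w. real (r k) / L k + (1 + real i) / L k) /
            (\<Prod>i<Suc w. real (b k) / L k + (1 + real i) / L k) * \<phi> k (r k) = u k x"
        proof eventually_elim
          case (elim k)
          have "r k \<le> b k" using elim by (simp add: field_simps)
          then have u: "u k x = L k * q k (r k) * \<phi> k (r k)"
            using elim 2 by (simp add: u_eq r_def)
          have e: "real m / L k + (1 + real i) / L k = (real m + 1 + real i) / L k" for m i
            by (simp add: add_divide_distrib)
          have "(\<Prod>i<Suc w. real (b k) + 1 + real i) > 0" by (intro prod_pos) auto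
          then show ?case
            unfolding u q_def e prod_dividef using elim by (simp add: divide_simps)
        qed
        then show ?thesis using lim2 by (rule tendsto_cong[THEN iffD1])
      qed
      then show "(\<lambda>k. u (k + k0) x) \<longlonglongrightarrow> ?h x" by (rule LIMSEQ_ignore_initial_segment)
    qed
  qed (rule meas)
  then have "(\<lambda>k. \<integral>x. u k x \<partial>lborel) \<longlonglongrightarrow> (\<integral>x. ?h x \<partial>lborel)"
    by (rule LIMSEQ_offset)
  moreover have "\<forall>\<^sub>F k in sequentially. (\<integral>x. u k x \<partial>lborel) = urn_mean (Suc w) (\<phi> k) (b k)"
    using L0 by eventually_elim (use u_int in auto)
  ultimately show ?thesis by (simp add: tendsto_cong)
qed

section \<open>Limit of the product mean with a fixed number of vertices left\<close>

lemma filterlim_N_ln_N: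
  "filterlim (\<lambda>N. real N * ln (real N)) at_top sequentially"
proof (rule filterlim_at_top_mult_at_top)
  show "filterlim (\<lambda>N. ln (real N)) at_top sequentially"
    by (rule filterlim_compose[OF ln_at_top filterlim_real_sequentially])
qed (rule filterlim_real_sequentially)

lemma hidden_edges_negligible:
  "(\<lambda>N. real (hidden_edges N w) / (real N * ln (real N))) \<longlonglongrightarrow> 0"
proof (rule tendsto_sandwich)
  show "\<forall>\<^sub>F N in sequentially. 0 \<le> real (hidden_edges N w) / (real N * ln (real N))"
    using eventually_ge_at_top[of 1] by eventually_elim simp
  show "\<forall>\<^sub>F N in sequentially. real (hidden_edges N w) / (real N * ln (real N)) \<le> real w / ln (real N)"
    using eventually_ge_at_top[of "max w 2"]
  proof eventually_elim
    case (elim N)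
    then have N: "0 < real N" "0 < ln (real N)" by auto
    have "real (hidden_edges N w) \<le> real w * real N"
      using hidden_edges_le[of w N] elim by (simp flip: of_nat_mult)
    then have "real (hidden_edges N w) / (real N * ln (real N)) \<le> real w * real N / (real N * ln (real N))"
      using N by (intro divide_right_mono) auto
    then show ?case using N by simp
  qed
  show "(\<lambda>N. real w / ln (real N)) \<longlonglongrightarrow> 0"
    by (rule real_tendsto_divide_at_top[OF tendsto_const filterlim_compose[OF ln_at_top filterlim_real_sequentially]])
qed simp

text \<open>The powers of \<open>x\<close> cancel off 0, and what remains is the derivative of
  \<open>(G / \<eta>) ^ Suc w\<close>. The fundamental theorem tolerates a finite exceptional set
  for a continuous \<open>G\<close>, which admits step functions \<open>g\<close>.\<close>

lemma integral_power_primitive: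
  fixes G g :: "real \<Rightarrow> real"
  assumes S: "finite S" and \<eta>: "0 < \<eta>"
    and G: "continuous_on {0..\<eta>} G" "G 0 = 0"
    and deriv: "\<And>s. 0 < s \<Longrightarrow> s \<notin> S \<Longrightarrow> (G has_real_derivative g s) (at s)"
    and g: "g \<in> borel_measurable borel" "\<And>s. \<bar>g s\<bar> \<le> 1"
  shows "(\<lambda>x. indicator {0..\<eta>} x * ((real w + 1) * x ^ w / \<eta> ^ Suc w * (g x * (G x / x) ^ w)))
      \<in> borel_measurable lborel" (is "?h \<in> _")
    and "(\<integral>x. indicator {0..\<eta>} x * ((real w + 1) * x ^ w / \<eta> ^ Suc w * (g x * (G x / x) ^ w)) \<partial>lborel) =
      (G \<eta> / \<eta>) ^ Suc w"
proof -
  have GI: "(\<lambda>x. indicator {0..\<eta>} x *\<^sub>R G x) \<in> borel_measurable borel"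
    using G(1) by (intro borel_measurable_continuous_on_indicator) auto
  have eq: "?h = (\<lambda>x. indicator {0..\<eta>} x * ((real w + 1) * x ^ w / \<eta> ^ Suc w * (g x * ((indicator {0..\<eta>} x *\<^sub>R G x) / x) ^ w)))"
    by (auto simp: indicator_def)
  show "?h \<in> borel_measurable lborel"
    unfolding eq using g(1) GI by measurable
  define F where "F x = (real w + 1) * G x ^ w * g x / \<eta> ^ Suc w" for x
  have "(F has_integral (G \<eta> ^ Suc w / \<eta> ^ Suc w - G 0 ^ Suc w / \<eta> ^ Suc w)) {0..\<eta>}"
  proof (rule fundamental_theorem_of_calculus_interior_strong[OF S])
    show "continuous_on {0..\<eta>} (\<lambda>x. G x ^ Suc w / \<eta> ^ Suc w)"
      using G \<eta> by (intro continuous_intros) auto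
    show "((\<lambda>x. G x ^ Suc w / \<eta> ^ Suc w) has_vector_derivative F x) (at x)" if "x \<in> {0<..<\<eta>} - S" for x
      unfolding has_real_derivative_iff_has_vector_derivative[symmetric] F_def
      using that \<eta> by (auto intro!: derivative_eq_intros deriv simp del: power_Suc)
  qed (use \<eta> in auto)
  then have HK: "(F has_integral (G \<eta> / \<eta>) ^ Suc w) {0..\<eta>}"
    using G by (simp add: power_divide)
  obtain C where C: "\<forall>x\<in>{0..\<eta>}. \<bar>G x\<bar> \<le> C"
    using compact_imp_bounded[OF compact_continuous_image[OF G(1) compact_Icc]]
    unfolding bounded_iff real_norm_def by blast
  have int: "set_integrable lborel {0..\<eta>} F"
    unfolding set_integrable_def
  proof (rule integrableI_bounded_set[where A="{0..\<eta>}" and B="(real w + 1) * C ^ w / \<eta> ^ Suc w"])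
    have "(\<lambda>x. indicator {0..\<eta>} x *\<^sub>R F x) = (\<lambda>x. indicator {0..\<eta>} x * ((real w + 1) * (indicator {0..\<eta>} x *\<^sub>R G x) ^ w * g x / \<eta> ^ Suc w))"
      by (auto simp: indicator_def F_def)
    also have "\<dots> \<in> borel_measurable lborel" using g(1) GI by measurable
    finally show "(\<lambda>x. indicator {0..\<eta>} x *\<^sub>R F x) \<in> borel_measurable lborel" .
    show "AE x\<in>{0..\<eta>} in lborel. norm (indicator {0..\<eta>} x *\<^sub>R F x) \<le> (real w + 1) * C ^ w / \<eta> ^ Suc w"
    proof (intro AE_I2 impI)
      fix x assume x: "x \<in> {0..\<eta>}"
      have "\<bar>G x\<bar> ^ w * \<bar>g x\<bar> \<le> C ^ w * 1"
        using bspec[OF C x] g(2)[of x] by (intro mult_mono power_mono) auto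
      then show "norm (indicator {0..\<eta>} x *\<^sub>R F x) \<le> (real w + 1) * C ^ w / \<eta> ^ Suc w"
        using x \<eta> by (simp add: F_def abs_mult power_abs divide_right_mono mult_left_mono mult.assoc)
    qed
  qed (use \<eta> in \<open>auto simp: indicator_def\<close>)
  have "AE x in lborel. x \<noteq> (0::real)" by (rule AE_lborel_singleton)
  then have "AE x in lborel. ?h x = indicator {0..\<eta>} x *\<^sub>R F x"
  proof eventually_elim
    case (elim x)
    then show ?case by (simp add: F_def power_divide)
  qed
  then have "(\<integral>x. ?h x \<partial>lborel) = (LINT x:{0..\<eta>}|lborel. F x)"
    unfolding set_lebesgue_integral_def using \<open>?h \<in> _\<close> int[unfolded set_integrable_def]
    by (intro integral_cong_AE) (auto intro: borel_measurable_integrable)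
  also have "\<dots> = (G \<eta> / \<eta>) ^ Suc w"
    using set_borel_integral_eq_integral(2)[OF int] HK by (simp add: integral_unique)
  finally show "(\<integral>x. ?h x \<partial>lborel) = (G \<eta> / \<eta>) ^ Suc w" .
qed

text \<open>The next vertex sits at the largest of \<open>Suc w\<close> uniform points, and the
  others repeat the situation on the interval below it. The statement is about sequences
  \<open>N k\<close> and \<open>y k\<close> so that it can be applied along subsequences in
  \<open>product_mean_uniform\<close>.\<close>

proposition product_mean_tendsto:
  fixes N y :: "nat \<Rightarrow> nat" and G g :: "real \<Rightarrow> real"
  defines "L \<equiv> \<lambda>k. real (N k) * ln (real (N k))"
  assumes N: "filterlim N at_top sequentially"
    and S: "finite S"
    and G: "\<And>A. continuous_on A G" "G 0 = 0"
    and deriv: "\<And>s. 0 < s \<Longrightarrow> s \<notin> S \<Longrightarrow> (G has_real_derivative g s) (at s)"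
    and cont: "\<And>s. 0 < s \<Longrightarrow> s \<notin> S \<Longrightarrow> isCont g s"
    and g: "g \<in> borel_measurable borel" "\<And>s. 0 \<le> g s \<and> g s \<le> 1"
    and y: "(\<lambda>k. real (y k) / L k) \<longlonglongrightarrow> \<eta>" and \<eta>: "0 < \<eta>"
  shows "(\<lambda>k. product_mean (N k) (\<lambda>z. g (real z / L k)) w (y k)) \<longlonglongrightarrow> (G \<eta> / \<eta>) ^ w"
  using y \<eta>
proof (induction w arbitrary: y \<eta>)
  case (Suc w)
  have L: "filterlim L at_top sequentially"
    unfolding L_def by (rule filterlim_compose[OF filterlim_N_ln_N N])
  define D where "D k = hidden_edges (N k) (Suc w)" for k
  have D: "(\<lambda>k. real (D k) / L k) \<longlonglongrightarrow> 0"
    unfolding D_def L_def by (rule filterlim_compose[OF hidden_edges_negligible N])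
  have L0: "\<forall>\<^sub>F k in sequentially. 0 < L k"
    using L by (simp add: filterlim_at_top_dense)
  have "\<forall>\<^sub>F k in sequentially. real (D k) / L k - real (y k) / L k < 0"
    using Suc.prems by (intro order_tendstoD(2)[OF tendsto_diff[OF D]]) auto
  with L0 have le: "\<forall>\<^sub>F k in sequentially. D k \<le> y k"
    by eventually_elim (simp add: field_simps)
  define \<phi> where "\<phi> k r = g (real (r + D k) / L k) *
    product_mean (N k) (\<lambda>z. g (real z / L k)) w (r + D k)" for k r
  have "(\<lambda>k. urn_mean (Suc w) (\<phi> k) (y k - D k)) \<longlonglongrightarrow>
    (\<integral>x. indicator {0..\<eta>} x * ((real w + 1) * x ^ w / \<eta> ^ Suc w * (g x * (G x / x) ^ w)) \<partial>lborel)"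
  proof (rule urn_mean_tendsto[OF L _ Suc.prems(2) _ S])
    have "(\<lambda>k. real (y k) / L k - real (D k) / L k) \<longlonglongrightarrow> \<eta> - 0"
      by (intro tendsto_diff Suc.prems D)
    moreover have "\<forall>\<^sub>F k in sequentially. real (y k) / L k - real (D k) / L k = real (y k - D k) / L k"
      using le by eventually_elim (simp add: of_nat_diff diff_divide_distrib)
    ultimately show "(\<lambda>k. real (y k - D k) / L k) \<longlonglongrightarrow> \<eta>"
      by (simp add: tendsto_cong)
    show "\<bar>\<phi> k r\<bar> \<le> 1" for k r
      unfolding \<phi>_def using g(2) product_mean_bounds[of "\<lambda>z. g (real z / L k)" "N k" w "r + D k"]
      by (auto simp: abs_mult intro!: mult_le_one)
    show "(\<lambda>k. \<phi> k (r k)) \<longlonglongrightarrow> g s * (G s / s) ^ w"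
      if "0 < s" "s \<notin> S" "(\<lambda>k. real (r k) / L k) \<longlonglongrightarrow> s" for s r
    proof -
      have "(\<lambda>k. real (r k) / L k + real (D k) / L k) \<longlonglongrightarrow> s + 0"
        by (intro tendsto_add that D)
      then have *: "(\<lambda>k. real (r k + D k) / L k) \<longlonglongrightarrow> s" by (simp add: add_divide_distrib)
      show ?thesis
        unfolding \<phi>_def using cont[OF that(1,2)]
        by (intro tendsto_mult Suc.IH[OF * that(1)] isCont_tendsto_compose[OF _ *])
    qed
    show "(\<lambda>x. indicator {0..\<eta>} x * ((real w + 1) * x ^ w / \<eta> ^ Suc w * (g x * (G x / x) ^ w)))
      \<in> borel_measurable lborel"
      using g by (intro integral_power_primitive(1)[OF S Suc.prems(2) G deriv]) auto
  qed
  also have "(\<integral>x. indicator {0..\<eta>} x * ((real w + 1) * x ^ w / \<eta> ^ Suc w * (g x * (G x / x) ^ w)) \<partial>lborel)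
      = (G \<eta> / \<eta>) ^ Suc w"
    using g by (intro integral_power_primitive(2)[OF S Suc.prems(2) G deriv]) auto
  finally have lim: "(\<lambda>k. urn_mean (Suc w) (\<phi> k) (y k - D k)) \<longlonglongrightarrow> (G \<eta> / \<eta>) ^ Suc w" .
  have "\<forall>\<^sub>F k in sequentially. urn_mean (Suc w) (\<phi> k) (y k - D k) =
      product_mean (N k) (\<lambda>z. g (real z / L k)) (Suc w) (y k)"
    using le by eventually_elim (simp add: vertex_step_def \<phi>_def[abs_def] D_def)
  then show ?case using lim by (simp only: tendsto_cong)
qed simp

section \<open>From the last m vertices to all vertices\<close>

lemma plain_mean_outlier_le:
  assumes \<delta>: "0 < \<delta>"
  shows "\<forall>\<^sub>F N in sequentially. plain_mean N (N - m)
      (\<lambda>y. of_bool (\<delta> * (real m + 1) < \<bar>real y / (real N * ln (real N)) - (real m + 1)\<bar>)) \<le>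
    4 / (\<delta>\<^sup>2 * (real m + 1))"
proof -
  define L where "L N = real N * ln (real N)" for N
  define a where "a N = mean_ratio N (N - m)" for N
  define D where "D N = real (hidden_edges N m)" for N
  define M where "M = real m + 1"
  have L: "filterlim L at_top sequentially" unfolding L_def by (rule filterlim_N_ln_N)
  have aL: "(\<lambda>N. a N / L N) \<longlonglongrightarrow> 1" unfolding a_def L_def by (rule mean_ratio_asymp)
  have DL: "(\<lambda>N. D N / L N) \<longlonglongrightarrow> 0" unfolding D_def L_def by (rule hidden_edges_negligible)
  have MLim: "(\<lambda>N. M / L N) \<longlonglongrightarrow> 0" by (rule real_tendsto_divide_at_top[OF tendsto_const L])
  have "(\<lambda>N. M * (\<delta> / 2) * (a N / L N) + M * \<bar>a N / L N - 1\<bar> + (M / L N + D N / L N)) \<longlonglongrightarrow>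
      M * (\<delta> / 2) * 1 + M * \<bar>1 - 1\<bar> + (0 + 0)"
    by (intro tendsto_intros aL DL MLim)
  moreover have "M * (\<delta> / 2) * 1 + M * \<bar>1 - 1\<bar> + (0 + 0) < \<delta> * M" using \<delta> by (simp add: M_def)
  ultimately have "\<forall>\<^sub>F N in sequentially.
      M * (\<delta> / 2) * (a N / L N) + M * \<bar>a N / L N - 1\<bar> + (M / L N + D N / L N) < \<delta> * M"
    by (rule order_tendstoD(2))
  moreover have "\<forall>\<^sub>F N in sequentially. 0 < L N" using L by (simp add: filterlim_at_top_dense)
  moreover have "\<forall>\<^sub>F N in sequentially. m \<le> N" by (rule eventually_ge_at_top)
  ultimately show ?thesis
  proof eventually_elim
    case (elim N)
    have N: "N - (N - m) = m" using elim by simp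
    have a: "0 < a N" using mean_ratio_ge_1[of N "N - m"] by (simp add: a_def)
    \<comment> \<open>Chebyshev: an outlier forces the ratio to deviate from \<open>a N\<close> by
      at least \<open>\<delta> / 2 * a N\<close>, since the other half of the tolerance absorbs the
      deviation of \<open>a N / L N\<close> from 1 and the terms \<open>D N / L N\<close> and
      \<open>M / L N\<close>.\<close>
    let ?c = "4 / (\<delta>\<^sup>2 * (a N)\<^sup>2)"
    have "plain_mean N (N - m) (\<lambda>y. of_bool (\<delta> * M < \<bar>real y / L N - M\<bar>)) \<le>
        plain_mean N (N - m) (\<lambda>y. ?c * (pool_ratio N (N - m) y - a N)\<^sup>2)"
    proof (rule chain_mean_mono)
      fix y
      let ?A = "pool_ratio N (N - m) y"
      have y: "real y / L N - M = M * ((?A - a N) / L N) + M * (a N / L N - 1) + (D N / L N - M / L N)"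
      proof -
        have "M * ?A = real y - D N + M"
          by (simp add: pool_ratio_def pool_size_def N D_def M_def)
        then have "real y = M * ?A + D N - M" by simp
        then show ?thesis using elim(2)
          by (simp add: diff_divide_distrib add_divide_distrib right_diff_distrib)
      qed
      show "of_bool (\<delta> * M < \<bar>real y / L N - M\<bar>) \<le> ?c * (?A - a N)\<^sup>2"
      proof (cases "\<bar>?A - a N\<bar> < \<delta> / 2 * a N")
        case True
        have M: "0 < M" and D: "0 \<le> D N" by (auto simp: M_def D_def)
        have "M * (\<bar>?A - a N\<bar> / L N) \<le> M * (\<delta> / 2 * a N / L N)"
          using M elim(2) True by (intro mult_left_mono divide_right_mono) auto
        moreover have "\<bar>M * ((?A - a N) / L N)\<bar> = M * (\<bar>?A - a N\<bar> / L N)"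
          using M elim(2) by (simp add: abs_mult)
        moreover have "\<bar>M * (a N / L N - 1)\<bar> = M * \<bar>a N / L N - 1\<bar>"
          using M by (simp add: abs_mult)
        moreover have "0 \<le> D N / L N" "0 \<le> M / L N" using M D elim(2) by auto
        moreover have "M * (\<delta> / 2 * a N / L N) = M * (\<delta> / 2) * (a N / L N)" by simp
        ultimately have "\<bar>real y / L N - M\<bar> < \<delta> * M"
          unfolding y using elim(1) by linarith
        then show ?thesis using \<delta> a by simp
      next
        case False
        then have "(\<delta> / 2 * a N)\<^sup>2 \<le> (?A - a N)\<^sup>2"
          using a \<delta> by (intro abs_le_square_iff[THEN iffD1]) auto
        then have "1 \<le> ?c * (?A - a N)\<^sup>2"
          using a \<delta> by (simp add: field_simps power2_eq_square)
        then show ?thesis by (simp add: of_bool_def)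
      qed
    qed (use elim in auto)
    also have "\<dots> \<le> ?c * ((a N)\<^sup>2 / M)"
      unfolding chain_mean_scale
      using plain_mean_pool_ratio_variance[of "N - m" N] N
      by (intro mult_left_mono) (auto simp: a_def M_def)
    also have "\<dots> = 4 / (\<delta>\<^sup>2 * M)" using a by simp
    finally show ?case by (simp add: L_def M_def)
  qed
qed

text \<open>Convergence along all convergent sequences of arguments is uniform on compact sets. If
  uniformity failed, infinitely many \<open>N\<close> would have a bad state; enumerated
  increasingly, they have a subsequence along which the rescaled bad states converge in
  \<open>[\<eta>1, \<eta>2]\<close>.\<close>

lemma product_mean_uniform:
  fixes G g :: "real \<Rightarrow> real"
  defines "L \<equiv> \<lambda>N. real N * ln (real N)"
  assumes S: "finite S"
    and G: "\<And>A. continuous_on A G" "G 0 = 0"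
    and deriv: "\<And>s. 0 < s \<Longrightarrow> s \<notin> S \<Longrightarrow> (G has_real_derivative g s) (at s)"
    and cont: "\<And>s. 0 < s \<Longrightarrow> s \<notin> S \<Longrightarrow> isCont g s"
    and g: "g \<in> borel_measurable borel" "\<And>s. 0 \<le> g s \<and> g s \<le> 1"
    and \<eta>: "0 < \<eta>1" and \<epsilon>: "0 < \<epsilon>"
  shows "\<forall>\<^sub>F N in sequentially. \<forall>y. \<eta>1 \<le> real y / L N \<and> real y / L N \<le> \<eta>2 \<longrightarrow>
    \<bar>product_mean N (\<lambda>z. g (real z / L N)) m y - (G (real y / L N) / (real y / L N)) ^ m\<bar> < \<epsilon>"
proof (rule ccontr)
  let ?bad = "\<lambda>N y. \<eta>1 \<le> real y / L N \<and> real y / L N \<le> \<eta>2 \<and>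
    \<epsilon> \<le> \<bar>product_mean N (\<lambda>z. g (real z / L N)) m y - (G (real y / L N) / (real y / L N)) ^ m\<bar>"
  assume "\<not> ?thesis"
  then have "\<exists>\<^sub>F N in sequentially. \<exists>y. ?bad N y"
    unfolding not_eventually by (rule frequently_elim1) (auto simp: not_less)
  then have inf: "infinite {N. \<exists>y. ?bad N y}"
    by (simp add: frequently_cofinite[symmetric] cofinite_eq_sequentially)
  define N where "N = enumerate {N. \<exists>y. ?bad N y}"
  have N: "strict_mono N" unfolding N_def using inf by (rule strict_mono_enumerate)
  have "\<exists>y. ?bad (N k) y" for k
    using enumerate_in_set[OF inf, of k] by (simp add: N_def)
  then obtain y where y: "\<And>k. ?bad (N k) (y k)" by metis
  have "\<forall>k. real (y k) / L (N k) \<in> {\<eta>1..\<eta>2}" using y by auto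
  then obtain \<eta> r where r: "\<eta> \<in> {\<eta>1..\<eta>2}" "strict_mono (r :: nat \<Rightarrow> nat)"
      "((\<lambda>k. real (y k) / L (N k)) \<circ> r) \<longlonglongrightarrow> \<eta>"
    by (rule seq_compactE[OF compact_imp_seq_compact[OF compact_Icc]])
  have \<eta>0: "0 < \<eta>" using r(1) \<eta> by simp
  have lim: "(\<lambda>k. real ((y \<circ> r) k) / L ((N \<circ> r) k)) \<longlonglongrightarrow> \<eta>" using r(3) by (simp add: o_def)
  have 1: "(\<lambda>k. product_mean ((N \<circ> r) k) (\<lambda>z. g (real z / L ((N \<circ> r) k))) m ((y \<circ> r) k))
      \<longlonglongrightarrow> (G \<eta> / \<eta>) ^ m"
    unfolding L_def
    by (rule product_mean_tendsto[OF filterlim_subseq[OF strict_mono_o[OF N r(2)]] S G deriv cont g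
          lim[unfolded L_def] \<eta>0])
  have "isCont G \<eta>" using G(1)[of UNIV] by (simp add: continuous_on_eq_continuous_at)
  then have 2: "(\<lambda>k. (G (real ((y \<circ> r) k) / L ((N \<circ> r) k)) / (real ((y \<circ> r) k) / L ((N \<circ> r) k))) ^ m)
      \<longlonglongrightarrow> (G \<eta> / \<eta>) ^ m"
    using \<eta>0 by (intro tendsto_intros lim isCont_tendsto_compose[OF _ lim]) auto
  have "(\<lambda>k. \<bar>product_mean ((N \<circ> r) k) (\<lambda>z. g (real z / L ((N \<circ> r) k))) m ((y \<circ> r) k) -
      (G (real ((y \<circ> r) k) / L ((N \<circ> r) k)) / (real ((y \<circ> r) k) / L ((N \<circ> r) k))) ^ m\<bar>)
      \<longlonglongrightarrow> \<bar>(G \<eta> / \<eta>) ^ m - (G \<eta> / \<eta>) ^ m\<bar>"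
    by (intro tendsto_rabs tendsto_diff 1 2)
  then have "\<epsilon> \<le> \<bar>(G \<eta> / \<eta>) ^ m - (G \<eta> / \<eta>) ^ m\<bar>"
    by (rule tendsto_lowerbound) (use y in \<open>auto intro!: always_eventually\<close>)
  then show False using \<epsilon> by simp
qed

lemma filterlim_real_Suc: "filterlim (\<lambda>m. real m + 1) at_top sequentially"
  using filterlim_compose[OF filterlim_real_sequentially filterlim_Suc] by (simp add: add.commute)

lemma one_minus_div_power_tendsto: "(\<lambda>m. (1 - d / (real m + 1)) ^ m) \<longlonglongrightarrow> exp (- d)"
proof -
  have "(\<lambda>m. (1 + (- d) / real (Suc m)) ^ Suc m) \<longlonglongrightarrow> exp (- d)"
    using LIMSEQ_Suc[OF tendsto_exp_limit_sequentially[of "- d"]] .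
  moreover have c: "(\<lambda>m. 1 - d / (real m + 1)) \<longlonglongrightarrow> 1 - 0"
    by (intro tendsto_intros real_tendsto_divide_at_top[OF tendsto_const filterlim_real_Suc])
  ultimately have "(\<lambda>m. (1 + (- d) / real (Suc m)) ^ Suc m / (1 - d / (real m + 1))) \<longlonglongrightarrow> exp (- d) / (1 - 0)"
    by (intro tendsto_divide) auto
  moreover have "\<forall>\<^sub>F m in sequentially. 0 < 1 - d / (real m + 1)"
    using c by (intro order_tendstoD(1)) auto
  then have "\<forall>\<^sub>F m in sequentially. (1 + (- d) / real (Suc m)) ^ Suc m / (1 - d / (real m + 1)) =
      (1 - d / (real m + 1)) ^ m"
    by eventually_elim (simp add: add.commute)
  ultimately show ?thesis by (simp add: tendsto_cong)
qed

text \<open>The choices are made in the order \<open>\<delta>\<close>, \<open>m\<close>,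
  \<open>N\<close>. First \<open>\<delta>\<close> is so small that dividing \<open>c\<close> by
  \<open>1 + \<delta>\<close> or \<open>1 - \<delta>\<close> hardly changes
  \<open>exp (- c)\<close>. Then \<open>m\<close> is so large that outliers are rare and the powers
  are near their limits, and finally \<open>N\<close> is taken large for this
  \<open>m\<close>.\<close>

proposition product_mean_limit:
  fixes G g :: "real \<Rightarrow> real"
  assumes S: "finite S"
    and G: "\<And>A. continuous_on A G" "G 0 = 0"
    and deriv: "\<And>s. 0 < s \<Longrightarrow> s \<notin> S \<Longrightarrow> (G has_real_derivative g s) (at s)"
    and cont: "\<And>s. 0 < s \<Longrightarrow> s \<notin> S \<Longrightarrow> isCont g s"
    and g: "g \<in> borel_measurable borel" "\<And>s. 0 \<le> g s \<and> g s \<le> 1"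
    and R: "0 < R" "\<And>s. R \<le> s \<Longrightarrow> g s = 1" "\<And>s. R \<le> s \<Longrightarrow> G s = s - c"
    and c: "0 \<le> c" "c \<le> R"
  shows "(\<lambda>N. product_mean N (\<lambda>z. g (real z / (real N * ln (real N)))) N (N choose 2)) \<longlonglongrightarrow> exp (- c)"
proof (rule LIMSEQ_I)
  fix \<epsilon> :: real assume \<epsilon>: "0 < \<epsilon>"
  define e where "e = \<epsilon> / 8"
  have e: "0 < e" using \<epsilon> by (simp add: e_def)
  have cont_exp: "((\<lambda>d. exp (- (c / (1 + d)))) \<longlongrightarrow> exp (- (c / (1 + 0)))) (at 0)"
    by (intro tendsto_intros) auto
  obtain \<delta>0 where \<delta>0: "0 < \<delta>0" "\<And>d. d \<noteq> 0 \<Longrightarrow> \<bar>d\<bar> < \<delta>0 \<Longrightarrow> \<bar>exp (- (c / (1 + d))) - exp (- c)\<bar> < e"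
    using LIM_D[OF cont_exp e] by (auto simp: dist_real_def)
  define \<delta> where "\<delta> = min (1/2) (\<delta>0 / 2)"
  have \<delta>: "0 < \<delta>" "\<delta> \<le> 1/2" "\<delta> < \<delta>0" using \<delta>0(1) by (auto simp: \<delta>_def)
  have lim1: "(\<lambda>m. (1 - (c / (1 + d)) / (real m + 1)) ^ m) \<longlonglongrightarrow> exp (- (c / (1 + d)))" for d
    by (rule one_minus_div_power_tendsto)
  have ev: "\<forall>\<^sub>F m in sequentially. \<bar>(1 - (c / (1 + d)) / (real m + 1)) ^ m - exp (- (c / (1 + d)))\<bar> < e" for d
    using tendstoD[OF lim1[of d] e] by (simp add: dist_real_def)
  note r = filterlim_real_Suc
  have "(\<lambda>m. (4 / \<delta>\<^sup>2) / (real m + 1)) \<longlonglongrightarrow> 0"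
    by (rule real_tendsto_divide_at_top[OF tendsto_const r])
  then have ev2: "\<forall>\<^sub>F m in sequentially. (4 / \<delta>\<^sup>2) / (real m + 1) < e"
    using e by (intro order_tendstoD(2)) auto
  \<comment> \<open>Puts the left end \<open>\<eta>1\<close> of the typical window beyond
    \<open>R\<close>.\<close>
  have ev3: "\<forall>\<^sub>F m in sequentially. R / (1 - \<delta>) < real m + 1"
    using r by (simp add: filterlim_at_top_dense)
  obtain m where m: "\<bar>(1 - (c / (1 + \<delta>)) / (real m + 1)) ^ m - exp (- (c / (1 + \<delta>)))\<bar> < e"
      "\<bar>(1 - (c / (1 + - \<delta>)) / (real m + 1)) ^ m - exp (- (c / (1 + - \<delta>)))\<bar> < e"
      "(4 / \<delta>\<^sup>2) / (real m + 1) < e" "R / (1 - \<delta>) < real m + 1"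
    using eventually_happens'[OF sequentially_bot
        eventually_conj[OF ev[of \<delta>] eventually_conj[OF ev[of "- \<delta>"] eventually_conj[OF ev2 ev3]]]]
    by blast
  define L where "L N = real N * ln (real N)" for N
  define \<eta>1 where "\<eta>1 = (1 - \<delta>) * (real m + 1)"
  define \<eta>2 where "\<eta>2 = (1 + \<delta>) * (real m + 1)"
  have \<eta>1: "R < \<eta>1" using m(4) \<delta> by (simp add: \<eta>1_def field_simps)
  have \<eta>2: "\<eta>1 \<le> \<eta>2" using \<delta> by (simp add: \<eta>1_def \<eta>2_def mult_right_mono)
  have hi: "(1 - c / \<eta>2) ^ m \<le> exp (- c) + 2 * e"
  proof -
    have "(1 - c / \<eta>2) ^ m = (1 - (c / (1 + \<delta>)) / (real m + 1)) ^ m" by (simp add: \<eta>2_def)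
    then show ?thesis using m(1) \<delta>0(2)[of \<delta>] \<delta> by linarith
  qed
  have lo: "exp (- c) - 2 * e \<le> (1 - c / \<eta>1) ^ m"
  proof -
    have "(1 - c / \<eta>1) ^ m = (1 - (c / (1 + - \<delta>)) / (real m + 1)) ^ m" by (simp add: \<eta>1_def)
    then show ?thesis using m(2) \<delta>0(2)[of "- \<delta>"] \<delta> by linarith
  qed
  \<comment> \<open>Since \<open>c \<le> R < \<eta>1\<close>, the base \<open>1 - c / s\<close> is
    nonnegative and increasing on the window, so the two ends control all typical states.\<close>
  have mono: "(1 - c / \<eta>1) ^ m \<le> (1 - c / s) ^ m \<and> (1 - c / s) ^ m \<le> (1 - c / \<eta>2) ^ m"
    if "\<eta>1 \<le> s" "s \<le> \<eta>2" for s
    using that c R(1) \<eta>1 by (intro conjI power_mono diff_left_mono divide_left_mono) auto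
  have "\<forall>\<^sub>F N in sequentially. \<forall>y. \<eta>1 \<le> real y / L N \<and> real y / L N \<le> \<eta>2 \<longrightarrow>
    \<bar>product_mean N (\<lambda>z. g (real z / L N)) m y - (G (real y / L N) / (real y / L N)) ^ m\<bar> < e"
    unfolding L_def using \<eta>1 R(1) by (intro product_mean_uniform[OF S G deriv cont g _ e]) auto
  moreover have "\<forall>\<^sub>F N in sequentially. plain_mean N (N - m)
      (\<lambda>y. of_bool (\<delta> * (real m + 1) < \<bar>real y / L N - (real m + 1)\<bar>)) \<le> 4 / (\<delta>\<^sup>2 * (real m + 1))"
    unfolding L_def by (rule plain_mean_outlier_le[OF \<delta>(1)])
  moreover have "\<forall>\<^sub>F N in sequentially. 0 < L N"
    using filterlim_N_ln_N unfolding L_def by (simp add: filterlim_at_top_dense)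
  moreover have "\<forall>\<^sub>F N in sequentially. m \<le> N" by (rule eventually_ge_at_top)
  ultimately have "\<forall>\<^sub>F N in sequentially. norm (product_mean N (\<lambda>z. g (real z / L N)) N (N choose 2) - exp (- c)) < \<epsilon>"
  proof eventually_elim
    case (elim N)
    define out :: "nat \<Rightarrow> real" where
      "out y = of_bool (\<delta> * (real m + 1) < \<bar>real y / L N - (real m + 1)\<bar>)" for y
    define gN where "gN z = g (real z / L N)" for z :: nat
    define U where "U = product_mean N gN m"
    have gN: "0 \<le> gN z \<and> gN z \<le> 1" for z using g(2) by (simp add: gN_def)
    have U: "0 \<le> U y" "U y \<le> 1" for y using product_mean_bounds[of gN N m y] gN by (auto simp: U_def)
    have out01: "0 \<le> out y" "out y \<le> 1" for y by (auto simp: out_def)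
    have in_iff: "\<eta>1 \<le> real y / L N \<and> real y / L N \<le> \<eta>2" if "out y = 0" for y
      using that by (auto simp: out_def \<eta>1_def \<eta>2_def algebra_simps split: if_splits)
    have out_cases: "out y = 0 \<or> out y = 1" for y by (auto simp: out_def)
    define \<beta> where "\<beta> = plain_mean N (N - m) out"
    have \<beta>: "\<beta> \<le> e" using elim(2) m(3) by (simp add: \<beta>_def out_def[abs_def])
    have NM: "N - m \<le> N" "N - (N - m) = m" using elim by auto
    let ?j = "N - m"
    have p: "product_mean N gN N (N choose 2) = chain_mean N gN ?j U"
      using chain_mean_product_mean[OF NM(1), of gN] NM by (simp add: U_def)
    \<comment> \<open>Paths that are typical with \<open>m\<close> vertices left carry weight 1 up
      to there and can be averaged without weights; the rest is bounded by the probability of an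
      outlier.\<close>
    also have "\<dots> = chain_mean N gN ?j (\<lambda>y. (1 - out y) * U y + out y * U y)"
      by (simp add: algebra_simps)
    also have "\<dots> = plain_mean N ?j (\<lambda>y. (1 - out y) * U y) + chain_mean N gN ?j (\<lambda>y. out y * U y)"
      unfolding chain_mean_add
    proof (subst chain_mean_eq_plain_mean[where r = "nat \<lceil>R * L N\<rceil>"])
      fix z assume "nat \<lceil>R * L N\<rceil> \<le> z"
      then have "R * L N \<le> real z" by linarith
      then show "gN z = 1" using elim(3) by (simp add: gN_def R(2) field_simps)
    next
      fix z assume z: "z < nat \<lceil>R * L N\<rceil>"
      then have "real z < R * L N" by linarith
      then have "real z / L N < R" using elim(3) by (simp add: pos_divide_less_eq)
      then have "real z / L N < \<eta>1" using \<eta>1 by linarith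
      then have "out z \<noteq> 0" using in_iff[of z] by auto
      then show "(1 - out z) * U z = 0" using out_cases[of z] by auto
    qed simp
    finally have split: "product_mean N gN N (N choose 2) =
      plain_mean N ?j (\<lambda>y. (1 - out y) * U y) + chain_mean N gN ?j (\<lambda>y. out y * U y)" .
    have 1: "0 \<le> chain_mean N gN ?j (\<lambda>y. out y * U y)"
      using chain_mean_mono[of gN ?j N "\<lambda>_. 0" "\<lambda>y. out y * U y"] gN NM U out01
        chain_mean_scale[of N gN ?j 0 "\<lambda>_. 0"] by simp
    have 2: "chain_mean N gN ?j (\<lambda>y. out y * U y) \<le> \<beta>"
    proof -
      have "chain_mean N gN ?j (\<lambda>y. out y * U y) \<le> plain_mean N ?j (\<lambda>y. out y * U y)"
        using gN U out01 NM by (intro chain_mean_le_plain_mean) auto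
      also have "\<dots> \<le> \<beta>" unfolding \<beta>_def
        using U out01 NM by (intro chain_mean_mono mult_right_le_one_le) auto
      finally show ?thesis .
    qed
    define hi' where "hi' = exp (- c) + 3 * e"
    define lo' where "lo' = exp (- c) - 3 * e"
    have Uin: "lo' \<le> U y \<and> U y \<le> hi'" if "out y = 0" for y
    proof -
      note s = in_iff[OF that]
      have "\<bar>U y - (G (real y / L N) / (real y / L N)) ^ m\<bar> < e"
        using elim(1) s by (simp add: U_def gN_def[abs_def])
      moreover have "G (real y / L N) / (real y / L N) = 1 - c / (real y / L N)"
      proof -
        have "0 < real y / L N" "R \<le> real y / L N" using s \<eta>1 R(1) by linarith+
        moreover from this(2) have "G (real y / L N) = real y / L N - c" by (rule R(3))
        moreover from calculation(1) have "real y / L N / (real y / L N) = 1"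
          by (intro divide_self) linarith
        ultimately show ?thesis by (simp only: diff_divide_distrib)
      qed
      ultimately have "\<bar>U y - (1 - c / (real y / L N)) ^ m\<bar> < e" by simp
      then show ?thesis using mono[of "real y / L N"] s hi lo unfolding hi'_def lo'_def by linarith
    qed
    have ec: "exp (- c) \<le> 1" using c by simp
    have 3: "plain_mean N ?j (\<lambda>y. (1 - out y) * U y) \<le> hi'"
    proof -
      have "plain_mean N ?j (\<lambda>y. (1 - out y) * U y) \<le> plain_mean N ?j (\<lambda>_. hi')"
      proof (rule chain_mean_mono)
        show "(1 - out y) * U y \<le> hi'" for y
          using Uin[of y] out_cases[of y] e by (auto simp: hi'_def intro: add_nonneg_nonneg)
      qed (use NM in auto)
      then show ?thesis using NM by (simp add: plain_mean_const)
    qed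
    have 4: "lo' - \<beta> \<le> plain_mean N ?j (\<lambda>y. (1 - out y) * U y)"
    proof -
      have "plain_mean N ?j (\<lambda>y. lo' + (- 1) * out y) \<le> plain_mean N ?j (\<lambda>y. (1 - out y) * U y)"
      proof (rule chain_mean_mono)
        have "lo' \<le> 1" using ec e unfolding lo'_def by linarith
        then show "lo' + (- 1) * out y \<le> (1 - out y) * U y" for y
          using Uin[of y] out_cases[of y] by auto
      qed (use NM in auto)
      moreover have "plain_mean N ?j (\<lambda>y. lo' + (- 1) * out y) = lo' + (- 1) * \<beta>"
        unfolding chain_mean_add chain_mean_scale \<beta>_def by (simp only: plain_mean_const[OF NM(1)])
      ultimately show ?thesis by simp
    qed
    have "\<bar>product_mean N gN N (N choose 2) - exp (- c)\<bar> \<le> 4 * e"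
      using 1 2 3 4 \<beta> unfolding split hi'_def lo'_def by linarith
    then show ?case using \<epsilon> by (simp add: gN_def[abs_def] e_def)
  qed
  then show "\<exists>n0. \<forall>N\<ge>n0. norm (product_mean N (\<lambda>z. g (real z / (real N * ln (real N)))) N (N choose 2) - exp (- c)) < \<epsilon>"
    by (simp add: eventually_sequentially L_def)
qed

section \<open>Generating functions and point probabilities\<close>

text \<open>The tail bounds hold for generating functions of sub-probabilities and suffice to read off the
  coefficients one after the other, letting \<open>x\<close> tend to 0.\<close>

lemma gen_fun_coeff_tendsto:
  fixes a :: "nat \<Rightarrow> nat \<Rightarrow> real" and A :: "nat \<Rightarrow> real \<Rightarrow> real"
  assumes conv: "\<And>x. 0 < x \<Longrightarrow> x < 1 \<Longrightarrow> (\<lambda>N. A N x) \<longlonglongrightarrow> B x"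
    and a: "\<And>N x k. 0 < x \<Longrightarrow> x < 1 \<Longrightarrow> \<bar>A N x - (\<Sum>j\<le>k. a N j * x ^ j)\<bar> \<le> x ^ Suc k"
    and b: "\<And>x k. 0 < x \<Longrightarrow> x < 1 \<Longrightarrow> \<bar>B x - (\<Sum>j\<le>k. b j * x ^ j)\<bar> \<le> x ^ Suc k"
  shows "(\<lambda>N. a N k) \<longlonglongrightarrow> b k"
proof (induction k rule: less_induct)
  case (less k)
  show ?case
  proof (rule LIMSEQ_I)
    fix e :: real assume e: "0 < e"
    \<comment> \<open>With \<open>x \<le> e / 4\<close> the two tails, \<open>2 * x ^ Suc k\<close>
      together, take up at most half of \<open>e * x ^ k\<close>.\<close>
    define x where "x = min (1/2) (e / 4)"
    have x: "0 < x" "x < 1" "x \<le> e / 4" using e by (auto simp: x_def)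
    have "(\<lambda>N. (A N x - B x) - (\<Sum>j<k. (a N j - b j) * x ^ j)) \<longlonglongrightarrow>
        (B x - B x) - (\<Sum>j<k. (b j - b j) * x ^ j)"
      using less by (intro tendsto_intros conv x) auto
    then have "(\<lambda>N. (A N x - B x) - (\<Sum>j<k. (a N j - b j) * x ^ j)) \<longlonglongrightarrow> 0" by simp
    moreover have "0 < e / 2 * x ^ k" using e x by simp
    ultimately obtain M where M: "\<And>N. N \<ge> M \<Longrightarrow>
        norm ((A N x - B x) - (\<Sum>j<k. (a N j - b j) * x ^ j) - 0) < e / 2 * x ^ k"
      using LIMSEQ_D by blast
    have "norm (a N k - b k) < e" if N: "N \<ge> M" for N
    proof -
      let ?d = "(A N x - B x) - (\<Sum>j<k. (a N j - b j) * x ^ j)"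
      have "(a N k - b k) * x ^ k = ?d - ((A N x - (\<Sum>j\<le>k. a N j * x ^ j)) - (B x - (\<Sum>j\<le>k. b j * x ^ j)))"
        by (simp add: lessThan_Suc_atMost[symmetric] sum_subtractf algebra_simps)
      then have "\<bar>(a N k - b k) * x ^ k\<bar> < e / 2 * x ^ k + 2 * x ^ Suc k"
        using M[OF N] a[OF x(1,2), of N k] b[OF x(1,2), of k] by (simp only: real_norm_def abs_le_iff) linarith
      also have "\<dots> \<le> e * x ^ k"
        using mult_right_mono[OF x(3), of "x ^ k"] x by (simp add: field_simps)
      finally show ?thesis using x by (simp add: abs_mult)
    qed
    then show "\<exists>M. \<forall>N\<ge>M. norm (a N k - b k) < e" by blast
  qed
qed

section \<open>Poisson weights and their generating function\<close>

definition poisson_weight :: "real \<Rightarrow> nat \<Rightarrow> real" where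
  "poisson_weight l k = l ^ k / fact k * exp (- l)"

lemma poisson_weight_nonneg: "0 \<le> l \<Longrightarrow> 0 \<le> poisson_weight l k"
  by (simp add: poisson_weight_def)

lemma poisson_weight_sums: "poisson_weight l sums 1"
proof -
  have "(\<lambda>k. l ^ k / fact k) sums exp l" 
    using exp_converges[of l] by (simp add: field_simps scaleR_conv_of_real)
  then have "(\<lambda>k. l ^ k / fact k * exp (- l)) sums (exp l * exp (- l))" by (rule sums_mult2)
  then show ?thesis by (simp add: poisson_weight_def[abs_def] exp_minus)
qed

lemma poisson_gen_fun_sums: "(\<lambda>k. poisson_weight l k * x ^ k) sums exp (l * (x - 1))"
proof -
  have "(\<lambda>k. (l * x) ^ k / fact k) sums exp (l * x)" 
    using exp_converges[of "l * x"] by (simp add: field_simps scaleR_conv_of_real)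
  then have "(\<lambda>k. (l * x) ^ k / fact k * exp (- l)) sums (exp (l * x) * exp (- l))" by (rule sums_mult2)
  also have "exp (l * x) * exp (- l) = exp (l * (x - 1))" by (simp add: exp_add[symmetric] algebra_simps)
  finally show ?thesis
    by (rule sums_cong[THEN iffD1, rotated]) (simp add: poisson_weight_def power_mult_distrib)
qed

lemma poisson_gen_fun_tail:
  assumes "0 \<le> l" "0 < x" "x < 1"
  shows "\<bar>exp (l * (x - 1)) - (\<Sum>j\<le>k. poisson_weight l j * x ^ j)\<bar> \<le> x ^ Suc k"
proof -
  note s = poisson_gen_fun_sums[of l x]
  have s1: "(\<lambda>i. poisson_weight l (i + Suc k) * x ^ (i + Suc k)) sums
      (exp (l * (x - 1)) - (\<Sum>j\<le>k. poisson_weight l j * x ^ j))"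
    using s by (subst sums_iff_shift) (simp add: lessThan_Suc_atMost)
  have s2: "(\<lambda>i. poisson_weight l (i + Suc k) * x ^ Suc k) sums
      ((1 - (\<Sum>j\<le>k. poisson_weight l j)) * x ^ Suc k)"
    using poisson_weight_sums by (intro sums_mult2, subst sums_iff_shift) (simp add: lessThan_Suc_atMost)
  have "0 \<le> exp (l * (x - 1)) - (\<Sum>j\<le>k. poisson_weight l j * x ^ j)"
    by (rule sums_le[OF _ sums_zero s1]) (use assms poisson_weight_nonneg in auto)
  moreover have "exp (l * (x - 1)) - (\<Sum>j\<le>k. poisson_weight l j * x ^ j) \<le>
      (1 - (\<Sum>j\<le>k. poisson_weight l j)) * x ^ Suc k"
    by (rule sums_le[OF _ s1 s2])
      (use assms poisson_weight_nonneg in \<open>auto intro!: mult_left_mono power_decreasing\<close>)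
  moreover have "(1 - (\<Sum>j\<le>k. poisson_weight l j)) * x ^ Suc k \<le> 1 * x ^ Suc k"
    using assms poisson_weight_nonneg[OF assms(1)] by (intro mult_right_mono) (auto intro: sum_nonneg)
  ultimately show ?thesis by simp
qed

text \<open>The factor \<open>Z\<close> carries the other coordinates while
  \<open>joint_gen_fun_imp_counts\<close> turns the power in one coordinate into an
  indicator.\<close>

lemma gen_fun_tail:
  fixes Z :: "'h \<Rightarrow> real" and C :: "'h \<Rightarrow> nat"
  assumes Z: "\<And>h. 0 \<le> Z h \<and> Z h \<le> 1" and x: "0 < x" "x < 1"
  shows "\<bar>measure_pmf.expectation p (\<lambda>h. Z h * x ^ C h) -
    (\<Sum>j\<le>k. measure_pmf.expectation p (\<lambda>h. Z h * of_bool (C h = j)) * x ^ j)\<bar> \<le> x ^ Suc k"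
proof -
  have bd: "integrable p f" if "\<And>h. \<bar>f h\<bar> \<le> (1::real)" for f
    using that by (intro measure_pmf.integrable_const_bound[where B=1]) auto
  have zb: "\<bar>Z h * t\<bar> \<le> t" if "0 \<le> t" for h t
    using Z[of h] that mult_right_mono[of "Z h" 1 t] by (simp add: abs_mult)
  have i1: "integrable p (\<lambda>h. Z h * of_bool (C h = j))" for j
  proof (rule bd)
    show "\<bar>Z h * of_bool (C h = j)\<bar> \<le> 1" for h
      using Z[of h] by (cases "C h = j") auto
  qed
  have i2: "integrable p (\<lambda>h. Z h * x ^ C h)"
  proof (rule bd)
    show "\<bar>Z h * x ^ C h\<bar> \<le> 1" for h
      using zb[of "x ^ C h" h] power_le_one[of x "C h"] zero_le_power[of x "C h"] x by linarith
  qed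
  have "measure_pmf.expectation p (\<lambda>h. Z h * x ^ C h) -
      (\<Sum>j\<le>k. measure_pmf.expectation p (\<lambda>h. Z h * of_bool (C h = j)) * x ^ j) =
    measure_pmf.expectation p (\<lambda>h. Z h * x ^ C h - (\<Sum>j\<le>k. Z h * of_bool (C h = j) * x ^ j))"
    using i1 i2 by simp
  also have "(\<lambda>h. Z h * x ^ C h - (\<Sum>j\<le>k. Z h * of_bool (C h = j) * x ^ j)) =
      (\<lambda>h. Z h * (of_bool (k < C h) * x ^ C h))"
  proof
    fix h
    have "(\<Sum>j\<le>k. Z h * of_bool (C h = j) * x ^ j) = (\<Sum>j\<le>k. if j = C h then Z h * x ^ j else 0)"
      by (intro sum.cong) auto
    also have "\<dots> = of_bool (C h \<le> k) * (Z h * x ^ C h)" by (simp add: sum.delta)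
    finally show "Z h * x ^ C h - (\<Sum>j\<le>k. Z h * of_bool (C h = j) * x ^ j) =
        Z h * (of_bool (k < C h) * x ^ C h)" by auto
  qed
  finally have eq: "measure_pmf.expectation p (\<lambda>h. Z h * x ^ C h) -
      (\<Sum>j\<le>k. measure_pmf.expectation p (\<lambda>h. Z h * of_bool (C h = j)) * x ^ j) =
    measure_pmf.expectation p (\<lambda>h. Z h * (of_bool (k < C h) * x ^ C h))" .
  have 1: "\<bar>Z h * (of_bool (k < C h) * x ^ C h)\<bar> \<le> x ^ Suc k" for h
  proof (rule order_trans[OF zb])
    show "0 \<le> of_bool (k < C h) * x ^ C h" using x by simp
    show "of_bool (k < C h) * x ^ C h \<le> x ^ Suc k"
      using x power_decreasing[of "Suc k" "C h" x] by (cases "k < C h") auto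
  qed
  have "\<bar>measure_pmf.expectation p (\<lambda>h. Z h * (of_bool (k < C h) * x ^ C h))\<bar> \<le>
      measure_pmf.expectation p (\<lambda>h. \<bar>Z h * (of_bool (k < C h) * x ^ C h)\<bar>)"
    by (rule integral_abs_bound)
  also have "\<dots> \<le> x ^ Suc k"
  proof (rule measure_pmf.integral_le_const)
    show "integrable p (\<lambda>h. \<bar>Z h * (of_bool (k < C h) * x ^ C h)\<bar>)"
    proof (rule bd)
      show "\<bar>\<bar>Z h * (of_bool (k < C h) * x ^ C h)\<bar>\<bar> \<le> 1" for h
        using 1[of h] power_le_one[of x "Suc k"] x by linarith
    qed
    show "AE h in p. \<bar>Z h * (of_bool (k < C h) * x ^ C h)\<bar> \<le> x ^ Suc k"
      using 1 by (intro AE_I2)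
  qed
  finally show ?thesis unfolding eq .
qed

text \<open>One coordinate at a time: after \<open>j\<close> steps the first \<open>j\<close> powers
  have become indicators while the remaining variables are still free in \<open>[0, 1]\<close>. The
  expectation is then a power series in the next variable, and its coefficients converge by
  \<open>gen_fun_coeff_tendsto\<close>.\<close>

lemma joint_gen_fun_imp_counts:
  fixes p :: "nat \<Rightarrow> 'h pmf" and C :: "nat \<Rightarrow> 'h \<Rightarrow> nat \<Rightarrow> nat" and l :: real
  assumes l: "0 \<le> l"
    and conv: "\<And>x. (\<And>i. 0 \<le> x i \<and> x i \<le> 1) \<Longrightarrow>
      (\<lambda>N. measure_pmf.expectation (p N) (\<lambda>h. \<Prod>i<d. x i ^ C N h i)) \<longlonglongrightarrow>
        (\<Prod>i<d. exp (l * (x i - 1)))"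
  shows "(\<lambda>N. measure_pmf.prob (p N) {h. \<forall>i<d. C N h i = c i}) \<longlonglongrightarrow>
    (\<Prod>i<d. poisson_weight l (c i))"
proof -
  have "(\<lambda>N. measure_pmf.expectation (p N)
      (\<lambda>h. (\<Prod>i<j. of_bool (C N h i = c i)) * (\<Prod>i\<in>{j..<d}. x i ^ C N h i))) \<longlonglongrightarrow>
    (\<Prod>i<j. poisson_weight l (c i)) * (\<Prod>i\<in>{j..<d}. exp (l * (x i - 1)))"
    if "j \<le> d" "\<And>i. 0 \<le> x i \<and> x i \<le> 1" for j x
    using that
  proof (induction j arbitrary: x)
    case 0
    then show ?case using conv[of x] by (simp add: atLeast0LessThan)
  next
    case (Suc j)
    let ?Z = "\<lambda>N h. (\<Prod>i<j. of_bool (C N h i = c i)) * (\<Prod>i\<in>{Suc j..<d}. x i ^ C N h i)"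
    let ?z = "(\<Prod>i<j. poisson_weight l (c i)) * (\<Prod>i\<in>{Suc j..<d}. exp (l * (x i - 1)))"
    have Z: "0 \<le> ?Z N h \<and> ?Z N h \<le> 1" for N h
      using Suc.prems(2)
      by (auto intro!: mult_nonneg_nonneg mult_le_one prod_nonneg prod_le_1 power_le_one)
    have pw: "poisson_weight l k \<le> 1" for k
      using sums_le[OF _ sums_single[of k "\<lambda>_. poisson_weight l k"] poisson_weight_sums[of l]]
        poisson_weight_nonneg[OF l] by auto
    have z: "0 \<le> ?z" "?z \<le> 1"
      using Suc.prems(2) l pw poisson_weight_nonneg[OF l]
      by (auto intro!: mult_nonneg_nonneg mult_le_one prod_nonneg prod_le_1 mult_nonneg_nonpos)
    have split: "{j..<d} = insert j {Suc j..<d}" using Suc.prems by auto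
    have "(\<lambda>N. measure_pmf.expectation (p N) (\<lambda>h. ?Z N h * of_bool (C N h j = k))) \<longlonglongrightarrow>
      ?z * poisson_weight l k" for k
    proof (rule gen_fun_coeff_tendsto[where A = "\<lambda>N t. measure_pmf.expectation (p N) (\<lambda>h. ?Z N h * t ^ C N h j)"
          and B = "\<lambda>t. ?z * exp (l * (t - 1))"])
      fix t :: real assume t: "0 < t" "t < 1"
      have "(\<lambda>N. measure_pmf.expectation (p N)
          (\<lambda>h. (\<Prod>i<j. of_bool (C N h i = c i)) * (\<Prod>i\<in>{j..<d}. (x(j:=t)) i ^ C N h i))) \<longlonglongrightarrow>
        (\<Prod>i<j. poisson_weight l (c i)) * (\<Prod>i\<in>{j..<d}. exp (l * ((x(j:=t)) i - 1)))"
        using Suc.prems t by (intro Suc.IH) auto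
      then show "(\<lambda>N. measure_pmf.expectation (p N) (\<lambda>h. ?Z N h * t ^ C N h j)) \<longlonglongrightarrow>
          ?z * exp (l * (t - 1))"
        unfolding split by (simp add: mult_ac)
      show "\<bar>measure_pmf.expectation (p N) (\<lambda>h. ?Z N h * t ^ C N h j) - 
          (\<Sum>i\<le>k. measure_pmf.expectation (p N) (\<lambda>h. ?Z N h * of_bool (C N h j = i)) * t ^ i)\<bar> \<le> t ^ Suc k" for N k
        by (rule gen_fun_tail[OF Z t])
      show "\<bar>?z * exp (l * (t - 1)) - (\<Sum>i\<le>k. ?z * poisson_weight l i * t ^ i)\<bar> \<le> t ^ Suc k" for k
      proof -
        have "\<bar>z * exp (l * (t - 1)) - (\<Sum>i\<le>k. z * poisson_weight l i * t ^ i)\<bar> =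
            z * \<bar>exp (l * (t - 1)) - (\<Sum>i\<le>k. poisson_weight l i * t ^ i)\<bar>"
          if "0 \<le> z" for z
          using that 
          by (simp add: sum_distrib_left[symmetric] mult.assoc right_diff_distrib[symmetric] abs_mult)
        from this[OF z(1)]
        have "\<bar>?z * exp (l * (t - 1)) - (\<Sum>i\<le>k. ?z * poisson_weight l i * t ^ i)\<bar> =
            ?z * \<bar>exp (l * (t - 1)) - (\<Sum>i\<le>k. poisson_weight l i * t ^ i)\<bar>" .
        also have "\<dots> \<le> 1 * t ^ Suc k"
          using z poisson_gen_fun_tail[OF l t, of k] by (intro mult_mono) auto
        finally show ?thesis by simp
      qed
    qed
    from this[of "c j"] show ?case
      by (simp add: mult_ac)
  qed
  from this[of d "\<lambda>_. 0"]
  have "(\<lambda>N. measure_pmf.expectation (p N) (\<lambda>h. \<Prod>i<d. of_bool (C N h i = c i))) \<longlonglongrightarrow>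
    (\<Prod>i<d. poisson_weight l (c i))" by simp
  also have "(\<lambda>N. measure_pmf.expectation (p N) (\<lambda>h. \<Prod>i<d. of_bool (C N h i = c i))) =
    (\<lambda>N. measure_pmf.prob (p N) {h. \<forall>i<d. C N h i = c i})"
  proof
    fix N
    have "(\<Prod>i<d. of_bool (C N h i = c i)) = indicat_real {h. \<forall>i<d. C N h i = c i} h" for h
      by (induction d) (auto simp: indicator_def less_Suc_eq)
    then show "measure_pmf.expectation (p N) (\<lambda>h. \<Prod>i<d. of_bool (C N h i = c i)) =
      measure_pmf.prob (p N) {h. \<forall>i<d. C N h i = c i}" by simp
  qed
  finally show ?thesis .
qed

section \<open>Counts in the cells of a grid\<close>

definition cell :: "real \<Rightarrow> nat \<Rightarrow> real set" where
  "cell a i = {real i * a..<real (Suc i) * a}"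

definition cell_weight :: "real \<Rightarrow> nat \<Rightarrow> (nat \<Rightarrow> real) \<Rightarrow> real \<Rightarrow> real" where
  "cell_weight a d x s = (\<Prod>i<d. if s \<in> cell a i then x i else 1)"

text \<open>For \<open>a > 0\<close> and \<open>s \<ge> 0\<close> the clipped difference is the
  length of \<open>[0, s] \<inter> cell a i\<close>, which makes this the integral of
  \<open>cell_weight\<close> over \<open>[0, s]\<close>.\<close>

definition cell_primitive :: "real \<Rightarrow> nat \<Rightarrow> (nat \<Rightarrow> real) \<Rightarrow> real \<Rightarrow> real" where
  "cell_primitive a d x s =
     s + (\<Sum>i<d. (x i - 1) * (max (real i * a) (min s (real (Suc i) * a)) - real i * a))"

lemma cell_less:
  assumes "0 < a" "s \<in> cell a i" "i < d"
  shows "s < real d * a"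
proof -
  have "real (Suc i) * a \<le> real d * a" using assms by (intro mult_right_mono) auto
  then show ?thesis using assms(2) by (simp add: cell_def)
qed

lemma cell_weight_eq_sum:
  assumes a: "0 < a"
  shows "cell_weight a d x s = 1 + (\<Sum>i<d. (x i - 1) * indicator (cell a i) s)"
proof (induction d)
  case (Suc d)
  show ?case
  proof (cases "s \<in> cell a d")
    case True
    then have "s \<notin> cell a i" if "i < d" for i
      using cell_less[OF a _ that, of s] by (auto simp: cell_def)
    then have "cell_weight a d x s = 1" "(\<Sum>i<d. (x i - 1) * indicator (cell a i) s) = 0"
      by (auto simp: cell_weight_def intro!: prod.neutral sum.neutral)
    then show ?thesis using True by (simp add: cell_weight_def)
  next
    case False
    then show ?thesis using Suc by (simp add: cell_weight_def)
  qed
qed (simp add: cell_weight_def)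

lemma cell_weight_bounds:
  assumes "\<And>i. 0 \<le> x i \<and> x i \<le> 1"
  shows "0 \<le> cell_weight a d x s \<and> cell_weight a d x s \<le> 1"
  unfolding cell_weight_def using assms by (auto intro!: prod_nonneg prod_le_1)

lemma cell_primitive_deriv:
  assumes a: "0 < a" and s: "0 < s" "s \<notin> (\<lambda>i. real i * a) ` {..d}"
  shows "(cell_primitive a d x has_real_derivative cell_weight a d x s) (at s)"
    and "isCont (cell_weight a d x) s"
proof -
  have ne: "s \<noteq> real i * a" "s \<noteq> real (Suc i) * a" if "i < d" for i
    using s(2) that by (auto simp del: of_nat_Suc)
  have 1: "((\<lambda>t. max (real i * a) (min t (real (Suc i) * a)) - real i * a) has_real_derivative
      indicator (cell a i) s) (at s)" if "i < d" for i
  proof -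
    note n = ne[OF that]
    have le: "real i * a \<le> real (Suc i) * a" using a by (intro mult_right_mono) auto
    consider "s < real i * a" | "real i * a < s" "s < real (Suc i) * a" | "real (Suc i) * a < s"
      using n by linarith
    then show ?thesis
    proof cases
      case 1
      have "((\<lambda>t. 0) has_real_derivative indicator (cell a i) s) (at s)"
        using 1 by (auto simp: cell_def)
      then show ?thesis
        by (rule has_field_derivative_transform_within_open[of _ _ _ "{..<real i * a}"])
          (use 1 le in \<open>auto simp del: of_nat_Suc\<close>)
    next
      case 2
      have "((\<lambda>t. t - real i * a) has_real_derivative indicator (cell a i) s) (at s)"
        using 2 by (auto simp: cell_def intro!: derivative_eq_intros)
      then show ?thesis
        by (rule has_field_derivative_transform_within_open[of _ _ _ "{real i * a<..<real (Suc i) * a}"])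
          (use 2 in \<open>auto simp del: of_nat_Suc\<close>)
    next
      case 3
      have "((\<lambda>t. real (Suc i) * a - real i * a) has_real_derivative indicator (cell a i) s) (at s)"
        using 3 by (auto simp: cell_def)
      then show ?thesis
        by (rule has_field_derivative_transform_within_open[of _ _ _ "{real (Suc i) * a<..}"])
          (use 3 le in \<open>auto simp del: of_nat_Suc\<close>)
    qed
  qed
  have "((\<lambda>s. s + (\<Sum>i<d. (x i - 1) * (max (real i * a) (min s (real (Suc i) * a)) - real i * a)))
      has_real_derivative (1 + (\<Sum>i<d. (x i - 1) * indicator (cell a i) s))) (at s)"
    by (intro DERIV_add DERIV_ident DERIV_sum DERIV_cmult 1) auto
  then show "(cell_primitive a d x has_real_derivative cell_weight a d x s) (at s)"
    by (simp add: cell_weight_eq_sum[OF a] cell_primitive_def[abs_def])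
  have "isCont (indicator (cell a i) :: real \<Rightarrow> real) s" if "i < d" for i
  proof -
    have "s \<notin> frontier (cell a i)"
    proof -
      have "closure (cell a i) \<subseteq> {real i * a..real (Suc i) * a}"
        by (rule closure_minimal) (auto simp: cell_def)
      moreover have "interior (cell a i) = {real i * a<..<real (Suc i) * a}"
        by (simp add: cell_def)
      ultimately show ?thesis using ne[OF that] unfolding frontier_def by force
    qed
    then show ?thesis by (simp add: isCont_indicator)
  qed
  then have "isCont (\<lambda>s. 1 + (\<Sum>i<d. (x i - 1) * indicator (cell a i) s)) s"
    by (intro continuous_intros) auto
  then show "isCont (cell_weight a d x) s"
    by (simp add: cell_weight_eq_sum[OF a, abs_def])
qed

section \<open>Generating function of the cell counts\<close>

lemma edge_count_le: "edge_count h n \<le> occupied_edges h"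
proof (induction h n rule: edge_count.induct)
  case (2 v h n)
  have "occupied_edges (Vertex v # h) = occupied_edges h"
    unfolding occupied_edges_def Vertex_set_Cons ..
  then show ?case using 2 by simp
next
  case (3 e h n)
  have "occupied_edges h \<le> occupied_edges (Edge e # h)"
    unfolding occupied_edges_def Vertex_set_Cons by (intro card_mono) (auto simp: finite_occupied)
  then show ?case using 3 by simp
qed simp

definition scaled_atom :: "nat \<Rightarrow> element list \<Rightarrow> nat \<Rightarrow> real" where
  "scaled_atom N h n = (real (N choose 2) - real (edge_count h n)) / (real N * ln (real N))"

definition cell_count :: "real \<Rightarrow> nat \<Rightarrow> element list \<Rightarrow> nat \<Rightarrow> nat" where
  "cell_count a N h i = card {n \<in> {1..N}. scaled_atom N h n \<in> cell a i}"

lemma prod_cell_weight: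
  "(\<Prod>n=1..N. cell_weight a d x (scaled_atom N h n)) = (\<Prod>i<d. x i ^ cell_count a N h i)"
proof -
  have "(\<Prod>n=1..N. cell_weight a d x (scaled_atom N h n)) =
      (\<Prod>i<d. \<Prod>n=1..N. if scaled_atom N h n \<in> cell a i then x i else 1)"
    unfolding cell_weight_def by (rule prod.swap)
  also have "\<dots> = (\<Prod>i<d. x i ^ cell_count a N h i)"
    unfolding cell_count_def by (subst prod.inter_filter[symmetric]) auto
  finally show ?thesis .
qed

proposition cell_count_gen_fun:
  assumes a: "0 < a" and x: "\<And>i. 0 \<le> x i \<and> x i \<le> (1::real)"
  shows "(\<lambda>N. measure_pmf.expectation (growing_graph N) (\<lambda>h. \<Prod>i<d. x i ^ cell_count a N h i))
    \<longlonglongrightarrow> (\<Prod>i<d. exp (a * (x i - 1)))"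
proof -
  define c where "c = (\<Sum>i<d. a * (1 - x i))"
  have R: "real d * a \<le> real (Suc d) * a" using a by (intro mult_right_mono) auto
  have lim: "(\<lambda>N. product_mean N (\<lambda>z. cell_weight a d x (real z / (real N * ln (real N)))) N (N choose 2))
      \<longlonglongrightarrow> exp (- c)"
  \<comment> \<open>The grid points are the possible jumps of the weight. \<open>Suc d\<close>
    instead of \<open>d\<close> keeps \<open>R\<close> positive even without cells.\<close>
  proof (rule product_mean_limit[where S="(\<lambda>i. real i * a) ` {..d}" and G="cell_primitive a d x"
        and R="real (Suc d) * a"])
    show "continuous_on A (cell_primitive a d x)" for A
      unfolding cell_primitive_def[abs_def] by (intro continuous_intros)
    show "cell_primitive a d x 0 = 0"
    proof -
      have "max (real i * a) (min 0 (real (Suc i) * a)) = real i * a" for i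
        using a by (intro max_absorb1 order_trans[OF min.cobounded1]) auto
      then show ?thesis by (simp add: cell_primitive_def)
    qed
    show "cell_weight a d x \<in> borel_measurable borel"
      unfolding cell_weight_def[abs_def] cell_def by measurable
    show "cell_weight a d x s = 1" if "real (Suc d) * a \<le> s" for s
    proof -
      have "s \<notin> cell a i" if "i < d" for i
        using cell_less[OF a _ that, of s] R \<open>real (Suc d) * a \<le> s\<close> by linarith
      then show ?thesis by (simp add: cell_weight_def)
    qed
    show "cell_primitive a d x s = s - c" if "real (Suc d) * a \<le> s" for s
    proof -
      have "(x i - 1) * (max (real i * a) (min s (real (Suc i) * a)) - real i * a) = - (a * (1 - x i))"
        if "i < d" for i
      proof -
        have "real (Suc i) * a \<le> real (Suc d) * a" using a that by (intro mult_right_mono) auto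
        then have "min s (real (Suc i) * a) = real (Suc i) * a"
          using \<open>real (Suc d) * a \<le> s\<close> by linarith
        then show ?thesis using a by (simp add: max_def algebra_simps)
      qed
      then show ?thesis unfolding cell_primitive_def c_def by (simp add: sum_negf)
    qed
    show "0 \<le> c" unfolding c_def using x a by (auto intro!: sum_nonneg)
    have "c \<le> (\<Sum>i<d. a)" unfolding c_def using x a by (intro sum_mono mult_left_le) auto
    then show "c \<le> real (Suc d) * a" using R by simp
  qed (use a cell_primitive_deriv[OF a] cell_weight_bounds[OF x] in auto)
  have "measure_pmf.expectation (growing_graph N) (\<lambda>h. \<Prod>i<d. x i ^ cell_count a N h i) =
      product_mean N (\<lambda>z. cell_weight a d x (real z / (real N * ln (real N)))) N (N choose 2)" for N
  proof -
    have "measure_pmf.expectation (growing_graph N) (\<lambda>h. \<Prod>i<d. x i ^ cell_count a N h i) =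
      measure_pmf.expectation (growing_graph N) (\<lambda>h. \<Prod>n=1..N.
        cell_weight a d x (real ((N choose 2) - edge_count h n) / (real N * ln (real N))))"
    proof (intro integral_cong_AE; (simp add: AE_measure_pmf_iff)?)
      show "\<forall>h\<in>set_pmf (growing_graph N). (\<Prod>i<d. x i ^ cell_count a N h i) = (\<Prod>n = Suc 0..N.
        cell_weight a d x (real ((N choose 2) - edge_count h n) / (real N * ln (real N))))"
      proof
        \<comment> \<open>On the support the counts stay below \<open>N choose 2\<close>, so
          subtraction of naturals is not truncated and agrees with the real difference.\<close>
        fix h assume "h \<in> set_pmf (growing_graph N)"
        then have "edge_count h n \<le> N choose 2" for n
          using edge_count_le[of h n] pool_growing_graph(3) by metis
        then show "(\<Prod>i<d. x i ^ cell_count a N h i) = (\<Prod>n = Suc 0..N.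
          cell_weight a d x (real ((N choose 2) - edge_count h n) / (real N * ln (real N))))"
          unfolding prod_cell_weight[symmetric] by (simp add: scaled_atom_def of_nat_diff)
      qed
    qed
    also have "\<dots> = product_mean N (\<lambda>z. cell_weight a d x (real z / (real N * ln (real N)))) N (N choose 2)"
      by (rule expectation_growing_graph) (rule cell_weight_bounds[OF x])
    finally show ?thesis .
  qed
  moreover have "exp (- c) = (\<Prod>i<d. exp (a * (x i - 1)))"
    by (simp add: c_def exp_sum[symmetric] sum_negf[symmetric] algebra_simps)
  ultimately show ?thesis using lim by simp
qed

corollary cell_count_tendsto_poisson:
  assumes "0 < a"
  shows "(\<lambda>N. measure_pmf.prob (growing_graph N) {h. \<forall>i<d. cell_count a N h i = c i})
    \<longlonglongrightarrow> (\<Prod>i<d. poisson_weight a (c i))"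
  using assms by (intro joint_gen_fun_imp_counts cell_count_gen_fun) auto

section \<open>Vague convergence and discretisation\<close>

abbreviation atom_measure :: "'i set \<Rightarrow> ('i \<Rightarrow> real) \<Rightarrow> real measure" where
  "atom_measure A t \<equiv> distr (count_space A) half_line t"

lemma space_half_line: "space half_line = {0..}"
  by (simp add: space_restrict_space)

lemma atLeastAtMost_half_line: "{0..r} \<in> sets half_line"
  by (auto simp: sets_restrict_space_iff)

lemma cell_half_line: "0 < a \<Longrightarrow> cell a i \<in> sets half_line"
  by (auto simp: sets_restrict_space_iff cell_def intro: order_trans[rotated])

lemma bounded_cell: "bounded (cell a i)"
  unfolding cell_def by simp

lemma measurable_atoms:
  "(\<And>a. a \<in> A \<Longrightarrow> 0 \<le> t a) \<Longrightarrow> t \<in> measurable (count_space A) half_line"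
  by (auto simp: space_half_line)

lemma emeasure_atom_measure:
  assumes "\<And>a. a \<in> A \<Longrightarrow> 0 \<le> t a" "B \<in> sets half_line" "finite {a\<in>A. t a \<in> B}"
  shows "emeasure (atom_measure A t) B = of_nat (card {a\<in>A. t a \<in> B})"
proof -
  have "emeasure (atom_measure A t) B = emeasure (count_space A) {a\<in>A. t a \<in> B}"
    using emeasure_distr[OF measurable_atoms assms(2), of A t] assms(1)
    by (simp add: vimage_def Int_def conj_commute)
  then show ?thesis using assms(3) by (simp add: emeasure_count_space)
qed

lemma atom_measure_point_measures:
  assumes "\<And>a. a \<in> A \<Longrightarrow> 0 \<le> t a" "\<And>r. finite {a\<in>A. t a \<le> r}"
  shows "atom_measure A t \<in> point_measures"
  unfolding point_measures_def
proof (intro CollectI conjI ballI impI)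
  fix B :: "real set" assume B: "B \<in> sets half_line" "bounded B"
  obtain r where "\<And>x. x \<in> B \<Longrightarrow> x \<le> r"
    using bounded_imp_bdd_above[OF B(2)] unfolding bdd_above_def by blast
  then have "{a\<in>A. t a \<in> B} \<subseteq> {a\<in>A. t a \<le> r}" by auto
  then have "finite {a\<in>A. t a \<in> B}" using assms(2) by (rule finite_subset)
  then show "\<exists>k::nat. emeasure (atom_measure A t) B = of_nat k"
    using emeasure_atom_measure[of A t B, OF assms(1) B(1)] by (intro exI) auto
qed simp

text \<open>Histories outside the support can produce negative atoms, for which the map into the
  half-line is not measurable. \<open>distr\<close> still counts preimages, and subsets of the
  half-line do not see negative points; hence every history yields a point measure.\<close>

lemma atom_measure_drop_negative: "atom_measure A t = atom_measure {a\<in>A. 0 \<le> t a} t"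
proof -
  have "measure_of (space half_line) (sets half_line)
      (\<lambda>B. emeasure (count_space A) (t -` B \<inter> space (count_space A))) =
    measure_of (space half_line) (sets half_line)
      (\<lambda>B. emeasure (count_space {a\<in>A. 0 \<le> t a}) (t -` B \<inter> space (count_space {a\<in>A. 0 \<le> t a})))"
  proof (rule measure_of_eq)
    show "sets half_line \<subseteq> Pow (space half_line)" by (rule sets.space_closed)
    fix B assume "B \<in> sigma_sets (space half_line) (sets half_line)"
    then have "B \<in> sets half_line" by (simp only: sets.sigma_sets_eq)
    then have "B \<subseteq> {0..}" using sets.sets_into_space[of B half_line] by (simp add: space_half_line)
    then have eq: "t -` B \<inter> {a\<in>A. 0 \<le> t a} = t -` B \<inter> A"
      and "t -` B \<inter> A \<subseteq> {a\<in>A. 0 \<le> t a}" by auto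
    then show "emeasure (count_space A) (t -` B \<inter> space (count_space A)) =
        emeasure (count_space {a\<in>A. 0 \<le> t a}) (t -` B \<inter> space (count_space {a\<in>A. 0 \<le> t a}))"
      unfolding space_count_space eq by (simp only: emeasure_count_space Int_lower2)
  qed
  then show ?thesis by (simp add: distr_def)
qed

lemma test_function_support:
  assumes "f \<in> test_functions"
  obtains r where "0 < r" "\<And>x. r \<le> x \<Longrightarrow> f x = 0"
proof -
  obtain K where K: "compact K" "\<forall>x\<in>{0..} - K. f x = 0"
    using assms by (auto simp: test_functions_def)
  obtain r where r: "0 < r" "\<And>x. x \<in> K \<Longrightarrow> norm x \<le> r"
    using compact_imp_bounded[OF K(1)] unfolding bounded_pos by auto
  have "f x = 0" if "r + 1 \<le> x" for x
  proof -
    have "x \<in> {0..}" "x \<notin> K" using that r(1) r(2)[of x] by auto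
    then show ?thesis using K(2) by blast
  qed
  with r(1) show ?thesis by (intro that[of "r + 1"]) auto
qed

lemma test_function_measurable:
  assumes "f \<in> test_functions"
  shows "f \<in> borel_measurable half_line"
  using assms by (auto simp: test_functions_def intro: borel_measurable_continuous_on_restrict)

lemma integral_atom_measure:
  assumes "finite A" "\<And>a. a \<in> A \<Longrightarrow> 0 \<le> t a" "f \<in> test_functions"
  shows "(\<integral>x. f x \<partial>atom_measure A t) = (\<Sum>a\<in>A. f (t a))"
  using integral_distr[OF measurable_atoms test_function_measurable[OF assms(3)], of A t] assms
  by (simp add: lebesgue_integral_count_space_finite)

section \<open>Sequential convergence in the vague topology\<close>

lemma limitin_vague_topology:
  assumes "\<And>n. \<mu> n \<in> point_measures" "\<nu> \<in> point_measures"
    and "\<And>f. f \<in> test_functions \<Longrightarrow> (\<lambda>n. \<integral>x. f x \<partial>\<mu> n) \<longlonglongrightarrow> (\<integral>x. f x \<partial>\<nu>)"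
  shows "limitin vague_topology \<mu> \<nu> sequentially"
  unfolding limitin_def
proof (intro conjI allI impI)
  show "\<nu> \<in> topspace vague_topology" by (simp add: topspace_vague_topology assms)
  fix U assume U: "openin vague_topology U \<and> \<nu> \<in> U"
  then have "generate_topology_on
     {{\<mu> \<in> point_measures. (\<integral>x. f x \<partial>\<mu>) \<in> U} | f U. f \<in> test_functions \<and> open U} U"
    unfolding vague_topology_def openin_topology_generated_by_iff by blast
  then have "\<nu> \<in> U \<longrightarrow> eventually (\<lambda>n. \<mu> n \<in> U) sequentially"
  proof induction
    case Empty
    then show ?case by simp
  next
    case (Int a b)
    then show ?case by (auto intro: eventually_conj)
  next
    case (UN K)
    show ?case
    proof
      assume "\<nu> \<in> \<Union>K"
      then obtain X where X: "X \<in> K" "\<nu> \<in> X" by blast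
      then have "\<forall>\<^sub>F n in sequentially. \<mu> n \<in> X" using UN by blast
      then show "\<forall>\<^sub>F n in sequentially. \<mu> n \<in> \<Union>K" by eventually_elim (use X in blast)
    qed
  next
    case (Basis s)
    then obtain f V where s: "s = {\<mu> \<in> point_measures. (\<integral>x. f x \<partial>\<mu>) \<in> V}"
      and f: "f \<in> test_functions" and V: "open V" by blast
    show ?case
    proof
      assume "\<nu> \<in> s"
      then have "(\<integral>x. f x \<partial>\<nu>) \<in> V" by (simp add: s)
      then have "\<forall>\<^sub>F n in sequentially. (\<integral>x. f x \<partial>\<mu> n) \<in> V"
        using topological_tendstoD[OF assms(3)[OF f] V] by blast
      then show "\<forall>\<^sub>F n in sequentially. \<mu> n \<in> s" by eventually_elim (simp add: s assms(1))
    qed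
  qed
  then show "eventually (\<lambda>n. \<mu> n \<in> U) sequentially" using U by blast
qed

lemma continuous_map_vague_tendsto:
  assumes F: "continuous_map vague_topology euclideanreal F"
    and "\<And>n. \<mu> n \<in> point_measures" "\<nu> \<in> point_measures"
    and "\<And>f. f \<in> test_functions \<Longrightarrow> (\<lambda>n. \<integral>x. f x \<partial>\<mu> n) \<longlonglongrightarrow> (\<integral>x. f x \<partial>\<nu>)"
  shows "(\<lambda>n. F (\<mu> n)) \<longlonglongrightarrow> F \<nu>"
  using continuous_map_limit[OF F limitin_vague_topology[of \<mu> \<nu>, OF assms(2-4)]]
  by (simp add: o_def)

lemma point_measures_measure:
  assumes "\<mu> \<in> point_measures" "B \<in> sets half_line" "bounded B"
  shows "emeasure \<mu> B = ennreal (measure \<mu> B)" "measure \<mu> B = real (nat \<lfloor>measure \<mu> B\<rfloor>)"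
proof -
  obtain k :: nat where k: "emeasure \<mu> B = of_nat k"
    using assms by (auto simp: point_measures_def)
  then have e: "emeasure \<mu> B = ennreal (real k)" by (simp add: ennreal_of_nat_eq_real_of_nat)
  then have m: "measure \<mu> B = real k" by (simp add: measure_def)
  then show "emeasure \<mu> B = ennreal (measure \<mu> B)" using e by simp
  from m show "measure \<mu> B = real (nat \<lfloor>measure \<mu> B\<rfloor>)" by simp
qed

section \<open>Moving atoms to a grid\<close>

definition grid_measure :: "real \<Rightarrow> nat \<Rightarrow> (nat \<Rightarrow> nat) \<Rightarrow> real measure" where
  "grid_measure a d c = atom_measure (SIGMA i:{..<d}. {..<c i}) (\<lambda>(i, j). real i * a)"

lemma grid_measure_point_measures: "0 < a \<Longrightarrow> grid_measure a d c \<in> point_measures"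
  unfolding grid_measure_def by (intro atom_measure_point_measures) auto

lemma integral_grid_measure:
  assumes "0 < a" "f \<in> test_functions"
  shows "(\<integral>x. f x \<partial>grid_measure a d c) = (\<Sum>i<d. real (c i) * f (real i * a))"
proof -
  have "(\<integral>x. f x \<partial>grid_measure a d c) =
      (\<Sum>p\<in>(SIGMA i:{..<d}. {..<c i}). f ((\<lambda>(i, j). real i * a) p))"
    unfolding grid_measure_def using assms by (intro integral_atom_measure) auto
  also have "\<dots> = (\<Sum>i<d. \<Sum>j<c i. f (real i * a))"
    by (subst sum.Sigma) (auto simp: case_prod_unfold)
  finally show ?thesis by simp
qed

lemma grid_measure_cong: "(\<And>i. i < d \<Longrightarrow> c i = c' i) \<Longrightarrow> grid_measure a d c = grid_measure a d c'"
proof -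
  assume "\<And>i. i < d \<Longrightarrow> c i = c' i"
  then have "(SIGMA i:{..<d}. {..<c i}) = (SIGMA i:{..<d}. {..<c' i})" by (intro Sigma_cong) auto
  then show ?thesis by (simp only: grid_measure_def)
qed

definition mesh :: "nat \<Rightarrow> real" where
  "mesh K = 1 / (real K + 1)"

text \<open>The \<open>(K + 1)\<^sup>2\<close> cells of width \<open>1 / (K + 1)\<close> cover
  \<open>[0, K + 1)\<close>, so a single parameter refines the grid and extends its range. Counts of
  point measures in cells are integers, so the floor loses nothing.\<close>

definition mesh_measure :: "nat \<Rightarrow> real measure \<Rightarrow> real measure" where
  "mesh_measure K \<mu> =
     grid_measure (mesh K) ((K + 1)\<^sup>2) (\<lambda>i. nat \<lfloor>measure \<mu> (cell (mesh K) i)\<rfloor>)"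

lemma mesh_pos: "0 < mesh K"
  by (simp add: mesh_def)

lemma mesh_tendsto: "mesh \<longlonglongrightarrow> 0"
  unfolding mesh_def[abs_def] by (rule real_tendsto_divide_at_top[OF tendsto_const filterlim_real_Suc])

lemma cell_iff: "0 < a \<Longrightarrow> x \<in> cell a i \<longleftrightarrow> 0 \<le> x \<and> i = nat \<lfloor>x / a\<rfloor>"
  using nat_floor_iff[of "1 / a" x i] by (simp add: cell_def)

lemma mesh_step_function:
  fixes K :: nat and f :: "real \<Rightarrow> real"
  assumes "0 \<le> x"
  defines "i \<equiv> nat \<lfloor>x / mesh K\<rfloor>"
  shows "(\<Sum>i<(K + 1)\<^sup>2. f (real i * mesh K) * indicator (cell (mesh K) i) x) =
      (if x < real K + 1 then f (real i * mesh K) else 0)"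
    and "real i * mesh K \<le> x" "x < real i * mesh K + mesh K"
proof -
  have iff: "x \<in> cell (mesh K) j \<longleftrightarrow> j = i" for j
    unfolding i_def using assms(1) by (simp add: cell_iff[OF mesh_pos])
  then have "x \<in> cell (mesh K) i" by simp
  then show "real i * mesh K \<le> x" "x < real i * mesh K + mesh K"
    by (auto simp: cell_def algebra_simps)
  have lt: "i < (K + 1)\<^sup>2 \<longleftrightarrow> x < real K + 1"
  proof -
    have "i < (K + 1)\<^sup>2 \<longleftrightarrow> \<lfloor>x / mesh K\<rfloor> < int ((K + 1)\<^sup>2)"
      using assms mesh_pos[of K] unfolding i_def by (simp add: nat_less_iff)
    also have "\<dots> \<longleftrightarrow> x / mesh K < real ((K + 1)\<^sup>2)" by (simp add: floor_less_iff)
    also have "\<dots> \<longleftrightarrow> x * (real K + 1) < (real K + 1) * (real K + 1)"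
    proof -
      have "x / mesh K = x * (real K + 1)" by (simp add: mesh_def)
      moreover have "real ((K + 1)\<^sup>2) = (real K + 1) * (real K + 1)"
        by (simp add: power2_eq_square algebra_simps)
      ultimately show ?thesis by (simp only:)
    qed
    also have "\<dots> \<longleftrightarrow> x < real K + 1" by (intro mult_less_cancel_right_pos) simp
    finally show ?thesis .
  qed
  have "(\<Sum>i<(K + 1)\<^sup>2. f (real i * mesh K) * indicator (cell (mesh K) i) x) =
      (\<Sum>j<(K + 1)\<^sup>2. if j = i then f (real j * mesh K) else 0)"
  proof (rule sum.cong[OF refl])
    show "f (real j * mesh K) * indicator (cell (mesh K) j) x = (if j = i then f (real j * mesh K) else 0)" for j
      by (cases "j = i") (simp_all add: iff)
  qed
  also have "\<dots> = (if x < real K + 1 then f (real i * mesh K) else 0)"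
    using lt by (simp add: sum.delta)
  finally show "(\<Sum>i<(K + 1)\<^sup>2. f (real i * mesh K) * indicator (cell (mesh K) i) x) =
      (if x < real K + 1 then f (real i * mesh K) else 0)" .
qed

text \<open>The error depends on the measure only through the mass of one interval fixed by
  \<open>f\<close>; the small factor comes from the uniform continuity of \<open>f\<close>.\<close>

lemma mesh_measure_approx:
  assumes f: "f \<in> test_functions"
  obtains r where "\<And>\<epsilon>. 0 < \<epsilon> \<Longrightarrow> \<exists>K0. \<forall>K\<ge>K0. \<forall>\<mu>\<in>point_measures.
    \<bar>(\<integral>x. f x \<partial>mesh_measure K \<mu>) - (\<integral>x. f x \<partial>\<mu>)\<bar> \<le> \<epsilon> * measure \<mu> {0..real r}"
proof -
  obtain r0 where r0: "0 < r0" "\<And>x. r0 \<le> x \<Longrightarrow> f x = 0"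
    using test_function_support[OF f] by blast
  \<comment> \<open>An atom moves left by less than the mesh, which is at most 1, so atoms beyond
    \<open>r\<close> do not reach the support of \<open>f\<close>.\<close>
  obtain r :: nat where r: "r0 + 1 \<le> real r" using real_arch_simple by blast
  have cont: "continuous_on {0..real r} f"
    using f by (auto simp: test_functions_def intro: continuous_on_subset)
  obtain B where B: "\<forall>x\<in>{0..real r}. \<bar>f x\<bar> \<le> B"
    using compact_imp_bounded[OF compact_continuous_image[OF cont compact_Icc]]
    unfolding bounded_iff real_norm_def by blast
  show thesis
  proof (rule that[of r])
    fix \<epsilon> :: real assume \<epsilon>: "0 < \<epsilon>"
    obtain \<delta> where \<delta>: "0 < \<delta>" "\<And>x x'. x \<in> {0..real r} \<Longrightarrow> x' \<in> {0..real r} \<Longrightarrow> dist x' x < \<delta> \<Longrightarrow>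
        dist (f x') (f x) < \<epsilon>"
      using compact_uniformly_continuous[OF cont compact_Icc] \<epsilon>
      unfolding uniformly_continuous_on_def by metis
    obtain K1 where K1: "\<And>K. K1 \<le> K \<Longrightarrow> mesh K < \<delta>"
      using order_tendstoD(2)[OF mesh_tendsto \<delta>(1)] unfolding eventually_sequentially by blast
    show "\<exists>K0. \<forall>K\<ge>K0. \<forall>\<mu>\<in>point_measures.
      \<bar>(\<integral>x. f x \<partial>mesh_measure K \<mu>) - (\<integral>x. f x \<partial>\<mu>)\<bar> \<le> \<epsilon> * measure \<mu> {0..real r}"
    \<comment> \<open>\<open>K \<ge> r\<close> places \<open>[0, r]\<close> inside the range of the
      grid.\<close>
    proof (intro exI[of _ "max K1 r"] allI impI ballI)
    fix K :: nat and \<mu> assume K: "max K1 r \<le> K" and \<mu>: "\<mu> \<in> point_measures"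
    have S: "sets \<mu> = sets half_line" using \<mu> by (simp add: point_measures_def)
    have sp: "space \<mu> = {0..}" using sets_eq_imp_space_eq[OF S] by (simp add: space_half_line)
    have fm: "f \<in> borel_measurable \<mu>"
      using test_function_measurable[OF f] measurable_cong_sets[OF S refl] by blast
    have I: "{0..real r} \<in> sets \<mu>" unfolding S by (rule atLeastAtMost_half_line)
    have Ifin: "emeasure \<mu> {0..real r} < \<infinity>"
      using point_measures_measure(1)[OF \<mu> atLeastAtMost_half_line, of "real r"] by simp
    have int_f: "integrable \<mu> f"
    proof (rule integrableI_bounded_set[OF I fm Ifin])
      show "AE x in \<mu>. x \<in> {0..real r} \<longrightarrow> norm (f x) \<le> B" using B by auto
      show "AE x in \<mu>. x \<notin> {0..real r} \<longrightarrow> f x = 0"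
        by (rule AE_I2) (use sp r r0(2) in auto)
    qed
    let ?a = "mesh K" and ?d = "(K + 1)\<^sup>2"
    let ?s = "\<lambda>x. \<Sum>i<?d. f (real i * ?a) * indicator (cell ?a i) x"
    have C: "cell ?a i \<in> sets \<mu>" for i unfolding S by (rule cell_half_line[OF mesh_pos])
    have Cfin: "emeasure \<mu> (cell ?a i) < \<infinity>" for i
      using point_measures_measure(1)[OF \<mu> cell_half_line[OF mesh_pos] bounded_cell, of K i] by simp
    have int_s': "integrable \<mu> (\<lambda>x. f (real i * ?a) * indicator (cell ?a i) x)" for i
      using C Cfin by (intro integrable_mult_right integrable_real_indicator)
    have int_s: "integrable \<mu> ?s" by (intro Bochner_Integration.integrable_sum int_s')
    have "(\<integral>x. f x \<partial>mesh_measure K \<mu>) = (\<Sum>i<?d. measure \<mu> (cell ?a i) * f (real i * ?a))"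
      unfolding mesh_measure_def integral_grid_measure[OF mesh_pos f]
      using point_measures_measure(2)[OF \<mu> cell_half_line[OF mesh_pos] bounded_cell] by simp
    also have "\<dots> = (\<Sum>i<?d. \<integral>x. f (real i * ?a) * indicator (cell ?a i) x \<partial>\<mu>)"
      using C by (simp add: sets.Int_space_eq2 mult.commute)
    also have "\<dots> = (\<integral>x. ?s x \<partial>\<mu>)"
      by (rule Bochner_Integration.integral_sum[symmetric]) (rule int_s')
    finally have "(\<integral>x. f x \<partial>mesh_measure K \<mu>) - (\<integral>x. f x \<partial>\<mu>) = (\<integral>x. ?s x - f x \<partial>\<mu>)"
      using int_s int_f by simp
    also have "\<bar>\<dots>\<bar> \<le> (\<integral>x. \<bar>?s x - f x\<bar> \<partial>\<mu>)" by (rule integral_abs_bound)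
    also have "\<dots> \<le> (\<integral>x. \<epsilon> * indicator {0..real r} x \<partial>\<mu>)"
    proof (rule integral_mono)
      show "integrable \<mu> (\<lambda>x. \<bar>?s x - f x\<bar>)" using int_s int_f by simp
      show "integrable \<mu> (\<lambda>x. \<epsilon> * indicator {0..real r} x)"
        using I Ifin by (intro integrable_mult_right integrable_real_indicator)
      fix x assume "x \<in> space \<mu>"
      then have x: "0 \<le> x" by (simp add: sp)
      note step = mesh_step_function(1)[OF x, where K=K and f=f] mesh_step_function(2,3)[OF x, where K=K]
      define z where "z = real (nat \<lfloor>x / ?a\<rfloor>) * ?a"
      have z: "0 \<le> z" "z \<le> x" "x < z + ?a" "?a \<le> 1"
        using step(2,3) mesh_pos[of K] by (auto simp: z_def mesh_def)
      have Kr: "real r \<le> real K" using K by simp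
      have s: "?s x = (if x < real K + 1 then f z else 0)" unfolding z_def by (rule step(1))
      show "\<bar>?s x - f x\<bar> \<le> \<epsilon> * indicator {0..real r} x"
      proof (cases "x \<le> real r")
        case True
        have "dist z x < \<delta>" using z K1[of K] K by (simp add: dist_real_def)
        then have "\<bar>f z - f x\<bar> < \<epsilon>" using \<delta>(2)[of x z] x z True by (simp add: dist_real_def)
        then show ?thesis unfolding s using True x Kr by simp
      next
        case False
        then have "f x = 0" "f z = 0" using z r by (auto intro: r0(2))
        then show ?thesis unfolding s using False by simp
      qed
    qed
    also have "\<dots> = \<epsilon> * measure \<mu> {0..real r}" using I by (simp add: sets.Int_space_eq2)
    finally show "\<bar>(\<integral>x. f x \<partial>mesh_measure K \<mu>) - (\<integral>x. f x \<partial>\<mu>)\<bar> \<le> \<epsilon> * measure \<mu> {0..real r}" .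
    qed
  qed
qed

lemma mesh_measure_point_measures: "mesh_measure K \<mu> \<in> point_measures"
  unfolding mesh_measure_def by (rule grid_measure_point_measures[OF mesh_pos])

text \<open>Serves a tight sequence of measures as well as a single fixed measure: the mass bound
  \<open>c r\<close> makes the error of \<open>mesh_measure_approx\<close> absolute.\<close>

lemma mesh_measure_integral_tendsto:
  fixes K :: "nat \<Rightarrow> nat"
  assumes f: "f \<in> test_functions" and \<mu>: "\<And>n. \<mu> n \<in> point_measures"
    and bd: "\<And>r n. measure (\<mu> n) {0..real r} \<le> c r"
    and K: "filterlim K at_top sequentially"
    and lim: "(\<lambda>n. \<integral>x. f x \<partial>\<mu> n) \<longlonglongrightarrow> I"
  shows "(\<lambda>n. \<integral>x. f x \<partial>mesh_measure (K n) (\<mu> n)) \<longlonglongrightarrow> I"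
proof -
  obtain r where r: "\<And>\<epsilon>. 0 < \<epsilon> \<Longrightarrow> \<exists>K0. \<forall>K\<ge>K0. \<forall>\<mu>\<in>point_measures.
    \<bar>(\<integral>x. f x \<partial>mesh_measure K \<mu>) - (\<integral>x. f x \<partial>\<mu>)\<bar> \<le> \<epsilon> * measure \<mu> {0..real r}"
    using mesh_measure_approx[OF f] by blast
  have c: "0 \<le> c r" using bd[of 0 r] order_trans[OF measure_nonneg] by blast
  have "(\<lambda>n. (\<integral>x. f x \<partial>mesh_measure (K n) (\<mu> n)) - (\<integral>x. f x \<partial>\<mu> n)) \<longlonglongrightarrow> 0"
  proof (rule tendstoI)
    fix e :: real assume e: "0 < e"
    define \<epsilon> where "\<epsilon> = e / (c r + 1)"
    have \<epsilon>: "0 < \<epsilon>" "\<epsilon> * c r < e" using e c by (auto simp: \<epsilon>_def field_simps)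
    obtain K0 where K0: "\<And>k \<mu>. K0 \<le> k \<Longrightarrow> \<mu> \<in> point_measures \<Longrightarrow>
        \<bar>(\<integral>x. f x \<partial>mesh_measure k \<mu>) - (\<integral>x. f x \<partial>\<mu>)\<bar> \<le> \<epsilon> * measure \<mu> {0..real r}"
      using r[OF \<epsilon>(1)] by blast
    have "\<forall>\<^sub>F n in sequentially. K0 \<le> K n" using K by (simp add: filterlim_at_top)
    then show "\<forall>\<^sub>F n in sequentially.
        dist ((\<integral>x. f x \<partial>mesh_measure (K n) (\<mu> n)) - (\<integral>x. f x \<partial>\<mu> n)) 0 < e"
    proof eventually_elim
      case (elim n)
      then show ?case
        using K0[OF elim \<mu>[of n]] mult_left_mono[OF bd[of n r], of \<epsilon>] \<epsilon>
        unfolding dist_real_def by linarith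
    qed
  qed
  from tendsto_add[OF this lim] show ?thesis by simp
qed

text \<open>The map \<open>t \<mapsto> 1 / (1 + t)\<close> compactifies the half-line; the value 0 stands for an atom at infinity.\<close>

lemma sorted_points_subsequence:
  fixes xs :: "nat \<Rightarrow> real list" and c :: "nat \<Rightarrow> nat"
  assumes sorted: "\<And>l. sorted (xs l)" and nonneg: "\<And>l x. x \<in> set (xs l) \<Longrightarrow> 0 \<le> x"
    and count: "\<And>l r. length (filter (\<lambda>x. x \<le> real r) (xs l)) \<le> c r"
  obtains \<rho> \<nu> where "strict_mono (\<rho> :: nat \<Rightarrow> nat)" "\<nu> \<in> point_measures"
    "\<And>f. f \<in> test_functions \<Longrightarrow> (\<lambda>l. \<Sum>x\<leftarrow>xs (\<rho> l). f x) \<longlonglongrightarrow> (\<integral>x. f x \<partial>\<nu>)"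
proof -
  \<comment> \<open>Padding by 0, the image of infinity, turns lists of different lengths into
    points of one cube.\<close>
  define s where "s l k = (if k < length (xs l) then 1 / (1 + xs l ! k) else 0)" for l k
  have nn: "0 \<le> xs l ! k" if "k < length (xs l)" for l k using nonneg nth_mem[OF that] by blast
  \<comment> \<open>In a sorted list the points up to \<open>r\<close> fill at most the first
    \<open>c r\<close> places, so the same finitely many coordinates decide about
    \<open>[0, r]\<close> for all \<open>l\<close>.\<close>
  have far: "real r < xs l ! k" if "c r \<le> k" "k < length (xs l)" for r l k
  proof (rule ccontr)
    assume "\<not> real r < xs l ! k"
    then have "xs l ! i \<le> real r" if "i \<le> k" for i
      using sorted_nth_mono[OF sorted that \<open>k < length (xs l)\<close>] by linarith
    then have "{..k} \<subseteq> {i. i < length (xs l) \<and> xs l ! i \<le> real r}" using that by auto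
    then have "card {..k} \<le> card {i. i < length (xs l) \<and> xs l ! i \<le> real r}"
      by (intro card_mono) auto
    then show False using count[of r l] that(1) by (simp add: length_filter_conv_card)
  qed
  have s01: "0 \<le> s l k" "s l k \<le> 1" for l k using nn[of k l] by (auto simp: s_def field_simps)
  have s_small: "s l k \<le> 1 / (1 + real r)" if "c r \<le> k" for l k r
    using far[OF that, of l] by (auto simp: s_def intro!: divide_left_mono mult_pos_pos)
  \<comment> \<open>A countable product of intervals is compact by Tychonoff and, being first
    countable, sequentially compact.\<close>
  have "compact (PiE UNIV (\<lambda>_::nat. {0..1::real}))"
    using compactin_PiE[of "\<lambda>_. euclidean :: real topology" UNIV "\<lambda>_. {0..1}"]
    by (simp add: euclidean_product_topology)
  then have "seq_compact (PiE UNIV (\<lambda>_::nat. {0..1::real}))" by (rule compact_imp_seq_compact)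
  moreover have "\<forall>l. s l \<in> PiE UNIV (\<lambda>_. {0..1})" using s01 by auto
  ultimately obtain \<sigma> \<rho> where \<sigma>: "\<sigma> \<in> PiE UNIV (\<lambda>_::nat. {0..1::real})"
      and \<rho>: "strict_mono (\<rho> :: nat \<Rightarrow> nat)" and lim: "(s \<circ> \<rho>) \<longlonglongrightarrow> \<sigma>"
    by (rule seq_compactE)
  have limk: "(\<lambda>l. s (\<rho> l) k) \<longlonglongrightarrow> \<sigma> k" for k
    using continuous_on_tendsto_compose[OF continuous_on_product_coordinates[of k] lim]
    by (simp add: o_def)
  have \<sigma>01: "0 \<le> \<sigma> k" "\<sigma> k \<le> 1" for k using \<sigma> by (auto simp: PiE_iff)
  have \<sigma>_small: "\<sigma> k \<le> 1 / (1 + real r)" if "c r \<le> k" for k r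
    using limk by (rule tendsto_upperbound) (auto simp: s_small[OF that])
  define A where "A = {k. 0 < \<sigma> k}"
  define t where "t k = 1 / \<sigma> k - 1" for k
  have t0: "0 \<le> t k" if "k \<in> A" for k using that \<sigma>01[of k] by (simp add: A_def t_def)
  have t_far: "real r \<le> t k" if "c r \<le> k" "k \<in> A" for k r
    using \<sigma>_small[OF that(1)] that(2) by (simp add: A_def t_def field_simps)
  have fin: "finite {k\<in>A. t k \<le> u}" for u
  proof -
    obtain r :: nat where r: "u < real r" using reals_Archimedean2 by blast
    have "{k\<in>A. t k \<le> u} \<subseteq> {..<c r}"
    proof
      fix k assume "k \<in> {k\<in>A. t k \<le> u}"
      then show "k \<in> {..<c r}" using t_far[of r k] r by (cases "k < c r") auto
    qed
    then show ?thesis by (rule finite_subset) simp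
  qed
  show thesis
  proof (rule that[of \<rho> "atom_measure A t"])
    show "strict_mono \<rho>" by fact
    show "atom_measure A t \<in> point_measures" using t0 fin by (rule atom_measure_point_measures)
    fix f assume f: "f \<in> test_functions"
    obtain r0 where r0: "0 < r0" "\<And>x. r0 \<le> x \<Longrightarrow> f x = 0" using test_function_support[OF f] by blast
    obtain r :: nat where r: "r0 \<le> real r" using real_arch_simple by blast
    \<comment> \<open>The test function in the compactified coordinate. Its compact support lets it
      extend continuously by 0 to the point at infinity.\<close>
    define \<phi> where "\<phi> u = (if 0 < u then f (1 / u - 1) else 0)" for u :: real
    have \<phi>0: "\<phi> u = 0" if "u \<le> 1 / (1 + real r)" for u
    proof (cases "0 < u")
      case True
      then have "1 + real r \<le> 1 / u" using that by (simp add: field_simps)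
      then show ?thesis using r r0(2)[of "1 / u - 1"] by (simp add: \<phi>_def)
    qed (simp add: \<phi>_def)
    have \<phi>_cont: "continuous_on {0..1} \<phi>"
    proof -
      let ?v = "1 / (1 + real r)"
      have v: "0 < ?v" "?v \<le> 1" by auto
      have "continuous_on ({0..?v} \<union> {?v..1}) \<phi>"
      proof (rule continuous_on_closed_Un)
        show "continuous_on {0..?v} \<phi>"
          by (rule continuous_on_cong[THEN iffD2, OF refl _ continuous_on_const[of _ 0]]) (use \<phi>0 in auto)
        have "continuous_on {?v..1} (\<lambda>u. f (1 / u - 1))"
        proof (rule continuous_on_compose2[of "{0..}" f])
          show "continuous_on {0..} f" using f by (simp add: test_functions_def)
          show "continuous_on {?v..1} (\<lambda>u. 1 / u - 1)" using v by (intro continuous_intros) auto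
          show "(\<lambda>u. 1 / u - 1) ` {?v..1} \<subseteq> {0..}"
          proof
            fix z assume "z \<in> (\<lambda>u. 1 / u - 1) ` {?v..1}"
            then obtain u where u: "z = 1 / u - 1" "?v \<le> u" "u \<le> 1" by auto
            then have "0 < u" using v(1) by linarith
            then show "z \<in> {0..}" using u by simp
          qed
        qed
        moreover have "\<phi> u = f (1 / u - 1)" if "u \<in> {?v..1}" for u
        proof -
          have "0 < u" using less_le_trans[OF v(1), of u] that unfolding atLeastAtMost_iff by blast
          then show ?thesis by (simp add: \<phi>_def)
        qed
        ultimately show "continuous_on {?v..1} \<phi>" by (simp cong: continuous_on_cong_simp)
      qed auto
      moreover have "{0..?v} \<union> {?v..1} = {0..1}"
        using v by (intro ivl_disj_un_two_touch) auto
      ultimately show ?thesis by simp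
    qed
    \<comment> \<open>Places from \<open>c r\<close> on lie beyond the support, so the integral is a
      finite sum of a fixed length, continuous in the coordinates.\<close>
    have sum_eq: "(\<Sum>x\<leftarrow>xs l. f x) = (\<Sum>k<c r. \<phi> (s l k))" for l
    proof -
      have "(\<Sum>x\<leftarrow>xs l. f x) = (\<Sum>k<length (xs l). f (xs l ! k))"
        by (simp add: sum_list_sum_nth atLeast0LessThan)
      also have "\<dots> = (\<Sum>k<length (xs l). \<phi> (s l k))"
      proof (rule sum.cong[OF refl])
        fix k assume "k \<in> {..<length (xs l)}"
        then show "f (xs l ! k) = \<phi> (s l k)" using nn[of k l] by (simp add: \<phi>_def s_def)
      qed
      also have "\<dots> = (\<Sum>k<max (c r) (length (xs l)). \<phi> (s l k))"
        by (rule sum.mono_neutral_left) (auto simp: s_def \<phi>_def)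
      also have "\<dots> = (\<Sum>k<c r. \<phi> (s l k))"
        by (rule sum.mono_neutral_right) (auto simp: s_small intro!: \<phi>0)
      finally show ?thesis .
    qed
    have "(\<integral>x. f x \<partial>atom_measure A t) = (\<integral>k. f (t k) \<partial>count_space A)"
      using t0 by (intro integral_distr measurable_atoms test_function_measurable f) auto
    also have "\<dots> = (\<Sum>k | k \<in> A \<and> f (t k) \<noteq> 0. f (t k))"
    proof (rule lebesgue_integral_count_space_finite_support)
      have "{k\<in>A. f (t k) \<noteq> 0} \<subseteq> {k\<in>A. t k \<le> r0}" 
      proof
        fix k assume "k \<in> {k\<in>A. f (t k) \<noteq> 0}"
        then show "k \<in> {k\<in>A. t k \<le> r0}" using r0(2)[of "t k"] by (cases "r0 \<le> t k") auto
      qed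
      then show "finite {k\<in>A. f (t k) \<noteq> 0}" using fin by (rule finite_subset)
    qed
    also have "\<dots> = (\<Sum>k<c r. \<phi> (\<sigma> k))"
    proof -
      have "(\<Sum>k | k \<in> A \<and> f (t k) \<noteq> 0. f (t k)) = (\<Sum>k | k \<in> A \<and> f (t k) \<noteq> 0. \<phi> (\<sigma> k))"
        by (intro sum.cong) (auto simp: A_def t_def \<phi>_def)
      also have "\<dots> = (\<Sum>k<c r. \<phi> (\<sigma> k))"
      proof (rule sum.mono_neutral_left)
        show "{k. k \<in> A \<and> f (t k) \<noteq> 0} \<subseteq> {..<c r}"
        proof
          fix k assume k: "k \<in> {k. k \<in> A \<and> f (t k) \<noteq> 0}"
          show "k \<in> {..<c r}"
          proof (rule ccontr)
            assume "k \<notin> {..<c r}"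
            then have "real r \<le> t k" using k t_far[of r k] by auto
            then show False using k r r0(2)[of "t k"] by auto
          qed
        qed
        show "\<forall>k\<in>{..<c r} - {k. k \<in> A \<and> f (t k) \<noteq> 0}. \<phi> (\<sigma> k) = 0"
          by (auto simp: A_def t_def \<phi>_def)
      qed simp
      finally show ?thesis .
    qed
    finally have int_eq: "(\<integral>x. f x \<partial>atom_measure A t) = (\<Sum>k<c r. \<phi> (\<sigma> k))" .
    show "(\<lambda>l. \<Sum>x\<leftarrow>xs (\<rho> l). f x) \<longlonglongrightarrow> (\<integral>x. f x \<partial>atom_measure A t)"
      unfolding sum_eq int_eq
      by (intro tendsto_sum continuous_on_tendsto_compose[OF \<phi>_cont limk])
        (use \<sigma>01 s01 in \<open>auto intro!: always_eventually\<close>)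
  qed
qed

section \<open>Convergence of the point process\<close>

lemma scaled_point_process_eq: "scaled_point_process N h = atom_measure {1..N} (scaled_atom N h)"
  by (simp add: scaled_point_process_def scaled_atom_def[abs_def])

lemma scaled_point_process_point_measures: "scaled_point_process N h \<in> point_measures"
  unfolding scaled_point_process_eq
  by (subst atom_measure_drop_negative, rule atom_measure_point_measures) auto

lemma scaled_atom_nonneg:
  assumes "h \<in> set_pmf (growing_graph N)"
  shows "0 \<le> scaled_atom N h n"
proof -
  have "edge_count h n \<le> N choose 2"
    using edge_count_le[of h n] pool_growing_graph(3)[OF assms] by simp
  moreover have "0 \<le> real N * ln (real N)" by (cases N) auto
  ultimately show ?thesis by (simp add: scaled_atom_def)
qed

lemma measure_scaled_point_process:
  assumes h: "h \<in> set_pmf (growing_graph N)" and B: "B \<in> sets half_line"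
  shows "measure (scaled_point_process N h) B = real (card {n \<in> {1..N}. scaled_atom N h n \<in> B})"
  unfolding scaled_point_process_eq measure_def
  using emeasure_atom_measure[of "{1..N}" "scaled_atom N h" B] scaled_atom_nonneg[OF h] B
  by (simp add: ennreal_of_nat_eq_real_of_nat)

lemma measure_scaled_point_process_cell:
  assumes h: "h \<in> set_pmf (growing_graph N)" and a: "0 < a"
  shows "measure (scaled_point_process N h) (cell a i) = real (cell_count a N h i)"
  unfolding cell_count_def by (rule measure_scaled_point_process[OF h cell_half_line[OF a]])

lemma mesh_measure_scaled_point_process:
  assumes "h \<in> set_pmf (growing_graph N)"
  shows "mesh_measure K (scaled_point_process N h) =
    grid_measure (mesh K) ((K + 1)\<^sup>2) (cell_count (mesh K) N h)"
  unfolding mesh_measure_def measure_scaled_point_process_cell[OF assms mesh_pos] by simp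

text \<open>\<open>[0, r]\<close> lies in the zeroth cell of the grid of width \<open>r + 1\<close>,
  so tightness on bounded sets can be read off from cell counts.\<close>

lemma atoms_le_cell_count:
  "card {n \<in> {1..N}. scaled_atom N h n \<in> {0..real r}} \<le> cell_count (real r + 1) N h 0"
  unfolding cell_count_def cell_def by (intro card_mono) auto

text \<open>Compactness turns the pointwise convergence of the discretisations into uniform
  convergence on tight sets.\<close>

lemma mesh_measure_uniform:
  assumes F: "continuous_map vague_topology euclideanreal F" and \<epsilon>: "0 < \<epsilon>"
  shows "\<exists>K0. \<forall>K\<ge>K0. \<forall>N. \<forall>h\<in>set_pmf (growing_graph N). (\<forall>r. cell_count (real r + 1) N h 0 \<le> c r) \<longrightarrow>
    \<bar>F (mesh_measure K (scaled_point_process N h)) - F (scaled_point_process N h)\<bar> < \<epsilon>"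
proof (rule ccontr)
  let ?bad = "\<lambda>K N h. h \<in> set_pmf (growing_graph N) \<and> (\<forall>r. cell_count (real r + 1) N h 0 \<le> c r) \<and>
    \<epsilon> \<le> \<bar>F (mesh_measure K (scaled_point_process N h)) - F (scaled_point_process N h)\<bar>"
  assume "\<not> ?thesis"
  then have "\<forall>l. \<exists>K N h. l \<le> K \<and> ?bad K N h" by (auto simp: not_less) blast
  then obtain K N h where K: "\<And>l::nat. l \<le> K l" and bad: "\<And>l. ?bad (K l) (N l) (h l)" by metis
  define \<mu> where "\<mu> l = scaled_point_process (N l) (h l)" for l
  \<comment> \<open>Sorting makes \<open>sorted_points_subsequence\<close> applicable and affects
    neither integrals nor counts.\<close>
  define xs where "xs l = sort (map (scaled_atom (N l) (h l)) [1..<Suc (N l)])" for l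
  have \<mu>: "\<mu> l \<in> point_measures" for l unfolding \<mu>_def by (rule scaled_point_process_point_measures)
  have h: "h l \<in> set_pmf (growing_graph (N l))" for l using bad by blast
  have card_le: "card {n \<in> {1..N l}. scaled_atom (N l) (h l) n \<in> {0..real r}} \<le> c r" for l r
    using order_trans[OF atoms_le_cell_count] bad by blast
  have len: "length (filter (\<lambda>x. x \<le> real r) (xs l)) \<le> c r" for l r
  proof -
    have "mset (filter (\<lambda>x. x \<le> real r) (xs l)) =
        mset (filter (\<lambda>x. x \<le> real r) (map (scaled_atom (N l) (h l)) [1..<Suc (N l)]))"
      by (simp only: mset_filter xs_def mset_sort)
    then have "length (filter (\<lambda>x. x \<le> real r) (xs l)) =
        length (filter (\<lambda>x. x \<le> real r) (map (scaled_atom (N l) (h l)) [1..<Suc (N l)]))"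
      by (rule mset_eq_length)
    also have "\<dots> = length (filter (\<lambda>n. scaled_atom (N l) (h l) n \<le> real r) [1..<Suc (N l)])"
      by (simp only: filter_map length_map o_def)
    also have "\<dots> = card (set (filter (\<lambda>n. scaled_atom (N l) (h l) n \<le> real r) [1..<Suc (N l)]))"
      by (intro distinct_card[symmetric] distinct_filter distinct_upt)
    also have "set (filter (\<lambda>n. scaled_atom (N l) (h l) n \<le> real r) [1..<Suc (N l)]) =
        {n \<in> {1..N l}. scaled_atom (N l) (h l) n \<in> {0..real r}}"
      using scaled_atom_nonneg[OF h] by auto
    finally show ?thesis using card_le[of l r] by simp
  qed
  have nonneg: "0 \<le> x" if "x \<in> set (xs l)" for x l
    using that scaled_atom_nonneg[OF h] by (auto simp: xs_def)
  have int: "(\<integral>x. f x \<partial>\<mu> l) = (\<Sum>x\<leftarrow>xs l. f x)" if "f \<in> test_functions" for f l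
  proof -
    have "(\<integral>x. f x \<partial>\<mu> l) = (\<Sum>n\<in>{1..N l}. f (scaled_atom (N l) (h l) n))"
      unfolding \<mu>_def scaled_point_process_eq
      using that scaled_atom_nonneg[OF h] by (intro integral_atom_measure) auto
    also have "\<dots> = sum_list (map f (map (scaled_atom (N l) (h l)) [1..<Suc (N l)]))"
      by (simp add: interv_sum_list_conv_sum_set_nat atLeastLessThanSuc_atLeastAtMost o_def del: upt_Suc)
    also have "\<dots> = (\<Sum>x\<leftarrow>xs l. f x)"
      unfolding sum_mset_sum_list[symmetric] mset_map xs_def mset_sort ..
    finally show ?thesis .
  qed
  obtain \<rho> \<nu> where \<rho>: "strict_mono (\<rho> :: nat \<Rightarrow> nat)" and \<nu>: "\<nu> \<in> point_measures"
    and lim: "\<And>f. f \<in> test_functions \<Longrightarrow> (\<lambda>l. \<Sum>x\<leftarrow>xs (\<rho> l). f x) \<longlonglongrightarrow> (\<integral>x. f x \<partial>\<nu>)"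
    by (rule sorted_points_subsequence[of xs c]) (use nonneg len in \<open>auto simp: xs_def\<close>)
  have lim': "(\<lambda>l. \<integral>x. f x \<partial>\<mu> (\<rho> l)) \<longlonglongrightarrow> (\<integral>x. f x \<partial>\<nu>)" if "f \<in> test_functions" for f
    unfolding int[OF that] by (rule lim[OF that])
  have K\<rho>: "filterlim (\<lambda>l. K (\<rho> l)) at_top sequentially"
  proof (rule filterlim_at_top_mono[OF filterlim_ident])
    show "\<forall>\<^sub>F l in sequentially. l \<le> K (\<rho> l)"
      using K seq_suble[OF \<rho>] order_trans by (intro always_eventually) blast
  qed
  have bd: "measure (\<mu> (\<rho> n)) {0..real r} \<le> real (c r)" for r n
    unfolding \<mu>_def measure_scaled_point_process[OF h atLeastAtMost_half_line]
    using card_le by simp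
  \<comment> \<open>Along the subsequence the measures and their discretisations have the same vague
    limit, so the gap in \<open>F\<close> closes, contrary to the choice of the bad
    histories.\<close>
  have "(\<lambda>l. F (\<mu> (\<rho> l))) \<longlonglongrightarrow> F \<nu>"
    using \<mu> \<nu> lim' by (intro continuous_map_vague_tendsto[OF F])
  moreover have "(\<lambda>l. F (mesh_measure (K (\<rho> l)) (\<mu> (\<rho> l)))) \<longlonglongrightarrow> F \<nu>"
    using \<nu> by (intro continuous_map_vague_tendsto[OF F] mesh_measure_point_measures
        mesh_measure_integral_tendsto[OF _ \<mu> bd K\<rho>] lim')
  ultimately have "(\<lambda>l. \<bar>F (mesh_measure (K (\<rho> l)) (\<mu> (\<rho> l))) - F (\<mu> (\<rho> l))\<bar>) \<longlonglongrightarrow> \<bar>F \<nu> - F \<nu>\<bar>"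
    by (intro tendsto_rabs tendsto_diff)
  then have "\<epsilon> \<le> \<bar>F \<nu> - F \<nu>\<bar>"
    by (rule tendsto_lowerbound) (use bad in \<open>auto simp: \<mu>_def\<close>)
  then show False using \<epsilon> by simp
qed

section \<open>Tightness of the counts\<close>

lemma prob_cell_count_gt:
  assumes "0 < a" and \<epsilon>: "0 < \<epsilon>"
  shows "\<exists>c. \<forall>N. measure_pmf.prob (growing_graph N) {h. c < cell_count a N h 0} \<le> \<epsilon>"
proof -
  have "(\<lambda>m. \<Sum>k<m. poisson_weight a k) \<longlonglongrightarrow> 1"
    using poisson_weight_sums[of a] by (simp add: sums_def)
  then have "\<forall>\<^sub>F m in sequentially. 1 - \<epsilon> < (\<Sum>k<m. poisson_weight a k)"
    using \<epsilon> by (intro order_tendstoD(1)) auto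
  then obtain m where m: "1 - \<epsilon> < (\<Sum>k<m. poisson_weight a k)"
    using eventually_happens'[OF sequentially_bot] by blast
  have "(\<lambda>N. measure_pmf.prob (growing_graph N) {h. cell_count a N h 0 = k}) \<longlonglongrightarrow> poisson_weight a k" for k
    using cell_count_tendsto_poisson[OF assms(1), of 1 "\<lambda>_. k"] by simp
  then have "(\<lambda>N. \<Sum>k<m. measure_pmf.prob (growing_graph N) {h. cell_count a N h 0 = k}) \<longlonglongrightarrow>
      (\<Sum>k<m. poisson_weight a k)" by (intro tendsto_sum)
  then have "\<forall>\<^sub>F N in sequentially. 1 - \<epsilon> < (\<Sum>k<m. measure_pmf.prob (growing_graph N) {h. cell_count a N h 0 = k})"
    using m by (rule order_tendstoD(1))
  then obtain N0 where N0: "\<And>N. N0 \<le> N \<Longrightarrow>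
      1 - \<epsilon> < (\<Sum>k<m. measure_pmf.prob (growing_graph N) {h. cell_count a N h 0 = k})"
    unfolding eventually_sequentially by blast
  \<comment> \<open>One threshold for all \<open>N\<close>: from \<open>N0\<close> on, counts of at
    least \<open>m\<close> have probability below \<open>\<epsilon>\<close>, and for smaller
    \<open>N\<close> there are fewer than \<open>N0\<close> atoms altogether.\<close>
  have "measure_pmf.prob (growing_graph N) {h. max m N0 < cell_count a N h 0} \<le> \<epsilon>" for N
  proof (cases "N0 \<le> N")
    case True
    have "(\<Sum>k<m. measure_pmf.prob (growing_graph N) {h. cell_count a N h 0 = k}) =
        measure_pmf.prob (growing_graph N) (\<Union>k\<in>{..<m}. {h. cell_count a N h 0 = k})"
      by (rule measure_pmf.finite_measure_finite_Union[symmetric]) (auto simp: disjoint_family_on_def)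
    also have "\<dots> = 1 - measure_pmf.prob (growing_graph N) (- (\<Union>k\<in>{..<m}. {h. cell_count a N h 0 = k}))"
      using measure_pmf.prob_compl[of "\<Union>k\<in>{..<m}. {h. cell_count a N h 0 = k}" "growing_graph N"]
      by (simp add: Compl_eq_Diff_UNIV)
    finally have "measure_pmf.prob (growing_graph N) (- (\<Union>k\<in>{..<m}. {h. cell_count a N h 0 = k})) < \<epsilon>"
      using N0[OF True] by simp
    moreover have "measure_pmf.prob (growing_graph N) {h. max m N0 < cell_count a N h 0} \<le>
        measure_pmf.prob (growing_graph N) (- (\<Union>k\<in>{..<m}. {h. cell_count a N h 0 = k}))"
      by (intro measure_pmf.finite_measure_mono) auto
    ultimately show ?thesis by simp
  next
    case False
    have "cell_count a N h 0 \<le> card {1..N}" for h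
      unfolding cell_count_def by (intro card_mono) auto
    then have "\<not> max m N0 < cell_count a N h 0" for h
    proof -
      have "cell_count a N h 0 \<le> N" using \<open>\<And>h. cell_count a N h 0 \<le> card {1..N}\<close>[of h] by simp
      then show ?thesis using False by linarith
    qed
    then have "{h. max m N0 < cell_count a N h 0} = {}" by blast
    then show ?thesis using \<epsilon> by (simp only: measure_empty less_imp_le)
  qed
  then show ?thesis by blast
qed

lemma cell_counts_tight:
  assumes \<epsilon>: "0 < \<epsilon>"
  obtains c where "\<And>N. measure_pmf.prob (growing_graph N)
    {h. \<not> (\<forall>r. cell_count (real r + 1) N h 0 \<le> c r)} \<le> \<epsilon>"
proof -
  \<comment> \<open>The budget is split geometrically over \<open>r\<close>, so that all intervals
    are controlled at once with total \<open>\<epsilon>\<close>.\<close>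
  have "\<exists>c. \<forall>N. measure_pmf.prob (growing_graph N) {h. c < cell_count (real r + 1) N h 0} \<le> \<epsilon> * (1/2) ^ Suc r"
    for r :: nat
    using \<epsilon> by (intro prob_cell_count_gt) auto
  then obtain c where c: "\<And>r N. measure_pmf.prob (growing_graph N) {h. c r < cell_count (real r + 1) N h 0} \<le>
      \<epsilon> * (1/2) ^ Suc r" by metis
  have s: "(\<lambda>r. \<epsilon> * (1/2) ^ Suc r) sums (\<epsilon> * 1)" by (intro sums_mult power_half_series)
  have "measure_pmf.prob (growing_graph N) {h. \<not> (\<forall>r. cell_count (real r + 1) N h 0 \<le> c r)} \<le> \<epsilon>" for N
  proof -
    have sm: "summable (\<lambda>r. measure_pmf.prob (growing_graph N) {h. c r < cell_count (real r + 1) N h 0})"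
      using c by (intro summable_comparison_test'[OF sums_summable[OF s], of 0]) auto
    have "{h. \<not> (\<forall>r. cell_count (real r + 1) N h 0 \<le> c r)} =
        (\<Union>r. {h. c r < cell_count (real r + 1) N h 0})" by (auto simp: not_le)
    then have "measure_pmf.prob (growing_graph N) {h. \<not> (\<forall>r. cell_count (real r + 1) N h 0 \<le> c r)} \<le>
        (\<Sum>r. measure_pmf.prob (growing_graph N) {h. c r < cell_count (real r + 1) N h 0})"
      using sm by (simp only:) (intro measure_pmf.finite_measure_subadditive_countably, auto)
    also have "\<dots> \<le> (\<Sum>r. \<epsilon> * (1/2) ^ Suc r)" using c sm s by (intro suminf_le sums_summable) auto
    also have "\<dots> = \<epsilon>" using sums_unique[OF s] by simp
    finally show ?thesis .
  qed
  then show thesis by (rule that)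
qed

text \<open>The limit is a full probability law on a countable type, so a finite set carries almost
  all of its mass. Convergence of the point probabilities on that set keeps the mass of
  \<open>V N\<close> from escaping, and a bounded \<open>\<phi>\<close> is controlled by a finite
  sum.\<close>

lemma expectation_tendsto_of_point_probs:
  fixes V :: "nat \<Rightarrow> 'h \<Rightarrow> 'b :: countable" and W :: "'w \<Rightarrow> 'b" and \<phi> :: "'b \<Rightarrow> real"
  assumes "prob_space M" and W: "W \<in> measurable M (count_space UNIV)"
    and conv: "\<And>v. (\<lambda>N. measure_pmf.prob (p N) {h. V N h = v}) \<longlonglongrightarrow> measure M {\<omega> \<in> space M. W \<omega> = v}"
    and \<phi>: "\<And>v. \<bar>\<phi> v\<bar> \<le> B"
  shows "(\<lambda>N. measure_pmf.expectation (p N) (\<lambda>h. \<phi> (V N h))) \<longlonglongrightarrow> (\<integral>\<omega>. \<phi> (W \<omega>) \<partial>M)"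
proof -
  interpret prob_space M by fact
  have B: "0 \<le> B" using \<phi>[of undefined] by linarith
  have ev: "{\<omega> \<in> space M. W \<omega> \<in> A} \<in> sets M" for A
    using measurable_sets[OF W, of A] by (simp add: vimage_def Int_def conj_commute)
  \<comment> \<open>Truncation to \<open>A\<close> costs at most \<open>B\<close> times the mass
    outside; the space is left open so that this applies to \<open>p N\<close> and to
    \<open>M\<close>.\<close>
  have bound: "\<bar>(\<integral>\<omega>. \<phi> (X \<omega>) \<partial>Q) - (\<Sum>v\<in>A. \<phi> v * measure Q {\<omega> \<in> space Q. X \<omega> = v})\<bar> \<le>
      B * (1 - (\<Sum>v\<in>A. measure Q {\<omega> \<in> space Q. X \<omega> = v}))"
    if Q: "prob_space Q" and X: "X \<in> measurable Q (count_space UNIV)" and A: "finite A"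
    for Q :: "'z measure" and X :: "'z \<Rightarrow> 'b" and A
  proof -
    interpret Q: prob_space Q by fact
    have ev: "{\<omega> \<in> space Q. X \<omega> \<in> S} \<in> sets Q" for S
      using measurable_sets[OF X, of S] by (simp add: vimage_def Int_def conj_commute)
    have ev1: "{\<omega> \<in> space Q. X \<omega> = v} \<in> sets Q" for v using ev[of "{v}"] by simp
    have int1: "integrable Q (\<lambda>\<omega>. \<phi> (X \<omega>))"
      using \<phi> X by (intro Q.integrable_const_bound[where B=B]) (auto intro: measurable_compose)
    have int2: "integrable Q (\<lambda>\<omega>. \<phi> v * indicator {\<omega> \<in> space Q. X \<omega> = v} \<omega>)" for v
      using ev1 by (intro integrable_mult_right integrable_real_indicator) (auto simp: Q.emeasure_eq_measure)
    have int3: "integrable Q (\<lambda>\<omega>. indicator {\<omega> \<in> space Q. X \<omega> = v} \<omega> :: real)" for v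
      using ev1 by (intro integrable_real_indicator) (auto simp: Q.emeasure_eq_measure)
    have "(\<integral>\<omega>. \<phi> (X \<omega>) \<partial>Q) - (\<Sum>v\<in>A. \<phi> v * measure Q {\<omega> \<in> space Q. X \<omega> = v}) =
        (\<integral>\<omega>. \<phi> (X \<omega>) - (\<Sum>v\<in>A. \<phi> v * indicator {\<omega> \<in> space Q. X \<omega> = v} \<omega>) \<partial>Q)"
      using int1 int2 ev1 by (simp add: sets.Int_space_eq2)
    also have "\<bar>\<dots>\<bar> \<le> (\<integral>\<omega>. \<bar>\<phi> (X \<omega>) - (\<Sum>v\<in>A. \<phi> v * indicator {\<omega> \<in> space Q. X \<omega> = v} \<omega>)\<bar> \<partial>Q)"
      by (rule integral_abs_bound)
    also have "\<dots> \<le> (\<integral>\<omega>. B * (1 - (\<Sum>v\<in>A. indicator {\<omega> \<in> space Q. X \<omega> = v} \<omega>)) \<partial>Q)"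
    proof (rule integral_mono)
      show "integrable Q (\<lambda>\<omega>. \<bar>\<phi> (X \<omega>) - (\<Sum>v\<in>A. \<phi> v * indicator {\<omega> \<in> space Q. X \<omega> = v} \<omega>)\<bar>)"
        using int1 int2 by simp
      show "integrable Q (\<lambda>\<omega>. B * (1 - (\<Sum>v\<in>A. indicator {\<omega> \<in> space Q. X \<omega> = v} \<omega>)))"
        using int3 by simp
      fix \<omega> assume \<omega>: "\<omega> \<in> space Q"
      have "(\<Sum>v\<in>A. g v * indicator {\<omega> \<in> space Q. X \<omega> = v} \<omega>) = (if X \<omega> \<in> A then g (X \<omega>) else 0)"
        for g :: "'b \<Rightarrow> real"
      proof -
        have "(\<Sum>v\<in>A. g v * indicator {\<omega> \<in> space Q. X \<omega> = v} \<omega>) = (\<Sum>v\<in>A. if X \<omega> = v then g v else 0)"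
          using \<omega> by (intro sum.cong) (auto simp: indicator_def)
        then show ?thesis using A by simp
      qed
      from this[of \<phi>] this[of "\<lambda>_. 1"]
      show "\<bar>\<phi> (X \<omega>) - (\<Sum>v\<in>A. \<phi> v * indicator {\<omega> \<in> space Q. X \<omega> = v} \<omega>)\<bar> \<le>
          B * (1 - (\<Sum>v\<in>A. indicator {\<omega> \<in> space Q. X \<omega> = v} \<omega>))"
        using \<phi>[of "X \<omega>"] by (simp split: if_splits)
    qed
    also have "\<dots> = B * (1 - (\<Sum>v\<in>A. measure Q {\<omega> \<in> space Q. X \<omega> = v}))"
      using int3 ev1 by (simp add: sets.Int_space_eq2 Q.prob_space)
    finally show ?thesis .
  qed
  show ?thesis
  proof (rule LIMSEQ_I)
    fix \<epsilon> :: real assume \<epsilon>: "0 < \<epsilon>"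
    define \<delta> where "\<delta> = \<epsilon> / (4 * (B + 1))"
    have \<delta>: "0 < \<delta>" "B * \<delta> < \<epsilon> / 4" using \<epsilon> B by (auto simp: \<delta>_def field_simps)
    define A where "A n = {v :: 'b. to_nat v \<le> n}" for n
    have finA: "finite (A n)" for n
    proof -
      have "A n = to_nat -` {..n}" by (auto simp: A_def)
      then show ?thesis by (simp add: finite_vimageI)
    qed
    have "(\<lambda>n. prob {\<omega> \<in> space M. W \<omega> \<in> A n}) \<longlonglongrightarrow> prob (\<Union>n. {\<omega> \<in> space M. W \<omega> \<in> A n})"
    proof (rule finite_Lim_measure_incseq)
      show "range (\<lambda>n. {\<omega> \<in> space M. W \<omega> \<in> A n}) \<subseteq> events" using ev by blast
      show "incseq (\<lambda>n. {\<omega> \<in> space M. W \<omega> \<in> A n})" by (auto simp: incseq_def A_def)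
    qed
    moreover have "(\<Union>n. {\<omega> \<in> space M. W \<omega> \<in> A n}) = space M" by (auto simp: A_def)
    ultimately have "(\<lambda>n. prob {\<omega> \<in> space M. W \<omega> \<in> A n}) \<longlonglongrightarrow> 1" by (simp add: prob_space)
    then have "\<forall>\<^sub>F n in sequentially. 1 - \<delta> < prob {\<omega> \<in> space M. W \<omega> \<in> A n}"
      using \<delta> by (intro order_tendstoD(1)) auto
    then obtain n where n: "1 - \<delta> < prob {\<omega> \<in> space M. W \<omega> \<in> A n}"
      using eventually_happens'[OF sequentially_bot] by blast
    let ?q = "\<lambda>v. prob {\<omega> \<in> space M. W \<omega> = v}"
    let ?p = "\<lambda>N v. measure_pmf.prob (p N) {h. V N h = v}"
    have "{\<omega> \<in> space M. W \<omega> \<in> A n} = (\<Union>v\<in>A n. {\<omega> \<in> space M. W \<omega> = v})" by auto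
    moreover have "prob (\<Union>v\<in>A n. {\<omega> \<in> space M. W \<omega> = v}) = (\<Sum>v\<in>A n. ?q v)"
      using finA ev[of "{_}"] by (intro finite_measure_finite_Union) (auto simp: disjoint_family_on_def)
    ultimately have q: "1 - \<delta> < (\<Sum>v\<in>A n. ?q v)" using n by simp
    have "(\<lambda>N. \<Sum>v\<in>A n. ?p N v) \<longlonglongrightarrow> (\<Sum>v\<in>A n. ?q v)" by (intro tendsto_sum conv)
    then have ev1: "\<forall>\<^sub>F N in sequentially. 1 - \<delta> < (\<Sum>v\<in>A n. ?p N v)"
      using q by (rule order_tendstoD(1))
    have lim2: "(\<lambda>N. \<Sum>v\<in>A n. \<phi> v * ?p N v) \<longlonglongrightarrow> (\<Sum>v\<in>A n. \<phi> v * ?q v)"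
      by (intro tendsto_sum tendsto_mult conv tendsto_const)
    have ev2: "\<forall>\<^sub>F N in sequentially. \<bar>(\<Sum>v\<in>A n. \<phi> v * ?p N v) - (\<Sum>v\<in>A n. \<phi> v * ?q v)\<bar> < \<epsilon> / 4"
      using tendstoD[OF lim2, of "\<epsilon> / 4"] \<epsilon> by (simp add: dist_real_def)
    have "\<forall>\<^sub>F N in sequentially.
        norm (measure_pmf.expectation (p N) (\<lambda>h. \<phi> (V N h)) - (\<integral>\<omega>. \<phi> (W \<omega>) \<partial>M)) < \<epsilon>"
      using ev1 ev2
    proof eventually_elim
      case (elim N)
      have "\<bar>(\<integral>\<omega>. \<phi> (W \<omega>) \<partial>M) - (\<Sum>v\<in>A n. \<phi> v * ?q v)\<bar> \<le> B * (1 - (\<Sum>v\<in>A n. ?q v))"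
        by (rule bound) (use W finA in \<open>auto intro: prob_space_axioms\<close>)
      also have "\<dots> \<le> B * \<delta>" using q B by (intro mult_left_mono) auto
      finally have 1: "\<bar>(\<integral>\<omega>. \<phi> (W \<omega>) \<partial>M) - (\<Sum>v\<in>A n. \<phi> v * ?q v)\<bar> \<le> B * \<delta>" .
      have "\<bar>measure_pmf.expectation (p N) (\<lambda>h. \<phi> (V N h)) - (\<Sum>v\<in>A n. \<phi> v * ?p N v)\<bar> \<le>
          B * (1 - (\<Sum>v\<in>A n. ?p N v))"
        using bound[of "measure_pmf (p N)" "V N" "A n"] finA by (simp add: measure_pmf.prob_space_axioms)
      also have "\<dots> \<le> B * \<delta>" using elim(1) B by (intro mult_left_mono) auto
      finally have 2: "\<bar>measure_pmf.expectation (p N) (\<lambda>h. \<phi> (V N h)) - (\<Sum>v\<in>A n. \<phi> v * ?p N v)\<bar> \<le> B * \<delta>" .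
      show ?case using 1 2 elim(2) \<delta>(2) unfolding real_norm_def by linarith
    qed
    then show "\<exists>n0. \<forall>N\<ge>n0. norm (measure_pmf.expectation (p N) (\<lambda>h. \<phi> (V N h)) - (\<integral>\<omega>. \<phi> (W \<omega>) \<partial>M)) < \<epsilon>"
      by (simp add: eventually_sequentially)
  qed
qed

section \<open>Comparison with the Poisson process\<close>

lemma measure_lborel_cell: "0 < a \<Longrightarrow> measure lborel (cell a i) = a"
  by (simp add: cell_def algebra_simps)

lemma disjoint_cells: "0 < a \<Longrightarrow> disjoint_family_on (cell a) I"
  by (auto simp: disjoint_family_on_def cell_iff)

lemma poisson_process_cell_counts:
  assumes \<xi>: "homogeneous_poisson_process 1 M \<xi>" and a: "0 < a" and d: "0 < d"
  shows "(\<lambda>\<omega>. measure (\<xi> \<omega>) (cell a i)) \<in> borel_measurable M"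
    and "measure M {\<omega> \<in> space M. \<forall>i<d. measure (\<xi> \<omega>) (cell a i) = real (c i)} =
      (\<Prod>i<d. poisson_weight a (c i))"
proof -
  interpret prob_space M using \<xi> by (simp add: homogeneous_poisson_process_def)
  have cell: "cell a i \<in> sets half_line" "bounded (cell a i)" for i
    using cell_half_line[OF a] bounded_cell by auto
  have indep: "indep_vars (\<lambda>_. borel) (\<lambda>i \<omega>. measure (\<xi> \<omega>) (cell a i)) {..<m}" for m
  proof -
    have "\<forall>(B :: nat \<Rightarrow> real set) m.
        (\<forall>i<m. B i \<in> sets half_line \<and> bounded (B i)) \<and> disjoint_family_on B {..<m} \<longrightarrow>
        indep_vars (\<lambda>_. borel) (\<lambda>i \<omega>. measure (\<xi> \<omega>) (B i)) {..<m}"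
      using \<xi> unfolding homogeneous_poisson_process_def by (elim conjE)
    then show ?thesis using cell disjoint_cells[OF a] by simp
  qed
  \<comment> \<open>Measurability of a single count is contained in the independence of the first
    \<open>Suc i\<close> counts.\<close>
  show meas: "(\<lambda>\<omega>. measure (\<xi> \<omega>) (cell a i)) \<in> borel_measurable M" for i
    using indep[of "Suc i"] unfolding indep_vars_def by blast
  have "{\<omega> \<in> space M. \<forall>i<d. measure (\<xi> \<omega>) (cell a i) = real (c i)} =
      (\<Inter>i\<in>{..<d}. (\<lambda>\<omega>. measure (\<xi> \<omega>) (cell a i)) -` {real (c i)} \<inter> space M)"
    using d by auto
  also have "prob \<dots> = (\<Prod>i<d. prob ((\<lambda>\<omega>. measure (\<xi> \<omega>) (cell a i)) -` {real (c i)} \<inter> space M))"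
    using d by (intro indep_varsD_finite[OF indep]) auto
  also have "\<dots> = (\<Prod>i<d. poisson_weight a (c i))"
  proof (rule prod.cong[OF refl])
    fix i
    have "prob {\<omega> \<in> space M. measure (\<xi> \<omega>) (cell a i) = real (c i)} =
        (1 * measure lborel (cell a i)) ^ c i / fact (c i) * exp (- (1 * measure lborel (cell a i)))"
    proof -
      have "\<forall>B\<in>sets half_line. bounded B \<longrightarrow> (\<forall>k::nat. prob {\<omega> \<in> space M. measure (\<xi> \<omega>) B = real k} =
           (1 * measure lborel B) ^ k / fact k * exp (- (1 * measure lborel B)))"
        using \<xi> unfolding homogeneous_poisson_process_def by (elim conjE)
      then show ?thesis using cell[of i] by blast
    qed
    then show "prob ((\<lambda>\<omega>. measure (\<xi> \<omega>) (cell a i)) -` {real (c i)} \<inter> space M) = poisson_weight a (c i)"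
      by (simp add: measure_lborel_cell[OF a] poisson_weight_def vimage_def Int_def conj_commute)
  qed
  finally show "prob {\<omega> \<in> space M. \<forall>i<d. measure (\<xi> \<omega>) (cell a i) = real (c i)} =
      (\<Prod>i<d. poisson_weight a (c i))" .
qed

theorem theorem6:
  fixes M :: "'a measure" and \<xi> :: "'a \<Rightarrow> real measure"
  assumes "homogeneous_poisson_process 1 M \<xi>"
  shows "converges_in_distribution vague_topology
           (\<lambda>N. measure_pmf (growing_graph N)) scaled_point_process M \<xi>"
  unfolding converges_in_distribution_def
proof (intro conjI allI impI)
  have space_vague: "space (borel_measure_of vague_topology) = point_measures"
    by (simp add: borel_measure_of_def topspace_vague_topology space_measure_of_conv)
  interpret prob_space M using assms by (simp add: homogeneous_poisson_process_def)
  have \<xi>_meas: "\<xi> \<in> measurable M (borel_measure_of vague_topology)"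
    using assms by (simp add: homogeneous_poisson_process_def)
  then show "\<xi> \<in> measurable M (borel_measure_of vague_topology)" .
  show "prob_space M" by (rule prob_space_axioms)
  show "prob_space (measure_pmf (growing_graph N))" for N
    by (rule measure_pmf.prob_space_axioms)
  \<comment> \<open>The space of histories is discrete, so it only has to be checked that every
    history is mapped to a point measure.\<close>
  show "scaled_point_process N \<in> measurable (measure_pmf (growing_graph N)) (borel_measure_of vague_topology)" for N
    by (simp add: space_vague scaled_point_process_point_measures)
  have \<xi>_pm: "\<xi> \<omega> \<in> point_measures" if "\<omega> \<in> space M" for \<omega>
    using measurable_space[OF \<xi>_meas that] by (simp add: space_vague)
  fix F :: "real measure \<Rightarrow> real"
  assume asm: "continuous_map vague_topology euclideanreal F \<and> bounded (F ` topspace vague_topology)"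
  then have F: "continuous_map vague_topology euclideanreal F" by blast
  obtain B where B: "0 < B" "\<And>\<mu>. \<mu> \<in> point_measures \<Longrightarrow> \<bar>F \<mu>\<bar> \<le> B"
    using asm unfolding bounded_pos topspace_vague_topology by auto
  have F_meas: "F \<in> borel_measurable (borel_measure_of vague_topology)"
  proof (rule borel_measurableI)
    fix S :: "real set" assume "open S"
    then have "openin vague_topology {\<mu> \<in> topspace vague_topology. F \<mu> \<in> S}"
      using F by (auto simp: continuous_map)
    moreover have "F -` S \<inter> space (borel_measure_of vague_topology) = {\<mu> \<in> topspace vague_topology. F \<mu> \<in> S}"
      by (auto simp: space_vague topspace_vague_topology)
    moreover have "{U. openin vague_topology U} \<subseteq> Pow (topspace vague_topology)"
      using openin_subset by blast
    ultimately show "F -` S \<inter> space (borel_measure_of vague_topology) \<in> sets (borel_measure_of vague_topology)"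
      by (simp add: borel_measure_of_def sets_measure_of)
  qed
  define d where "d K = (K + 1)\<^sup>2" for K :: nat
  \<comment> \<open>Cell counts are encoded as lists of naturals, a countable type to which
    \<open>expectation_tendsto_of_point_probs\<close> applies.\<close>
  define val where "val K v = F (grid_measure (mesh K) (d K) (\<lambda>i. v ! i))" for K and v :: "nat list"
  have val: "\<bar>val K v\<bar> \<le> B" for K v
    unfolding val_def by (rule B(2)) (rule grid_measure_point_measures[OF mesh_pos])
  define V where "V K N h = map (cell_count (mesh K) N h) [0..<d K]" for K N h
  define W where "W K \<omega> = map (\<lambda>i. nat \<lfloor>measure (\<xi> \<omega>) (cell (mesh K) i)\<rfloor>) [0..<d K]" for K \<omega>
  have valV: "val K (V K N h) = F (mesh_measure K (scaled_point_process N h))"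
    if "h \<in> set_pmf (growing_graph N)" for K N h
    unfolding val_def V_def mesh_measure_scaled_point_process[OF that] d_def[symmetric]
    by (intro arg_cong[of _ _ F] grid_measure_cong) simp
  have valW: "val K (W K \<omega>) = F (mesh_measure K (\<xi> \<omega>))" for K \<omega>
    unfolding val_def W_def mesh_measure_def d_def[symmetric]
    by (intro arg_cong[of _ _ F] grid_measure_cong) simp
  have W_eq: "{\<omega> \<in> space M. W K \<omega> = v} = (if length v = d K
      then {\<omega> \<in> space M. \<forall>i<d K. measure (\<xi> \<omega>) (cell (mesh K) i) = real (v ! i)} else {})" for K v
  proof -
    have "nat \<lfloor>measure (\<xi> \<omega>) (cell (mesh K) i)\<rfloor> = k \<longleftrightarrow> measure (\<xi> \<omega>) (cell (mesh K) i) = real k"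
      if "\<omega> \<in> space M" for \<omega> i k
      using point_measures_measure(2)[OF \<xi>_pm[OF that] cell_half_line[OF mesh_pos] bounded_cell, of K i]
      by auto
    then show ?thesis by (auto simp: W_def list_eq_iff_nth_eq)
  qed
  have dpos: "0 < d K" for K by (simp add: d_def)
  note count = poisson_process_cell_counts[OF assms mesh_pos dpos]
  have W_meas: "W K \<in> measurable M (count_space UNIV)" for K
  proof -
    have 1: "W K -` {v} \<inter> space M = {\<omega> \<in> space M. W K \<omega> = v}" for v by auto
    have 2: "{\<omega> \<in> space M. \<forall>i<d K. measure (\<xi> \<omega>) (cell (mesh K) i) = real (v ! i)} =
        (\<Inter>i\<in>{..<d K}. (\<lambda>\<omega>. measure (\<xi> \<omega>) (cell (mesh K) i)) -` {real (v ! i)} \<inter> space M)" for v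
      using dpos[of K] by auto
    have 3: "{\<omega> \<in> space M. \<forall>i<d K. measure (\<xi> \<omega>) (cell (mesh K) i) = real (v ! i)} \<in> sets M" for v
      unfolding 2
    proof (rule sets.finite_INT)
      show "{..<d K} \<noteq> {}" using dpos[of K] by blast
      show "(\<lambda>\<omega>. measure (\<xi> \<omega>) (cell (mesh K) i)) -` {real (v ! i)} \<inter> space M \<in> sets M" for i
        by (rule measurable_sets[OF count(1)]) simp
    qed simp
    have "W K -` {v} \<inter> space M \<in> sets M" for v
    proof (cases "length v = d K")
      case True
      then have "W K -` {v} \<inter> space M = {\<omega> \<in> space M. \<forall>i<d K. measure (\<xi> \<omega>) (cell (mesh K) i) = real (v ! i)}"
        unfolding 1 by (intro trans[OF W_eq if_P])
      then show ?thesis using 3[of v] by (simp only:)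
    next
      case False
      then have "W K -` {v} \<inter> space M = {}" unfolding 1 by (intro trans[OF W_eq if_not_P])
      then show ?thesis by (simp only: sets.empty_sets)
    qed
    then show ?thesis unfolding measurable_count_space_eq2_countable by blast
  qed
  have conv: "(\<lambda>N. measure_pmf.prob (growing_graph N) {h. V K N h = v}) \<longlonglongrightarrow> prob {\<omega> \<in> space M. W K \<omega> = v}"
    for K v
  proof (cases "length v = d K")
    case True
    have 1: "{h. V K N h = v} = {h. \<forall>i<d K. cell_count (mesh K) N h i = v ! i}" for N
      using True by (auto simp: V_def list_eq_iff_nth_eq)
    have 2: "prob {\<omega> \<in> space M. W K \<omega> = v} = (\<Prod>i<d K. poisson_weight (mesh K) (v ! i))"
      using True unfolding W_eq by (simp add: count(2))
    show ?thesis unfolding 1 2 by (rule cell_count_tendsto_poisson[OF mesh_pos])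
  next
    case False
    then have 1: "{h. V K N h = v} = {}" for N by (auto simp: V_def)
    have 2: "{\<omega> \<in> space M. W K \<omega> = v} = {}" using False by (simp add: W_eq)
    show ?thesis unfolding 1 2 by simp
  qed
  have mid: "(\<lambda>N. measure_pmf.expectation (growing_graph N) (\<lambda>h. val K (V K N h))) \<longlonglongrightarrow>
      (\<integral>\<omega>. val K (W K \<omega>) \<partial>M)" for K
    by (rule expectation_tendsto_of_point_probs[where V = "V K" and W = "W K" and \<phi> = "val K" and B = B
          and p = growing_graph, OF prob_space_axioms W_meas conv val])
  \<comment> \<open>For each outcome the discretisations of \<open>\<xi> \<omega>\<close> converge
    vaguely to it as the grid is refined, and \<open>F\<close> is bounded.\<close>
  have right: "(\<lambda>K. \<integral>\<omega>. val K (W K \<omega>) \<partial>M) \<longlonglongrightarrow> (\<integral>\<omega>. F (\<xi> \<omega>) \<partial>M)"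
  proof (rule integral_dominated_convergence[where w = "\<lambda>_. B"])
    show "(\<lambda>\<omega>. F (\<xi> \<omega>)) \<in> borel_measurable M" by (rule measurable_compose[OF \<xi>_meas F_meas])
    show "(\<lambda>\<omega>. val K (W K \<omega>)) \<in> borel_measurable M" for K
      by (rule measurable_compose[OF W_meas]) simp
    show "AE \<omega> in M. (\<lambda>K. val K (W K \<omega>)) \<longlonglongrightarrow> F (\<xi> \<omega>)"
    proof (rule AE_I2)
      fix \<omega> assume "\<omega> \<in> space M"
      then have \<omega>: "\<xi> \<omega> \<in> point_measures" by (rule \<xi>_pm)
      show "(\<lambda>K. val K (W K \<omega>)) \<longlonglongrightarrow> F (\<xi> \<omega>)"
        unfolding valW
        by (intro continuous_map_vague_tendsto[OF F mesh_measure_point_measures \<omega>]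
            mesh_measure_integral_tendsto[where c = "\<lambda>r. measure (\<xi> \<omega>) {0..real r}"])
          (use \<omega> in \<open>auto simp: filterlim_ident\<close>)
    qed
  qed (use val in auto)
  show "(\<lambda>N. \<integral>h. F (scaled_point_process N h) \<partial>measure_pmf (growing_graph N)) \<longlonglongrightarrow> (\<integral>\<omega>. F (\<xi> \<omega>) \<partial>M)"
  proof (rule LIMSEQ_I)
    fix \<epsilon> :: real assume \<epsilon>: "0 < \<epsilon>"
    \<comment> \<open>Four quarters of \<open>\<epsilon>\<close> are spent: on discretising at
      finite \<open>N\<close> inside the tight set, on its complement, where the values differ by at
      most \<open>2 * B\<close>, on convergence for a fixed grid, and on discretising the
      limit.\<close>
    define \<delta> where "\<delta> = \<epsilon> / (8 * B)"
    have \<delta>: "0 < \<delta>" "2 * B * \<delta> = \<epsilon> / 4" using \<epsilon> B(1) by (auto simp: \<delta>_def)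
    obtain c where c: "\<And>N. measure_pmf.prob (growing_graph N)
        {h. \<not> (\<forall>r. cell_count (real r + 1) N h 0 \<le> c r)} \<le> \<delta>"
      using cell_counts_tight[OF \<delta>(1)] by blast
    have \<epsilon>4: "0 < \<epsilon> / 4" using \<epsilon> by simp
    obtain K0 where K0: "\<And>K N h. K0 \<le> K \<Longrightarrow> h \<in> set_pmf (growing_graph N) \<Longrightarrow>
        (\<forall>r. cell_count (real r + 1) N h 0 \<le> c r) \<Longrightarrow>
        \<bar>F (mesh_measure K (scaled_point_process N h)) - F (scaled_point_process N h)\<bar> < \<epsilon> / 4"
      using mesh_measure_uniform[OF F \<epsilon>4, of c] by blast
    have "\<forall>\<^sub>F K in sequentially. \<bar>(\<integral>\<omega>. val K (W K \<omega>) \<partial>M) - (\<integral>\<omega>. F (\<xi> \<omega>) \<partial>M)\<bar> < \<epsilon> / 4"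
      using tendstoD[OF right \<epsilon>4] by (simp add: dist_real_def)
    \<comment> \<open>The grid is fixed before \<open>N\<close> grows, which is possible because
      \<open>K0\<close> serves all \<open>N\<close> at once.\<close>
    then obtain K where K: "K0 \<le> K" "\<bar>(\<integral>\<omega>. val K (W K \<omega>) \<partial>M) - (\<integral>\<omega>. F (\<xi> \<omega>) \<partial>M)\<bar> < \<epsilon> / 4"
      unfolding eventually_sequentially by (metis nle_le)
    have left: "\<bar>(\<integral>h. F (scaled_point_process N h) \<partial>measure_pmf (growing_graph N)) -
        measure_pmf.expectation (growing_graph N) (\<lambda>h. val K (V K N h))\<bar> \<le> \<epsilon> / 4 + \<epsilon> / 4" for N
    proof -
      let ?p = "measure_pmf (growing_graph N)"
      let ?X = "{h. \<not> (\<forall>r. cell_count (real r + 1) N h 0 \<le> c r)}"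
      have FB: "\<bar>F (scaled_point_process N h)\<bar> \<le> B" for h
        by (rule B(2)) (rule scaled_point_process_point_measures)
      have i1: "integrable ?p (\<lambda>h. F (scaled_point_process N h))"
        using FB by (intro measure_pmf.integrable_const_bound[where B=B]) auto
      have i2: "integrable ?p (\<lambda>h. val K (V K N h))"
        using val by (intro measure_pmf.integrable_const_bound[where B=B]) auto
      have i3: "integrable ?p (\<lambda>h. \<epsilon> / 4 + 2 * B * indicator ?X h)"
        by (intro Bochner_Integration.integrable_add integrable_mult_right integrable_real_indicator)
          (auto simp: measure_pmf.emeasure_eq_measure)
      have "\<bar>(\<integral>h. F (scaled_point_process N h) \<partial>?p) - (\<integral>h. val K (V K N h) \<partial>?p)\<bar> =
          \<bar>\<integral>h. F (scaled_point_process N h) - val K (V K N h) \<partial>?p\<bar>"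
        using i1 i2 by simp
      also have "\<dots> \<le> (\<integral>h. \<bar>F (scaled_point_process N h) - val K (V K N h)\<bar> \<partial>?p)"
        by (rule integral_abs_bound)
      also have "\<dots> \<le> (\<integral>h. \<epsilon> / 4 + 2 * B * indicator ?X h \<partial>?p)"
      proof (rule integral_mono_AE)
        show "integrable ?p (\<lambda>h. \<bar>F (scaled_point_process N h) - val K (V K N h)\<bar>)"
          using i1 i2 by simp
        show "AE h in ?p. \<bar>F (scaled_point_process N h) - val K (V K N h)\<bar> \<le> \<epsilon> / 4 + 2 * B * indicator ?X h"
          unfolding AE_measure_pmf_iff
        proof
          fix h assume h: "h \<in> set_pmf (growing_graph N)"
          show "\<bar>F (scaled_point_process N h) - val K (V K N h)\<bar> \<le> \<epsilon> / 4 + 2 * B * indicator ?X h"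
          proof (cases "h \<in> ?X")
            case True
            then show ?thesis using FB[of h] val[of K "V K N h"] \<epsilon> by simp
          next
            case False
            then have "\<forall>r. cell_count (real r + 1) N h 0 \<le> c r" by blast
            from K0[OF K(1) h this] show ?thesis
              using False by (simp add: valV[OF h] abs_minus_commute)
          qed
        qed
      qed (rule i3)
      also have "\<dots> = \<epsilon> / 4 + 2 * B * measure_pmf.prob (growing_graph N) ?X"
        by (subst Bochner_Integration.integral_add)
          (auto simp: measure_pmf.emeasure_eq_measure measure_pmf.prob_space intro!: integrable_real_indicator)
      also have "\<dots> \<le> \<epsilon> / 4 + 2 * B * \<delta>" using c[of N] B(1) by (intro add_left_mono mult_left_mono) auto
      finally show ?thesis using \<delta>(2) by simp
    qed
    have "\<forall>\<^sub>F N in sequentially. \<bar>measure_pmf.expectation (growing_graph N) (\<lambda>h. val K (V K N h)) -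
        (\<integral>\<omega>. val K (W K \<omega>) \<partial>M)\<bar> < \<epsilon> / 4"
      using tendstoD[OF mid[of K] \<epsilon>4] by (simp add: dist_real_def)
    then have "\<forall>\<^sub>F N in sequentially. norm ((\<integral>h. F (scaled_point_process N h) \<partial>measure_pmf (growing_graph N)) -
        (\<integral>\<omega>. F (\<xi> \<omega>) \<partial>M)) < \<epsilon>"
    proof eventually_elim
      case (elim N)
      then show ?case using left[of N] K(2) unfolding real_norm_def by linarith
    qed
    then show "\<exists>n0. \<forall>N\<ge>n0. norm ((\<integral>h. F (scaled_point_process N h) \<partial>measure_pmf (growing_graph N)) -
        (\<integral>\<omega>. F (\<xi> \<omega>) \<partial>M)) < \<epsilon>"
      by (simp add: eventually_sequentially)
  qed
qed

end
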